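(* Let $R\subset S$ be an extension of commutative unital rings having FCP. Then $\ell[R,S]=\ell[R(X),S(X)]$.
   Context: All rings are commutative and unital. For a ring extension $R\subseteq S$, $[R,S]$ denotes the set of all $R$-subalgebras of $S$ (i.e. rings $T$ with $R\subseteq T\subseteq S$), ordered by inclusion. The extension has FCP if every chain in $[R,S]$ is finite. The length $\ell[R,S]$ is the supremum of the lengths of chains in $[R,S]$, where a chain $R_0\subset R_1\subset\cdots\subset R_n$ has length $n$. For a ring $R$ and an indeterminate $X$, the Nagata ring of $R$ is $R(X):=R[X]_{\Sigma_R}$, where $\Sigma_R$ is the multiplicatively closed set of polynomials in $R[X]$ whose coefficients generate the unit ideal $R$; an extension $R\subseteq S$ induces an extension $R(X)\subseteq S(X)$. *)

theory Defs
  imports "HOL-Algebra.UnivPoly" "HOL-Algebra.Subrings" "HOL-Library.Extended_Nat"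
begin

text \<open>
  A ring extension is given by a commutative ring \<open>S\<close> and a subring \<open>R\<close> of \<open>S\<close>, as a set;
  as a ring in its own right, the base of the extension is \<open>S\<lparr>carrier := R\<rparr>\<close>.
\<close>

section \<open>Intermediate rings, FCP and length\<close>

definition intermediate_rings :: "'a set \<Rightarrow> ('a, 'm) ring_scheme \<Rightarrow> 'a set set" where
  "intermediate_rings R S = {T. subring T S \<and> R \<subseteq> T}"

definition FCP :: "'a set \<Rightarrow> ('a, 'm) ring_scheme \<Rightarrow> bool" where
  "FCP R S \<longleftrightarrow> (\<forall>\<C>. subset.chain (intermediate_rings R S) \<C> \<longrightarrow> finite \<C>)"

definition ext_length :: "'a set \<Rightarrow> ('a, 'm) ring_scheme \<Rightarrow> enat" where
  "ext_length R S = Sup {enat n | n T.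
     (\<forall>i\<le>n. T i \<in> intermediate_rings R S) \<and> (\<forall>i<n. T i \<subset> T (Suc i))}"


section \<open>Localization at a multiplicatively closed set\<close>

definition frac_rel :: "('a, 'm) ring_scheme \<Rightarrow> 'a set \<Rightarrow> (('a \<times> 'a) \<times> ('a \<times> 'a)) set" where
  "frac_rel A M = {((a, s), (b, t)). a \<in> carrier A \<and> s \<in> M \<and> b \<in> carrier A \<and> t \<in> M \<and>
     (\<exists>u\<in>M. u \<otimes>\<^bsub>A\<^esub> (t \<otimes>\<^bsub>A\<^esub> a) = u \<otimes>\<^bsub>A\<^esub> (s \<otimes>\<^bsub>A\<^esub> b))}"

definition mk_frac :: "('a, 'm) ring_scheme \<Rightarrow> 'a set \<Rightarrow> 'a \<Rightarrow> 'a \<Rightarrow> ('a \<times> 'a) set" where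
  "mk_frac A M a s = frac_rel A M `` {(a, s)}"

text \<open>
  The operations are given on representatives: each union below is over equal sets, so it
  picks out the common value.
\<close>

definition localization :: "('a, 'm) ring_scheme \<Rightarrow> 'a set \<Rightarrow> ('a \<times> 'a) set ring" where
  "localization A M = \<lparr>
     carrier = (carrier A \<times> M) // frac_rel A M,
     mult = (\<lambda>x y. \<Union>(a, s)\<in>x. \<Union>(b, t)\<in>y. mk_frac A M (a \<otimes>\<^bsub>A\<^esub> b) (s \<otimes>\<^bsub>A\<^esub> t)),
     one = mk_frac A M \<one>\<^bsub>A\<^esub> \<one>\<^bsub>A\<^esub>,
     zero = mk_frac A M \<zero>\<^bsub>A\<^esub> \<one>\<^bsub>A\<^esub>,
     add = (\<lambda>x y. \<Union>(a, s)\<in>x. \<Union>(b, t)\<in>y.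
       mk_frac A M (a \<otimes>\<^bsub>A\<^esub> t \<oplus>\<^bsub>A\<^esub> b \<otimes>\<^bsub>A\<^esub> s) (s \<otimes>\<^bsub>A\<^esub> t))\<rparr>"


section \<open>Nagata rings\<close>

definition unit_content_polys :: "('a, 'm) ring_scheme \<Rightarrow> (nat \<Rightarrow> 'a) set" where
  "unit_content_polys A =
     {f \<in> carrier (UP A). Idl\<^bsub>A\<^esub> (range (coeff (UP A) f)) = carrier A}"

definition nagata :: "('a, 'm) ring_scheme \<Rightarrow> ((nat \<Rightarrow> 'a) \<times> (nat \<Rightarrow> 'a)) set ring" where
  "nagata A = localization (UP A) (unit_content_polys A)"

text \<open>
  The canonical map \<open>R(X) \<rightarrow> S(X)\<close>, \<open>f/g \<mapsto> f/g\<close>; again the union is over equal sets.  The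
  extension \<open>R(X) \<subseteq> S(X)\<close> is \<open>S(X)\<close> together with the image of this (injective) map.
\<close>

definition nagata_map ::
  "('a, 'm) ring_scheme \<Rightarrow> ((nat \<Rightarrow> 'a) \<times> (nat \<Rightarrow> 'a)) set \<Rightarrow> ((nat \<Rightarrow> 'a) \<times> (nat \<Rightarrow> 'a)) set" where
  "nagata_map S x = (\<Union>(f, g)\<in>x. mk_frac (UP S) (unit_content_polys S) f g)"

definition nagata_base ::
  "'a set \<Rightarrow> ('a, 'm) ring_scheme \<Rightarrow> ((nat \<Rightarrow> 'a) \<times> (nat \<Rightarrow> 'a)) set set" where
  "nagata_base R S = nagata_map S ` carrier (nagata (S\<lparr>carrier := R\<rparr>))"

end

theory Submission
  imports Defs "HOL-Computational_Algebra.Polynomial"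
begin

text \<open>
  A ring between \<open>R(X)\<close> and \<open>S(X)\<close> is determined by the polynomials \<open>W \<subseteq> S[X]\<close> it contains, because every
  polynomial over \<open>S\<close> with unit content divides one over \<open>R\<close> with unit content.  Let \<open>B\<close> be the integral
  closure of \<open>R\<close> in \<open>S\<close>.  A chain of such \<open>W\<close> is sent to two chains: the rings of leading coefficients of
  \<open>W \<inter> B[X]\<close>, which lie between \<open>R\<close> and \<open>B\<close>, and the rings of constants in the saturation of \<open>W B[X]\<close>, which
  lie between \<open>B\<close> and \<open>S\<close>.  At each step of the chain one of the two grows strictly: over \<open>R \<subseteq> B\<close> because
  \<open>B / R\<close> has finite length, over \<open>B \<subseteq> S\<close> because this extension is Pruefer, so that a saturated ring contains
  the coefficients of its polynomials, and in the mixed case because \<open>B\<close> is zero-dimensional modulo the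
  conductor.  Concatenating the two chains gives \<open>\<ell>[R(X),S(X)] \<le> \<ell>[R,S]\<close>.  Conversely \<open>T \<mapsto> T(X)\<close> is strictly
  monotone by McCoy's theorem.
\<close>

text \<open>Not every ring between \<open>R(X)\<close> and \<open>S(X)\<close> has the form
  \<open>T(X)\<close>: if \<open>R\<close> is a field \<open>k\<close> and
  \<open>S = k[u, v]\<close> with \<open>u^2 = u v = v^2 = 0\<close>, then
  \<open>k(X) + k(X) (u + X v)\<close> contains neither \<open>u\<close> nor \<open>v\<close>. So an
  intermediate ring need not contain the coefficients of its elements. Leading coefficients still
  form a ring, and they detect growth where finite length bounds the degrees involved; hence the
  splitting of a chain at the integral closure. That this closure has finite length over
  \<open>R\<close> is not proved beforehand: \<open>B\<close> is chosen as a maximal ring of finite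
  length over \<open>R\<close> and then shown to be integrally closed. Finite length means a finite
  sequence of simple steps and is never a number. One induction over such a sequence,
  \<open>steps_stabilise\<close>, supplies integral equations, the stabilisation of leading
  coefficients and the monic multiples. Localization is kept out until the end: saturated sets of
  polynomials replace rings of fractions, and McCoy's theorem cancels unit content
  polynomials.\<close>

hide_const (open) up_ring.coeff up_ring.monom

section \<open>Polynomials over subrings and their contents\<close>

definition subr :: "'a::comm_ring_1 set \<Rightarrow> bool" where
  "subr A \<longleftrightarrow> 1 \<in> A \<and> (\<forall>x\<in>A. \<forall>y\<in>A. x - y \<in> A \<and> x * y \<in> A)"

definition smod :: "'a::comm_ring_1 set \<Rightarrow> 'a set \<Rightarrow> bool" where
  "smod A N \<longleftrightarrow> 0 \<in> N \<and> (\<forall>x\<in>N. \<forall>y\<in>N. x + y \<in> N) \<and> (\<forall>a\<in>A. \<forall>x\<in>N. a * x \<in> N)"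

definition polys :: "'a::comm_ring_1 set \<Rightarrow> 'a poly set" where
  "polys A = {f. \<forall>i. coeff f i \<in> A}"

text \<open>Unit content witnessed by a single product: a linear combination of the coefficients of
  \<open>g\<close> is a coefficient of \<open>g * h\<close> when \<open>h\<close> lists the scalars
  in reverse order.\<close>

definition unit_polys :: "'a::comm_ring_1 set \<Rightarrow> 'a poly set" where
  "unit_polys A = {g \<in> polys A. \<exists>h\<in>polys A. \<exists>n. coeff (g * h) n = 1}"

lemma subrD:
  assumes "subr A"
  shows "1 \<in> A" "0 \<in> A" "x \<in> A \<Longrightarrow> y \<in> A \<Longrightarrow> x - y \<in> A" "x \<in> A \<Longrightarrow> y \<in> A \<Longrightarrow> x * y \<in> A"
    "x \<in> A \<Longrightarrow> - x \<in> A" "x \<in> A \<Longrightarrow> y \<in> A \<Longrightarrow> x + y \<in> A"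
proof -
  show 1: "1 \<in> A" and d: "x \<in> A \<Longrightarrow> y \<in> A \<Longrightarrow> x - y \<in> A" and "x \<in> A \<Longrightarrow> y \<in> A \<Longrightarrow> x * y \<in> A" for x y
    using assms by (auto simp: subr_def)
  show 0: "0 \<in> A" using d[OF 1 1] by simp
  show n: "x \<in> A \<Longrightarrow> - x \<in> A" for x using d[OF 0] by force
  show "x \<in> A \<Longrightarrow> y \<in> A \<Longrightarrow> x + y \<in> A" using d[of x "-y"] n[of y] by simp
qed

lemma subr_power: "subr A \<Longrightarrow> x \<in> A \<Longrightarrow> x ^ n \<in> A"
  by (induction n) (auto intro: subrD)

lemma subr_Int: "subr A \<Longrightarrow> subr B \<Longrightarrow> subr (A \<inter> B)"
  by (auto simp: subr_def)

lemma smodD: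
  assumes "smod A N"
  shows "0 \<in> N" "x \<in> N \<Longrightarrow> y \<in> N \<Longrightarrow> x + y \<in> N" "a \<in> A \<Longrightarrow> x \<in> N \<Longrightarrow> a * x \<in> N"
  using assms by (auto simp: smod_def)

lemma smod_uminus: "smod A N \<Longrightarrow> subr A \<Longrightarrow> x \<in> N \<Longrightarrow> - x \<in> N"
  using smodD(3)[of A N "-1" x] subrD(5)[of A 1] subrD(1)[of A] by simp

lemma smod_diff: "smod A N \<Longrightarrow> subr A \<Longrightarrow> x \<in> N \<Longrightarrow> y \<in> N \<Longrightarrow> x - y \<in> N"
  using smodD(2)[of A N x "-y"] smod_uminus[of A N y] by simp

lemma smod_sum: "smod A N \<Longrightarrow> (\<And>i. i \<in> I \<Longrightarrow> f i \<in> N) \<Longrightarrow> sum f I \<in> N"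
  by (induction I rule: infinite_finite_induct) (auto intro: smodD)

lemma smod_self: "subr A \<Longrightarrow> smod A A"
  by (auto simp: smod_def intro: subrD)

lemma smod_mono: "smod B N \<Longrightarrow> A \<subseteq> B \<Longrightarrow> smod A N"
  by (auto simp: smod_def)

lemma smod_subr: "subr T \<Longrightarrow> A \<subseteq> T \<Longrightarrow> smod A T"
  using smod_mono smod_self by blast

lemma smod_zero: "smod A {0}"
  by (auto simp: smod_def)

lemma smod_Int: "smod A M \<Longrightarrow> smod A N \<Longrightarrow> smod A (M \<inter> N)"
  by (auto simp: smod_def)

lemma polysD: "f \<in> polys A \<Longrightarrow> coeff f i \<in> A"
  by (auto simp: polys_def)

lemma polysI: "(\<And>i. coeff f i \<in> A) \<Longrightarrow> f \<in> polys A"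
  by (auto simp: polys_def)

lemma polys_mono: "A \<subseteq> B \<Longrightarrow> polys A \<subseteq> polys B"
  by (auto simp: polys_def)

lemma polys_monom: "0 \<in> A \<Longrightarrow> c \<in> A \<Longrightarrow> monom c n \<in> polys A"
  by (auto simp: polys_def)

lemma polys_mult: "smod A N \<Longrightarrow> f \<in> polys A \<Longrightarrow> g \<in> polys N \<Longrightarrow> f * g \<in> polys N"
  by (intro polysI) (auto simp: coeff_mult intro!: smod_sum smodD(3) polysD)

lemma smod_polys: "smod A N \<Longrightarrow> smod (polys A) (polys N)"
  unfolding smod_def[of "polys A"]
  by (auto intro: polys_mult) (auto simp: polys_def smod_def)

lemma subr_polys: "subr A \<Longrightarrow> subr (polys A)"
  unfolding subr_def[of "polys A"]
  by (auto intro: polys_mult smod_self) (auto simp: polys_def subrD coeff_pCons split: nat.splits)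

lemma polys_const: "0 \<in> A \<Longrightarrow> [:c:] \<in> polys A \<longleftrightarrow> c \<in> A"
  by (auto simp: polys_def coeff_pCons split: nat.splits)

lemma polys_smult: "smod A N \<Longrightarrow> c \<in> A \<Longrightarrow> f \<in> polys N \<Longrightarrow> smult c f \<in> polys N"
  by (auto simp: polys_def smodD)

lemma polys_smult': "smod A N \<Longrightarrow> c \<in> N \<Longrightarrow> f \<in> polys A \<Longrightarrow> smult c f \<in> polys N"
  proof (rule polysI)
  fix i
  assume "smod A N" "c \<in> N" "f \<in> polys A"
  then have "coeff f i * c \<in> N" using smodD(3) polysD by blast
  then show "coeff (smult c f) i \<in> N" by (simp add: mult.commute)
qed

lemma unit_polysD: "g \<in> unit_polys A \<Longrightarrow> g \<in> polys A"
  by (simp add: unit_polys_def)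

text \<open>McCoy's theorem modulo a module: \<open>g\<close> acts injectively on
  \<open>S[X] / N[X]\<close>. Later \<open>N\<close> is a subring, an ideal, the conductor
  \<open>K\<close> or the kernel of a covering map.\<close>

lemma mccoy:
  assumes A: "subr A" and N: "smod A N" and g: "g \<in> unit_polys A" and gf: "g * f \<in> polys N"
  shows "f \<in> polys N"
proof -
  obtain h n where h: "h \<in> polys A" and 1: "coeff (g * h) n = 1"
    using g by (auto simp: unit_polys_def)
  have gA: "g \<in> polys A" using g by (simp add: unit_polys_def)
  have key: "f \<in> polys N" if "\<And>i. smult (coeff g i) f \<in> polys N" for f
  proof (rule polysI)
    fix j
    have "coeff f j = (\<Sum>i\<le>n. coeff h (n - i) * (coeff g i * coeff f j))"
    proof -
      have "coeff f j = coeff (g * h) n * coeff f j" by (simp add: 1)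
      also have "\<dots> = (\<Sum>i\<le>n. coeff h (n - i) * (coeff g i * coeff f j))"
        by (simp add: coeff_mult sum_distrib_left sum_distrib_right mult_ac)
      finally show ?thesis .
    qed
    also have "\<dots> \<in> N"
      proof (rule smod_sum[OF N], rule smodD(3)[OF N])
      show "coeff h (n - i) \<in> A" for i using polysD[OF h] .
      show "coeff g i * coeff f j \<in> N" for i using polysD[OF that, of i j] by simp
    qed
    finally show "coeff f j \<in> N" .
  qed
  \<comment> \<open>Going down from the leading coefficient \<open>b\<close> of \<open>g\<close>: modulo \<open>N\<close> the polynomial \<open>b f\<close> has smaller
    degree than \<open>f\<close> and is still killed by \<open>g\<close>, so \<open>b f\<close> vanishes and \<open>b\<close> can be dropped from \<open>g\<close>.\<close>
  have "f \<in> polys N" if "\<forall>j\<ge>d. coeff f j \<in> N" "g * f \<in> polys N" for f d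
    using that
  proof (induction d arbitrary: f)
    case 0
    then show ?case by (auto simp: polys_def)
  next
    case (Suc d)
    have *: "smult (coeff g i) f \<in> polys N" for i
    proof (induction "degree g - i" arbitrary: i rule: less_induct)
      case less
      have "coeff g i * coeff f d \<in> N"
      proof (cases "i \<le> degree g")
        case True
        \<comment> \<open>In degree \<open>i + d\<close>, a term with \<open>k < i\<close> involves
          a coefficient of \<open>f\<close> above \<open>d\<close>, and a term with
          \<open>k > i\<close> falls under the inner induction.\<close>
        have *: "coeff g k * coeff f (i + d - k) \<in> N" if "k \<noteq> i" for k
        proof (cases "k < i")
          case True
          then have "coeff f (i + d - k) \<in> N" using Suc.prems(1) by auto
          then show ?thesis using smodD(3)[OF N] polysD[OF gA] by auto
        next
          case False
          with that have "i < k" by simp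
          show ?thesis
          proof (cases "k \<le> degree g")
            case True
            with \<open>i < k\<close> have "smult (coeff g k) f \<in> polys N"
              by (intro less) auto
            then show ?thesis using polysD[of _ N "i + d - k"] by fastforce
          next
            case False
            then show ?thesis using smodD(1)[OF N] by (simp add: coeff_eq_0)
          qed
        qed
        have "coeff (g * f) (i + d) = coeff g i * coeff f d + (\<Sum>k\<in>{..i+d} - {i}. coeff g k * coeff f (i + d - k))"
          by (simp add: coeff_mult sum.remove[of _ i])
        moreover have "(\<Sum>k\<in>{..i+d} - {i}. coeff g k * coeff f (i + d - k)) \<in> N"
          using * by (intro smod_sum[OF N]) auto
        ultimately show ?thesis
          using polysD[OF Suc.prems(2), of "i + d"] smod_diff[OF N A]
          by (metis add_diff_cancel_right')
      next
        case False
        then show ?thesis using smodD(1)[OF N] by (simp add: coeff_eq_0)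
      qed
      then have top: "coeff (smult (coeff g i) f) d \<in> N" by simp
      show ?case
      proof (rule Suc.IH)
        show "\<forall>j\<ge>d. coeff (smult (coeff g i) f) j \<in> N"
          using top Suc.prems(1) smodD(3)[OF N] polysD[OF gA]
          by (metis coeff_smult le_neq_implies_less Suc_leI)
        have "g * smult (coeff g i) f = smult (coeff g i) (g * f)" by simp
        then show "g * smult (coeff g i) f \<in> polys N"
          using polys_smult[OF N polysD[OF gA] Suc.prems(2)] by simp
      qed
    qed
    then show ?case by (rule key)
  qed
  from this[of "Suc (degree f)" f] show ?thesis
    using gf smodD(1)[OF N] by (auto simp: coeff_eq_0 Suc_le_eq)
qed

section \<open>Content ideals and products of unit content polynomials\<close>

definition content_ideal :: "'a::comm_ring_1 set \<Rightarrow> 'a poly \<Rightarrow> 'a set" where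
  "content_ideal A g = {c. \<exists>h\<in>polys A. \<exists>n. c = coeff (g * h) n}"

lemma smod_content_ideal:
  assumes "subr A"
  shows "smod A (content_ideal A g)"
proof -
  have "coeff (g * h) n + coeff (g * h') n' \<in> content_ideal A g"
    if h: "h \<in> polys A" "h' \<in> polys A" for h h' n n'
  proof -
    \<comment> \<open>The shifts bring the two chosen coefficients into the same degree
      \<open>n + n'\<close>.\<close>
    let ?k = "monom 1 n' * h + monom 1 n * h'"
    have "?k \<in> polys A"
      using h subrD[OF subr_polys[OF assms]] polys_monom subrD(1,2)[OF assms] by metis
    moreover have "g * ?k = monom 1 n' * (g * h) + monom 1 n * (g * h')"
      by (simp add: algebra_simps)
    then have "coeff (g * ?k) (n + n') = coeff (g * h) n + coeff (g * h') n'"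
      by (simp add: coeff_monom_mult)
    ultimately show ?thesis unfolding content_ideal_def mem_Collect_eq by metis
  qed
  moreover have "a * coeff (g * h) n \<in> content_ideal A g" if "a \<in> A" "h \<in> polys A" for a h n
    using that polys_smult[OF smod_self[OF assms]]
    by (auto simp: content_ideal_def intro!: bexI[of _ "smult a h"])
  moreover have "0 \<in> content_ideal A g"
    using polys_const[of A 0] subrD(2)[OF assms] by (force simp: content_ideal_def)
  ultimately show ?thesis by (auto simp: smod_def content_ideal_def)
qed

lemma coeff_in_content_ideal: "subr A \<Longrightarrow> coeff g i \<in> content_ideal A g"
  unfolding content_ideal_def using subrD(1)[OF subr_polys] by (force intro!: bexI[of _ 1])

text \<open>The pattern for later proofs of unit content: let all coefficients lie in a module
  \<open>J\<close> and derive \<open>1 \<in> J\<close>.\<close>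

lemma unit_polys_iff:
  assumes "subr A"
  shows "g \<in> unit_polys A \<longleftrightarrow> g \<in> polys A \<and> (\<forall>J. smod A J \<longrightarrow> g \<in> polys J \<longrightarrow> 1 \<in> J)"
proof safe
  fix J assume g: "g \<in> unit_polys A" "smod A J" "g \<in> polys J"
  then obtain h n where h: "h \<in> polys A" and 1: "coeff (g * h) n = 1"
    by (auto simp: unit_polys_def)
  then have "h * g \<in> polys J" using polys_mult g by blast
  then show "1 \<in> J" using 1 polysD by (metis mult.commute)
next
  assume "g \<in> polys A" and *: "\<forall>J. smod A J \<longrightarrow> g \<in> polys J \<longrightarrow> 1 \<in> J"
  have "1 \<in> content_ideal A g"
    using * smod_content_ideal[OF assms] coeff_in_content_ideal[OF assms] polysI by blast
  then obtain h n where "h \<in> polys A" "1 = coeff (g * h) n" unfolding content_ideal_def by blast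
  with \<open>g \<in> polys A\<close> show "g \<in> unit_polys A" unfolding unit_polys_def by auto
qed (simp add: unit_polysD)

lemma unit_polysI:
  "subr A \<Longrightarrow> g \<in> polys A \<Longrightarrow> (\<And>J. smod A J \<Longrightarrow> g \<in> polys J \<Longrightarrow> 1 \<in> J) \<Longrightarrow> g \<in> unit_polys A"
  by (simp add: unit_polys_iff)

lemma unit_polys_one_mem: "subr A \<Longrightarrow> g \<in> unit_polys A \<Longrightarrow> smod A J \<Longrightarrow> g \<in> polys J \<Longrightarrow> 1 \<in> J"
  by (simp add: unit_polys_iff)

lemma unit_polys_coeff_1:
  assumes "subr A" "g \<in> polys A" "coeff g i = 1"
  shows "g \<in> unit_polys A"
  using assms(3) by (intro unit_polysI assms) (metis polysD)

lemma unit_polys_1: "subr A \<Longrightarrow> 1 \<in> unit_polys A"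
  by (rule unit_polys_coeff_1[of _ _ 0]) (auto intro: subrD subr_polys)

text \<open>If the coefficients of \<open>f * g\<close> lie in \<open>J\<close>, McCoy's theorem
  cancels \<open>f\<close>, and then \<open>g\<close> puts 1 into \<open>J\<close>.\<close>

lemma unit_polys_mult:
  assumes A: "subr A" and "f \<in> unit_polys A" "g \<in> unit_polys A"
  shows "f * g \<in> unit_polys A"
proof (rule unit_polysI[OF A])
  show "f * g \<in> polys A" using assms subrD(4)[OF subr_polys[OF A]] unit_polysD by blast
  fix J assume J: "smod A J" "f * g \<in> polys J"
  then have "g \<in> polys J" using mccoy A assms(2) by blast
  then show "1 \<in> J" using unit_polys_one_mem[OF A assms(3)] J by blast
qed

lemma unit_polys_power: "subr A \<Longrightarrow> f \<in> unit_polys A \<Longrightarrow> f ^ n \<in> unit_polys A"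
  by (induction n) (auto intro: unit_polys_mult unit_polys_1)

lemma unit_polys_mono: "A \<subseteq> B \<Longrightarrow> unit_polys A \<subseteq> unit_polys B"
  unfolding unit_polys_def using polys_mono by blast

section \<open>Modules of finite length\<close>

text \<open>
  With \<open>\<Sigma> = {1}\<close> the condition says that \<open>M\<close> is a maximal ideal of \<open>A\<close> or the unit ideal.  In general it
  says so of the ideal generated by \<open>M\<close> in the localization of \<open>A\<close> at \<open>\<Sigma>\<close>; this is how the Nagata ring
  is handled without leaving the polynomial ring.
\<close>

definition rel_maximal :: "'a::comm_ring_1 set \<Rightarrow> 'a set \<Rightarrow> 'a set \<Rightarrow> bool" where
  "rel_maximal A \<Sigma> M \<longleftrightarrow> smod A M \<and> M \<subseteq> A \<and> (\<forall>x\<in>A. x \<in> M \<or> (\<exists>c\<in>A. \<exists>m\<in>M. c * x + m \<in> \<Sigma>))"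

definition adjoin :: "'a::comm_ring_1 set \<Rightarrow> 'a set \<Rightarrow> 'a \<Rightarrow> 'a set" where
  "adjoin A N e = {n + a * e | n a. n \<in> N \<and> a \<in> A}"

text \<open>After localization at \<open>\<Sigma>\<close> the quotient \<open>N' / N\<close> is
  cyclic and killed by \<open>M\<close>, hence simple or zero. A sequence of such steps is a
  composition series in which repetitions are allowed.\<close>

definition simple_step :: "'a::comm_ring_1 set \<Rightarrow> 'a set \<Rightarrow> 'a set \<Rightarrow> 'a set \<Rightarrow> bool" where
  "simple_step A \<Sigma> N N' \<longleftrightarrow> (\<exists>M e. rel_maximal A \<Sigma> M \<and> N' = adjoin A N e \<and> (\<forall>m\<in>M. m * e \<in> N))"

definition sat :: "'a::comm_ring_1 set \<Rightarrow> 'a set \<Rightarrow> bool" where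
  "sat \<Sigma> U \<longleftrightarrow> (\<forall>s\<in>\<Sigma>. \<forall>x. s * x \<in> U \<longrightarrow> x \<in> U)"

lemma smod_adjoin:
  assumes "subr A" "smod A N"
  shows "smod A (adjoin A N e)"
proof -
  have "(n + a * e) + (n' + a' * e) \<in> adjoin A N e"
    if "n \<in> N" "n' \<in> N" "a \<in> A" "a' \<in> A" for n n' a a'
  proof -
    have "(n + a * e) + (n' + a' * e) = (n + n') + (a + a') * e" by (simp add: algebra_simps)
    then show ?thesis unfolding adjoin_def using that smodD(2)[OF assms(2)] subrD(6)[OF assms(1)] by blast
  qed
  moreover have "b * (n + a * e) \<in> adjoin A N e" if "n \<in> N" "b \<in> A" "a \<in> A" for n a b
  proof -
    have "b * (n + a * e) = b * n + (b * a) * e" by (simp add: algebra_simps)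
    then show ?thesis unfolding adjoin_def using that smodD(3)[OF assms(2)] subrD(4)[OF assms(1)] by blast
  qed
  moreover have "0 \<in> adjoin A N e"
    unfolding adjoin_def using smodD(1)[OF assms(2)] subrD(2)[OF assms(1)] by force
  ultimately show ?thesis unfolding smod_def adjoin_def by blast
qed

lemma adjoin_superset: "subr A \<Longrightarrow> N \<subseteq> adjoin A N e"
  unfolding adjoin_def using subrD(2) by force

lemma smod_step: "subr A \<Longrightarrow> smod A N \<Longrightarrow> simple_step A \<Sigma> N N' \<Longrightarrow> smod A N'"
  by (auto simp: simple_step_def intro: smod_adjoin)

lemma smod_steps:
  assumes "(simple_step A \<Sigma>)\<^sup>*\<^sup>* B N" "subr A" "smod A B"
  shows "smod A N \<and> B \<subseteq> N"
  using assms(1)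
proof induction
  case (step N N')
  then show ?case using smod_step[OF assms(2)] adjoin_superset[OF assms(2), of N]
    by (fastforce simp: simple_step_def)
qed (use assms in auto)

text \<open>Induction along the composition series. At a step from \<open>N\<close> to
  \<open>N + A e\<close>, either elements of the \<open>U k\<close> involve \<open>e\<close> only
  with factors from \<open>M\<close>, and then lie in \<open>N\<close>; or some \<open>U L\<close>
  contains a multiple of \<open>e\<close> by an element of \<open>\<Sigma>\<close> modulo
  \<open>N\<close>. Subtracting it reduces later elements to \<open>N\<close>, and saturation
  cancels the factor.\<close>

lemma steps_stabilise:
  fixes U :: "nat \<Rightarrow> 'a::comm_ring_1 set"
  assumes "(simple_step A \<Sigma>)\<^sup>*\<^sup>* B N"
    and A: "subr A" and B: "smod A B"
    and U: "\<And>k. smod A (U k)" "\<And>k. sat \<Sigma> (U k)" "\<And>k. U k \<subseteq> U (Suc k)"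
    and base: "\<And>k. U k \<inter> B = U 0 \<inter> B"
  shows "\<exists>K. \<forall>k\<ge>K. U k \<inter> N = U K \<inter> N"
  using assms(1)
proof induction
  case base
  then show ?case using assms(7) by blast
next
  case (step N N')
  then obtain K where K: "\<And>k. k \<ge> K \<Longrightarrow> U k \<inter> N = U K \<inter> N" by blast
  have N: "smod A N" using smod_steps[OF step(1) A B] by blast
  obtain M e where M: "rel_maximal A \<Sigma> M" and N': "N' = adjoin A N e" and Me: "\<And>m. m \<in> M \<Longrightarrow> m * e \<in> N"
    using step(2) by (auto simp: simple_step_def)
  have mono: "U i \<subseteq> U j" if "i \<le> j" for i j
    using that U(3) by (rule lift_Suc_mono_le[rotated])
  show ?case
  proof (cases "\<exists>L\<ge>K. \<exists>n\<in>N. \<exists>a\<in>A. n + a * e \<in> U L \<and> a \<notin> M")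
    case False
    have "U k \<inter> N' \<subseteq> U K \<inter> N'" if "k \<ge> K" for k
    proof
      fix u assume u: "u \<in> U k \<inter> N'"
      then obtain n a where na: "u = n + a * e" "n \<in> N" "a \<in> A" by (auto simp: N' adjoin_def)
      with False u that have "a \<in> M" by blast
      then have "u \<in> N" using na Me smodD(2)[OF N] by auto
      then show "u \<in> U K \<inter> N'" using u K[OF that] by blast
    qed
    with mono show ?thesis by (intro exI[of _ K]) blast
  next
    case True
    then obtain L n a where L: "L \<ge> K" "n \<in> N" "a \<in> A" "n + a * e \<in> U L" "a \<notin> M" by blast
    then obtain c m where c: "c \<in> A" "m \<in> M" "c * a + m \<in> \<Sigma>" using M by (auto simp: rel_maximal_def)
    define s where "s = c * a + m"
    \<comment> \<open>Chosen so that \<open>n0 + s * e = c * (n + a * e)\<close>, with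
      \<open>s\<close> in \<open>\<Sigma>\<close>.\<close>
    define n0 where "n0 = c * n - m * e"
    have "m \<in> A" using c M by (auto simp: rel_maximal_def)
    then have sA: "s \<in> A" using c L subrD[OF A] by (auto simp: s_def)
    have n0: "n0 \<in> N" using c L Me smodD[OF N] smod_diff[OF N A] by (auto simp: n0_def)
    have "n0 + s * e = c * (n + a * e)" by (simp add: n0_def s_def algebra_simps)
    then have nU: "n0 + s * e \<in> U L" using smodD(3)[OF U(1)] c L by simp
    have "U k \<inter> N' \<subseteq> U L \<inter> N'" if "k \<ge> L" for k
    proof
      fix u assume u: "u \<in> U k \<inter> N'"
      then obtain n' b where nb: "u = n' + b * e" "n' \<in> N" "b \<in> A" by (auto simp: N' adjoin_def)
      have eq: "s * u - b * (n0 + s * e) = s * n' - b * n0" by (simp add: nb algebra_simps)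
      have bU: "b * (n0 + s * e) \<in> U L" using smodD(3)[OF U(1)] nU nb by blast
      then have "s * u - b * (n0 + s * e) \<in> U k"
        using smodD(3)[OF U(1) sA] u smod_diff[OF U(1) A] mono[OF that] by blast
      moreover have "s * n' - b * n0 \<in> N"
        using smod_diff[OF N A] smodD(3)[OF N] sA nb n0 by blast
      ultimately have "s * u - b * (n0 + s * e) \<in> U k \<inter> N" using eq by simp
      also have "U k \<inter> N = U L \<inter> N" using K[of k] K[of L] that L by simp
      finally have "s * u - b * (n0 + s * e) + b * (n0 + s * e) \<in> U L"
        using bU by (intro smodD(2)[OF U(1)]) blast+
      then have "s * u \<in> U L" by simp
      then have "u \<in> U L" using U(2)[of L] c unfolding sat_def s_def by blast
      with u show "u \<in> U L \<inter> N'" by blast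
    qed
    with mono show ?thesis by (intro exI[of _ L]) blast
  qed
qed

text \<open>For a coefficient \<open>x\<close> outside \<open>M\<close> with
  \<open>c * x + m = 1\<close>, appending \<open>m\<close> in a fresh degree gives unit content.
  Thus \<open>M[X]\<close> becomes maximal or trivial once unit content polynomials are inverted,
  and finite length passes to the Nagata ring.\<close>

lemma rel_maximal_polys:
  assumes A: "subr A" and M: "rel_maximal A {1} M" and f: "f \<in> polys A" "f \<notin> polys M"
  shows "\<exists>m\<in>polys M. f + m \<in> unit_polys A"
proof -
  obtain i where i: "coeff f i \<notin> M" using f by (auto simp: polys_def)
  have smM: "smod A M" and MA: "M \<subseteq> A" using M by (auto simp: rel_maximal_def)
  obtain c m where c: "c \<in> A" "m \<in> M" "c * coeff f i + m = 1"
    using M i polysD[OF f(1)] by (auto simp: rel_maximal_def)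
  define m' where "m' = monom m (Suc (degree f))"
  have m': "m' \<in> polys M" using c smodD(1)[OF smM] by (simp add: m'_def polys_monom)
  have i': "i \<le> degree f" using i smodD(1)[OF smM] coeff_eq_0[of f i] by force
  have "f + m' \<in> unit_polys A"
  proof (rule unit_polysI[OF A])
    show "f + m' \<in> polys A"
      using f m' MA by (auto simp: polys_def intro: subrD(6)[OF A])
    fix J assume J: "smod A J" "f + m' \<in> polys J"
    have "coeff (f + m') i \<in> J" "coeff (f + m') (Suc (degree f)) \<in> J" using polysD[OF J(2)] by auto
    then have "coeff f i \<in> J" "m \<in> J" using i' by (auto simp: m'_def coeff_eq_0)
    then show "1 \<in> J" using c smodD[OF J(1)] by metis
  qed
  with m' show ?thesis by blast
qed

lemma adjoin_polys:
  assumes "0 \<in> N" "subr A"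
  shows "polys (adjoin A N e) = adjoin (polys A) (polys N) [:e:]"
proof safe
  fix f assume f: "f \<in> polys (adjoin A N e)"
  have "\<forall>i. \<exists>n a. n \<in> N \<and> a \<in> A \<and> coeff f i = n + a * e"
    using polysD[OF f] unfolding adjoin_def by blast
  then obtain n a where na: "\<And>i. n i \<in> N" "\<And>i. a i \<in> A" "\<And>i. coeff f i = n i + a i * e"
    by metis
  define p where "p = (\<Sum>i\<le>degree f. monom (n i) i)"
  define q where "q = (\<Sum>i\<le>degree f. monom (a i) i)"
  have cp: "coeff p i = (if i \<le> degree f then n i else 0)" for i
    by (auto simp: p_def coeff_sum)
  have cq: "coeff q i = (if i \<le> degree f then a i else 0)" for i
    by (auto simp: q_def coeff_sum)
  have "f = p + q * [:e:]"
  proof (rule poly_eqI)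
    fix i
    show "coeff f i = coeff (p + q * [:e:]) i"
      using na(3)[of i] by (cases "i \<le> degree f") (auto simp: cp cq mult.commute[of e] coeff_eq_0)
  qed
  moreover have "p \<in> polys N" using na assms by (auto simp: polys_def cp)
  moreover have "q \<in> polys A" using na subrD(2)[OF assms(2)] by (auto simp: polys_def cq)
  ultimately show "f \<in> adjoin (polys A) (polys N) [:e:]" by (auto simp: adjoin_def)
qed (force simp: adjoin_def polys_def mult.commute[of e])

lemma simple_step_polys:
  assumes A: "subr A" and N: "smod A N" and "simple_step A {1} N N'"
  shows "simple_step (polys A) (unit_polys A) (polys N) (polys N')"
proof -
  obtain M e where M: "rel_maximal A {1} M" and N': "N' = adjoin A N e" and Me: "\<And>m. m \<in> M \<Longrightarrow> m * e \<in> N"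
    using assms(3) by (auto simp: simple_step_def)
  have sm: "smod A M" "M \<subseteq> A" using M by (auto simp: rel_maximal_def)
  have "rel_maximal (polys A) (unit_polys A) (polys M)"
    unfolding rel_maximal_def
  proof (intro conjI ballI)
    show "smod (polys A) (polys M)" "polys M \<subseteq> polys A" using smod_polys[OF sm(1)] polys_mono[OF sm(2)] by auto
    fix f assume "f \<in> polys A"
    then show "f \<in> polys M \<or> (\<exists>c\<in>polys A. \<exists>m\<in>polys M. c * f + m \<in> unit_polys A)"
      using rel_maximal_polys[OF A M] subrD(1)[OF subr_polys[OF A]] by (metis mult_1)
  qed
  moreover have "\<forall>m\<in>polys M. m * [:e:] \<in> polys N"
    using Me by (auto simp: polys_def mult.commute[of e])
  ultimately show ?thesis
    unfolding simple_step_def N' adjoin_polys[OF smodD(1)[OF N] A] by blast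
qed

lemma steps_polys:
  assumes "(simple_step A {1})\<^sup>*\<^sup>* B N" and A: "subr A" and B: "smod A B"
  shows "(simple_step (polys A) (unit_polys A))\<^sup>*\<^sup>* (polys B) (polys N)"
  using assms(1)
proof induction
  case (step N N')
  have "simple_step (polys A) (unit_polys A) (polys N) (polys N')"
    using simple_step_polys[OF A _ step(2)] smod_steps[OF step(1) A B] by blast
  with step show ?case by simp
qed simp

text \<open>
  The values at \<open>x\<close> of the polynomials over \<open>A\<close> with leading coefficient in \<open>\<Sigma>\<close>.  In particular
  \<open>0 \<in> lead_rel A {1} x\<close> means that \<open>x\<close> is integral over \<open>A\<close>.
\<close>

inductive_set lead_rel :: "'a::comm_ring_1 set \<Rightarrow> 'a set \<Rightarrow> 'a \<Rightarrow> 'a set"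
  for A \<Sigma> x where
    lead: "s \<in> \<Sigma> \<Longrightarrow> s \<in> lead_rel A \<Sigma> x"
  | horner: "p \<in> lead_rel A \<Sigma> x \<Longrightarrow> b \<in> A \<Longrightarrow> b + x * p \<in> lead_rel A \<Sigma> x"

text \<open>The span of the powers of \<open>x\<close> below \<open>x ^ k\<close>, in Horner form to
  match the rule \<open>horner\<close>.\<close>

primrec low_span :: "'a::comm_ring_1 set \<Rightarrow> 'a \<Rightarrow> nat \<Rightarrow> 'a set" where
  "low_span A x 0 = {0}"
| "low_span A x (Suc k) = {b + x * z | b z. b \<in> A \<and> z \<in> low_span A x k}"

lemma smod_low_span:
  assumes A: "subr A"
  shows "smod A (low_span A x k)"
proof (induction k)
  case (Suc k)
  have "(b + x * z) + (b' + x * z') \<in> low_span A x (Suc k)"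
    if "b \<in> A" "b' \<in> A" "z \<in> low_span A x k" "z' \<in> low_span A x k" for b b' z z'
  proof -
    have "(b + x * z) + (b' + x * z') = (b + b') + x * (z + z')" by (simp add: algebra_simps)
    then show ?thesis using that smodD(2)[OF Suc] subrD(6)[OF A] unfolding low_span.simps by blast
  qed
  moreover have "a * (b + x * z) \<in> low_span A x (Suc k)"
    if "a \<in> A" "b \<in> A" "z \<in> low_span A x k" for a b z
  proof -
    have "a * (b + x * z) = a * b + x * (a * z)" by (simp add: algebra_simps)
    then show ?thesis using that smodD(3)[OF Suc] subrD(4)[OF A] unfolding low_span.simps by blast
  qed
  moreover have "0 \<in> low_span A x (Suc k)" using smodD(1)[OF Suc] subrD(2)[OF A] by force
  ultimately show ?case unfolding smod_def by auto
qed (simp add: smod_zero)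

lemma low_span_mono: "subr A \<Longrightarrow> low_span A x k \<subseteq> low_span A x (Suc k)"
proof (induction k)
  case 0
  then show ?case using subrD(2) by force
next
  case (Suc k)
  then show ?case unfolding low_span.simps(2)[of A x "Suc k"] low_span.simps(2)[of A x k] by blast
qed

lemma power_in_low_span: "subr A \<Longrightarrow> x ^ k \<in> low_span A x (Suc k)"
proof (induction k)
  case 0
  then show ?case using subrD(1) by force
next
  case (Suc k)
  then show ?case using subrD(2)[of A] by force
qed

lemma lead_rel_power_diff:
  assumes "subr A" "s \<in> \<Sigma>" "z \<in> low_span A x k"
  shows "s * x ^ k - z \<in> lead_rel A \<Sigma> x"
  using assms(3)
proof (induction k arbitrary: z)
  case 0
  then show ?case using assms lead by auto
next
  case (Suc k)
  then obtain b z' where z: "z = b + x * z'" "b \<in> A" "z' \<in> low_span A x k" by auto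
  have "- b + x * (s * x ^ k - z') \<in> lead_rel A \<Sigma> x"
    using Suc.IH z assms(1) subrD(5) by (intro horner) auto
  moreover have "- b + x * (s * x ^ k - z') = s * x ^ Suc k - z" by (simp add: z algebra_simps)
  ultimately show ?case by simp
qed

lemma lead_rel_decomp:
  "p \<in> lead_rel A {1} x \<Longrightarrow> subr A \<Longrightarrow> \<exists>k. \<exists>z\<in>low_span A x k. p = x ^ k + z"
proof (induction p rule: lead_rel.induct)
  case (lead s)
  then show ?case by (intro exI[of _ 0]) auto
next
  case (horner p b)
  then obtain k z where "z \<in> low_span A x k" "p = x ^ k + z" by blast
  then show ?case using horner by (intro exI[of _ "Suc k"] bexI[of _ "b + x * z"]) (auto simp: distrib_left)
qed

text \<open>A substitute for the determinant trick: the saturated spans of powers of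
  \<open>x\<close> become stationary, so a multiple of some power by an element of
  \<open>\<Sigma>\<close> lies in the span of the lower powers. For polynomials
  \<open>\<Sigma>\<close> consists of unit content polynomials.\<close>

lemma steps_integral:
  fixes x :: "'a::comm_ring_1"
  assumes st: "(simple_step A \<Sigma>)\<^sup>*\<^sup>* A N" and A: "subr A" and N: "subr N" "x \<in> N"
    and \<Sigma>: "\<Sigma> \<subseteq> A" "1 \<in> \<Sigma>" "\<And>s t. s \<in> \<Sigma> \<Longrightarrow> t \<in> \<Sigma> \<Longrightarrow> s * t \<in> \<Sigma>"
  shows "0 \<in> lead_rel A \<Sigma> x"
proof -
  \<comment> \<open>With \<open>Suc k\<close> the module \<open>U 0\<close> already contains
    \<open>A\<close>, so the chain is constant on the base.\<close>
  define U where "U k = {u. \<exists>s\<in>\<Sigma>. s * u \<in> low_span A x (Suc k)}" for k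
  have Z: "smod A (low_span A x k)" for k by (rule smod_low_span[OF A])
  have low_U: "low_span A x (Suc k) \<subseteq> U k" for k
    using \<Sigma>(2) by (auto simp: U_def simp del: low_span.simps intro!: bexI[of _ 1])
  have smU: "smod A (U k)" for k
    unfolding smod_def
  proof (intro conjI ballI)
    show "0 \<in> U k" using low_U smodD(1)[OF Z] by blast
    fix u v assume "u \<in> U k" "v \<in> U k"
    then obtain s t where st: "s \<in> \<Sigma>" "t \<in> \<Sigma>" "s * u \<in> low_span A x (Suc k)" "t * v \<in> low_span A x (Suc k)"
      by (auto simp: U_def)
    have "(s * t) * (u + v) = t * (s * u) + s * (t * v)" by (simp add: algebra_simps)
    then have "(s * t) * (u + v) \<in> low_span A x (Suc k)"
      using smodD(2,3)[OF Z[of "Suc k"]] st \<Sigma>(1) by (metis subsetD)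
    then show "u + v \<in> U k" using \<Sigma>(3) st by (auto simp: U_def)
  next
    fix a u assume "a \<in> A" "u \<in> U k"
    then obtain s where s: "s \<in> \<Sigma>" "s * u \<in> low_span A x (Suc k)"
      by (auto simp: U_def)
    have "s * (a * u) = a * (s * u)" by (simp add: algebra_simps)
    then have "s * (a * u) \<in> low_span A x (Suc k)"
      using smodD(3)[OF Z[of "Suc k"]] s \<open>a \<in> A\<close> by metis
    then show "a * u \<in> U k" using s by (auto simp: U_def)
  qed
  have satU: "sat \<Sigma> (U k)" for k
    unfolding sat_def
  proof (intro ballI allI impI)
    fix s u assume "s \<in> \<Sigma>" "s * u \<in> U k"
    then obtain t where "t \<in> \<Sigma>" "t * (s * u) \<in> low_span A x (Suc k)" by (auto simp: U_def)
    then have "(t * s) * u \<in> low_span A x (Suc k)" by (simp add: mult.assoc)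
    then show "u \<in> U k" using \<Sigma>(3) \<open>s \<in> \<Sigma>\<close> \<open>t \<in> \<Sigma>\<close> unfolding U_def by blast
  qed
  have monoU: "U k \<subseteq> U (Suc k)" for k
    using low_span_mono[OF A, of x "Suc k"] by (auto simp: U_def simp del: low_span.simps)
  have AU: "A \<subseteq> U k" for k
  proof -
    have "A \<subseteq> low_span A x (Suc k)" using smodD(1)[OF Z[of k]] by force
    with low_U show ?thesis by blast
  qed
  then have "U k \<inter> A = U 0 \<inter> A" for k by blast
  from steps_stabilise[OF st A smod_self[OF A] smU satU monoU this]
  obtain K where K: "\<And>k. k \<ge> K \<Longrightarrow> U k \<inter> N = U K \<inter> N" by blast
  have "x ^ Suc K \<in> U (Suc K) \<inter> N"
    using low_U power_in_low_span[OF A, of x "Suc K"] subr_power[OF N] by blast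
  then have "x ^ Suc K \<in> U K" using K[of "Suc K"] by simp
  then obtain s where "s \<in> \<Sigma>" "s * x ^ Suc K \<in> low_span A x (Suc K)" by (auto simp: U_def)
  from lead_rel_power_diff[OF A this] show ?thesis by simp
qed

section \<open>Integral elements\<close>

definition lspan :: "'a::comm_ring_1 set \<Rightarrow> 'a list \<Rightarrow> 'a set" where
  "lspan A vs = foldr (\<lambda>v N. adjoin A N v) vs {0}"

lemma lspan_simps [simp]: "lspan A [] = {0}" "lspan A (v # vs) = adjoin A (lspan A vs) v"
  by (simp_all add: lspan_def)

lemma smod_lspan: "subr A \<Longrightarrow> smod A (lspan A vs)"
  by (induction vs) (auto intro: smod_adjoin smod_zero)

lemma lspan_mem: "subr A \<Longrightarrow> v \<in> set vs \<Longrightarrow> v \<in> lspan A vs"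
proof (induction vs)
  case (Cons w vs)
  then show ?case
  proof (cases "v = w")
    case True
    have "w = 0 + 1 * w" by simp
    then show ?thesis
      unfolding lspan_simps adjoin_def True
      using smodD(1)[OF smod_lspan[OF Cons.prems(1)]] subrD(1)[OF Cons.prems(1)] by blast
  next
    case False
    then show ?thesis using Cons adjoin_superset[OF Cons.prems(1)] by auto
  qed
qed simp

lemma lspan_least: "smod A N \<Longrightarrow> set vs \<subseteq> N \<Longrightarrow> lspan A vs \<subseteq> N"
  by (induction vs) (auto simp: adjoin_def smodD)

lemma lspan_mult:
  assumes "subr A"
  shows "u \<in> lspan A us \<Longrightarrow> c \<in> lspan A vs \<Longrightarrow> u * c \<in> lspan A [x * y. x \<leftarrow> us, y \<leftarrow> vs]"
proof -
  let ?L = "lspan A [x * y. x \<leftarrow> us, y \<leftarrow> vs]"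
  note L = smod_lspan[OF assms]
  assume u: "u \<in> lspan A us" and c: "c \<in> lspan A vs"
  have "lspan A vs \<subseteq> {c. x * c \<in> ?L}" if "x \<in> set us" for x
  proof (rule lspan_least)
    show "smod A {c. x * c \<in> ?L}"
      using smodD[OF L] by (auto simp: smod_def algebra_simps mult.left_commute[of x])
    show "set vs \<subseteq> {c. x * c \<in> ?L}"
      using that by (auto intro!: lspan_mem[OF assms] bexI[of _ x])
  qed
  then have "set us \<subseteq> {u. u * c \<in> ?L}" using c by blast
  moreover have "smod A {u. u * c \<in> ?L}"
    using smodD[OF L] by (auto simp: smod_def algebra_simps mult.assoc)
  ultimately show "u * c \<in> ?L" using lspan_least u by blast
qed

text \<open>Induction on the generators. Allowing a factor \<open>1 - a * t\<close> on the left
  makes the hypothesis stable under elimination of a generator, because such factors are closed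
  under products.\<close>

lemma nakayama:
  assumes T: "subr T" and a: "a \<in> T" and W: "smod T W"
  shows "(\<And>v. v \<in> set vs \<Longrightarrow> \<exists>t\<in>T. \<exists>w\<in>W. \<exists>u\<in>lspan T vs. (1 - a * t) * v = w + a * u)
    \<Longrightarrow> \<exists>t\<in>T. \<forall>v\<in>set vs. (1 - a * t) * v \<in> W"
proof (induction vs)
  case Nil
  then show ?case using subrD(2)[OF T] by auto
next
  case (Cons v vs)
  note L = smod_lspan[OF T, of vs] and T' = subrD[OF T] and W' = smodD[OF W]
  have comp: "\<exists>c\<in>T. (1 - a * s) * (1 - a * t) = 1 - a * c" if "s \<in> T" "t \<in> T" for s t
  proof
    show "(1 - a * s) * (1 - a * t) = 1 - a * (s + t - a * (s * t))" by (simp add: algebra_simps)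
    show "s + t - a * (s * t) \<in> T" using that a T' by auto
  qed
  obtain s w u where v: "s \<in> T" "w \<in> W" "u \<in> lspan T (v # vs)" "(1 - a * s) * v = w + a * u"
    using Cons.prems[of v] by auto
  obtain u' b where u: "u = u' + b * v" "u' \<in> lspan T vs" "b \<in> T"
    using v(3) by (auto simp: adjoin_def)
  \<comment> \<open>Moving the part \<open>a * b * v\<close> of the right-hand side to the left
    leaves \<open>g * v\<close> expressed without \<open>v\<close>.\<close>
  define g where "g = 1 - a * (s + b)"
  have gv: "g * v = w + a * u'" using v(4) by (simp add: g_def u algebra_simps)
  have gT: "g \<in> T" using v u a T' by (auto simp: g_def)
  have "\<exists>t\<in>T. \<exists>w\<in>W. \<exists>u\<in>lspan T vs. (1 - a * t) * x = w + a * u" if x: "x \<in> set vs" for x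
  proof -
    obtain s1 w1 u1 where 1: "s1 \<in> T" "w1 \<in> W" "u1 \<in> lspan T (v # vs)" "(1 - a * s1) * x = w1 + a * u1"
      using Cons.prems[of x] x by auto
    obtain u2 b2 where u1: "u1 = u2 + b2 * v" "u2 \<in> lspan T vs" "b2 \<in> T"
      using 1(3) by (auto simp: adjoin_def)
    obtain c where c: "c \<in> T" "(1 - a * (s + b)) * (1 - a * s1) = 1 - a * c"
      using comp[of "s + b" s1] v u 1 T' by auto
    have "(1 - a * c) * x = g * ((1 - a * s1) * x)" by (simp add: c(2)[symmetric] g_def mult.assoc)
    also have "\<dots> = g * (w1 + a * u1)" by (simp only: 1)
    also have "\<dots> = g * w1 + a * (g * u2) + (a * b2) * (g * v)" by (simp add: u1 algebra_simps)
    also have "\<dots> = (g * w1 + (a * b2) * w) + a * (g * u2 + (a * b2) * u')"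
      by (simp add: gv algebra_simps)
    finally have "(1 - a * c) * x = (g * w1 + (a * b2) * w) + a * (g * u2 + (a * b2) * u')" .
    moreover have "g * w1 + (a * b2) * w \<in> W" using W' gT 1 v a u1 T' by auto
    moreover have "g * u2 + (a * b2) * u' \<in> lspan T vs" using smodD[OF L] gT u u1 a T' by auto
    ultimately show ?thesis using c(1) by blast
  qed
  from Cons.IH[OF this] obtain t where t: "t \<in> T" "\<And>x. x \<in> set vs \<Longrightarrow> (1 - a * t) * x \<in> W" by blast
  have "smod T {x. (1 - a * t) * x \<in> W}"
    using W' by (auto simp: smod_def distrib_left mult.left_commute[of "1 - a * t"])
  with t(2) have "lspan T vs \<subseteq> {x. (1 - a * t) * x \<in> W}" by (intro lspan_least) auto
  then have tu: "(1 - a * t) * u' \<in> W" using u by blast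
  obtain c where c: "c \<in> T" "(1 - a * t) * g = 1 - a * c"
    using comp[of t "s + b"] v u t T' by (auto simp: g_def)
  have tT: "1 - a * t \<in> T" using t a T' by auto
  have "(1 - a * c) * v = (1 - a * t) * w + a * ((1 - a * t) * u')"
  proof -
    have "(1 - a * c) * v = (1 - a * t) * (g * v)" by (simp add: c(2)[symmetric] mult.assoc)
    then show ?thesis by (simp add: gv distrib_left mult.left_commute)
  qed
  then have "(1 - a * c) * v \<in> W" using W' tT v(2) tu a by auto
  moreover have "(1 - a * c) * x \<in> W" if "x \<in> set vs" for x
  proof -
    have "(1 - a * c) * x = g * ((1 - a * t) * x)" by (simp add: c(2)[symmetric] mult_ac)
    then show ?thesis using W' gT t(2)[OF that] by auto
  qed
  ultimately show ?case using c(1) by auto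
qed

text \<open>Modulo \<open>C\<close>, the element \<open>y\<close> inverts \<open>r\<close>. Along
  Horner's scheme for an integral equation of \<open>y\<close>, the value \<open>p\<close> satisfies
  \<open>r ^ k * p = 1 - r * t\<close> modulo \<open>C\<close>; the end value \<open>p = 0\<close>
  gives the claim. Here \<open>y\<close> may lie outside \<open>T\<close>.\<close>

lemma integral_inverse:
  assumes A: "subr A" and T: "subr T" "A \<subseteq> T" and C: "smod T C" "C \<subseteq> T"
    and r: "r \<in> A" "m \<in> C" "r * y + m = 1" and y: "0 \<in> lead_rel A {1} y"
  shows "\<exists>t\<in>A. 1 - r * t \<in> C"
proof -
  note A' = subrD[OF A] and T' = subrD[OF T(1)] and C' = smodD[OF C(1)]
  have "\<exists>k. \<exists>t\<in>A. r ^ k * p - (1 - r * t) \<in> C" if "p \<in> lead_rel A {1} y" for p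
    using that
  proof induction
    case (lead s)
    then show ?case using A' C' by (intro exI[of _ 0] bexI[of _ 0]) auto
  next
    case (horner p b)
    then obtain k t where kt: "t \<in> A" "r ^ k * p - (1 - r * t) \<in> C" by blast
    have "(r ^ k * p - (1 - r * t)) + (1 - r * t) \<in> T"
      by (rule T'(6)) (use kt C(2) r T A' in auto)
    then have "r ^ k * p \<in> T" by simp
    then have "(r ^ k * p) * m \<in> C" using C' r by blast
    then have "(r ^ k * p - (1 - r * t)) - (r ^ k * p) * m \<in> C"
      using smod_diff[OF C(1) T(1) kt(2)] by blast
    moreover have "r ^ Suc k * (b + y * p) - (1 - r * (t - r ^ k * b))
        = (r ^ k * p - (1 - r * t)) - (r ^ k * p) * m"
    proof -
      have m: "m = 1 - r * y" using r(3) by (metis add_diff_cancel_left')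
      show ?thesis unfolding m by (simp add: algebra_simps)
    qed
    ultimately have "r ^ Suc k * (b + y * p) - (1 - r * (t - r ^ k * b)) \<in> C" by (simp only:)
    moreover have "t - r ^ k * b \<in> A" using kt horner r A' subr_power[OF A] by auto
    ultimately show ?case by blast
  qed
  from this[OF y] obtain t where t: "t \<in> A" "- (1 - r * t) \<in> C" by force
  then have "- (- (1 - r * t)) \<in> C" using smod_uminus[OF C(1) T(1)] by blast
  then show ?thesis using t by auto
qed

text \<open>Integrality allows inverses modulo \<open>C\<close> of elements of \<open>A\<close> to
  be chosen in \<open>A\<close>.\<close>

lemma rel_maximal_contract:
  assumes A: "subr A" and T: "subr T" "A \<subseteq> T" and C: "rel_maximal T {1} C"
    and int: "\<And>x. x \<in> T \<Longrightarrow> 0 \<in> lead_rel A {1} x"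
  shows "rel_maximal A {1} (C \<inter> A)"
  unfolding rel_maximal_def
proof (intro conjI ballI)
  have C1: "smod T C" "C \<subseteq> T" using C by (auto simp: rel_maximal_def)
  show "smod A (C \<inter> A)" using smod_Int smod_mono[OF C1(1) T(2)] smod_self[OF A] by blast
  fix r assume r: "r \<in> A"
  show "r \<in> C \<inter> A \<or> (\<exists>c\<in>A. \<exists>m\<in>C \<inter> A. c * r + m \<in> {1})"
  proof (cases "r \<in> C")
    case False
    then obtain c m where cm: "c \<in> T" "m \<in> C" "c * r + m = 1"
      using C r T by (auto simp: rel_maximal_def)
    then have "r * c + m = 1" by (simp add: mult.commute)
    from integral_inverse[OF A T C1 r cm(2) this int[OF cm(1)]]
    obtain t where t: "t \<in> A" "1 - r * t \<in> C" by blast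
    moreover have "1 - r * t \<in> A" using t r subrD[OF A] by auto
    ultimately show ?thesis
      by (intro disjI2 bexI[of _ t] bexI[of _ "1 - r * t"]) (auto simp: mult.commute)
  qed (use r in auto)
qed auto

section \<open>Rings generated by one element\<close>

definition adj :: "'a::comm_ring_1 set \<Rightarrow> 'a \<Rightarrow> 'a set" where
  "adj A x = (\<lambda>p. poly p x) ` polys A"

lemma subr_adj:
  assumes "subr A" shows "subr (adj A x)"
  unfolding subr_def
proof (intro conjI ballI)
  show "1 \<in> adj A x"
    using subrD(1)[OF subr_polys[OF assms]] by (force simp: adj_def)
  fix u v assume "u \<in> adj A x" "v \<in> adj A x"
  then obtain p q where "p \<in> polys A" "q \<in> polys A" "u = poly p x" "v = poly q x"
    by (auto simp: adj_def)
  then show "u - v \<in> adj A x" "u * v \<in> adj A x"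
    using subrD(3,4)[OF subr_polys[OF assms]]
    by (auto simp: adj_def image_iff simp flip: poly_diff poly_mult)
qed

lemma adj_horner: "subr A \<Longrightarrow> u \<in> adj A x \<longleftrightarrow> (\<exists>b\<in>A. \<exists>v\<in>adj A x. u = b + x * v)"
proof safe
  assume A: "subr A" "u \<in> adj A x"
  then obtain p where p: "p \<in> polys A" "u = poly p x" by (auto simp: adj_def)
  obtain b q where bq: "p = pCons b q" by (rule pCons_cases)
  have "b \<in> A" using polysD[OF p(1), of 0] by (simp add: bq)
  moreover have "q \<in> polys A" using polysD[OF p(1), of "Suc _"] by (auto simp: bq polys_def)
  ultimately show "\<exists>b\<in>A. \<exists>v\<in>adj A x. u = b + x * v" using p bq by (auto simp: adj_def)
next
  fix b v assume "subr A" "b \<in> A" "v \<in> adj A x"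
  then obtain q where "q \<in> polys A" "v = poly q x" by (auto simp: adj_def)
  then have "pCons b q \<in> polys A" using \<open>b \<in> A\<close> by (auto simp: polys_def coeff_pCons split: nat.split)
  moreover have "poly (pCons b q) x = b + x * v" using \<open>v = _\<close> by simp
  ultimately show "b + x * v \<in> adj A x" unfolding adj_def by (metis imageI)
qed

lemma adj_least:
  assumes "subr T" "A \<subseteq> T" "x \<in> T"
  shows "adj A x \<subseteq> T"
proof
  fix u assume "u \<in> adj A x"
  then obtain p where "p \<in> polys A" "u = poly p x" by (auto simp: adj_def)
  then show "u \<in> T"
    using subsetD[OF assms(2) polysD[of p A]] subr_power[OF assms(1,3)] subrD(4)[OF assms(1)]
    by (auto simp: poly_altdef intro!: smod_sum[OF smod_self[OF assms(1)]])
qed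

lemma adj_superset: "subr A \<Longrightarrow> A \<subseteq> adj A x"
  by (force simp: adj_def polys_const subrD intro!: image_eqI[of _ _ "[:_:]"])

lemma adj_gen: "subr A \<Longrightarrow> x \<in> adj A x"
  by (auto simp: adj_def image_iff intro!: bexI[of _ "[:0, 1:]"] polysI split: nat.split)
    (auto simp: coeff_pCons subrD split: nat.split)

lemma integral_scale:
  assumes "subr A" "a \<in> A" "0 \<in> lead_rel A {1} y"
  shows "0 \<in> lead_rel A {1} (a * y)"
proof -
  have "\<exists>k. a ^ k * p \<in> lead_rel A {1} (a * y)" if "p \<in> lead_rel A {1} y" for p
    using that
  proof induction
    case (lead s)
    then show ?case by (intro exI[of _ 0]) (auto intro: lead_rel.lead)
  next
    case (horner p b)
    then obtain k where "a ^ k * p \<in> lead_rel A {1} (a * y)" by blast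
    then have "a ^ Suc k * b + (a * y) * (a ^ k * p) \<in> lead_rel A {1} (a * y)"
      using horner assms(1,2) subr_power[OF assms(1,2)] subrD(4)[OF assms(1)] by (intro lead_rel.horner) auto
    then show ?case by (intro exI[of _ "Suc k"]) (simp add: algebra_simps)
  qed
  from this[OF assms(3)] show ?thesis by simp
qed

lemma integral_adj_fg:
  assumes A: "subr A" and y: "0 \<in> lead_rel A {1} y"
  shows "\<exists>vs. set vs \<subseteq> adj A y \<and> adj A y = lspan A vs"
proof -
  obtain k z where z: "z \<in> low_span A y k" "0 = y ^ k + z"
    using lead_rel_decomp[OF y A] by blast
  note Z = smod_low_span[OF A, of y]
  have yk: "y ^ k \<in> low_span A y k"
    using smod_uminus[OF Z A z(1)] z(2) by (metis add.inverse_unique add.commute minus_minus)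
  have stable: "low_span A y (Suc k) \<subseteq> low_span A y k"
  proof -
    \<comment> \<open>Passing from \<open>j\<close> to \<open>Suc j\<close> adds only multiples of
      \<open>y ^ j\<close>; for \<open>j = k\<close> these are already present.\<close>
    have "low_span A y (Suc j) \<subseteq> {u + b * y ^ j | u b. u \<in> low_span A y j \<and> b \<in> A}" for j
    proof (induction j)
      case 0
      then show ?case by auto
    next
      case (Suc j)
      show ?case
      proof
        fix u assume "u \<in> low_span A y (Suc (Suc j))"
        then obtain b v where "u = b + y * v" "b \<in> A" "v \<in> low_span A y (Suc j)"
          unfolding low_span.simps(2)[of A y "Suc j"] by blast
        moreover then obtain v' c where "v = v' + c * y ^ j" "v' \<in> low_span A y j" "c \<in> A"
          using Suc by blast
        ultimately have "u = (b + y * v') + c * y ^ Suc j" "b + y * v' \<in> low_span A y (Suc j)" "c \<in> A"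
          by (auto simp: algebra_simps)
        then show "u \<in> {u + b * y ^ Suc j | u b. u \<in> low_span A y (Suc j) \<and> b \<in> A}" by blast
      qed
    qed
    then show ?thesis using smodD(2,3)[OF Z] yk by blast
  qed
  have "poly p y \<in> low_span A y k" if "p \<in> polys A" for p
    using that
  proof (induction p)
    case 0
    then show ?case using smodD(1)[OF Z] by simp
  next
    case (pCons b p)
    have "b \<in> A" "p \<in> polys A"
      using polysD[OF pCons.prems, of 0] polysD[OF pCons.prems, of "Suc _"] by (auto simp: polys_def)
    then show ?case using pCons.IH stable by auto
  qed
  then have 1: "adj A y \<subseteq> low_span A y k" by (auto simp: adj_def)
  have 2: "\<exists>vs. set vs \<subseteq> adj A y \<and> low_span A y j \<subseteq> lspan A vs" for j
  proof (induction j)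
    case 0
    then show ?case by (intro exI[of _ "[]"]) auto
  next
    case (Suc j)
    then obtain vs where vs: "set vs \<subseteq> adj A y" "low_span A y j \<subseteq> lspan A vs" by blast
    let ?vs = "1 # map ((*) y) vs"
    have "set ?vs \<subseteq> adj A y"
      using vs(1) subrD(1,4)[OF subr_adj[OF A]] adj_gen[OF A] by auto
    moreover have "b + y * u \<in> lspan A ?vs" if "b \<in> A" "u \<in> low_span A y j" for b u
    proof -
      have "smod A {u. y * u \<in> lspan A (map ((*) y) vs)}"
        using smodD[OF smod_lspan[OF A]] by (auto simp: smod_def distrib_left mult.left_commute[of y])
      then have "lspan A vs \<subseteq> {u. y * u \<in> lspan A (map ((*) y) vs)}"
        by (rule lspan_least) (auto intro: lspan_mem[OF A])
      then have "y * u \<in> lspan A (map ((*) y) vs)" using that vs by blast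
      moreover have "b + y * u = y * u + b * 1" by simp
      ultimately show ?thesis using that unfolding lspan_simps adjoin_def by blast
    qed
    ultimately show ?case by (intro exI[of _ ?vs]) auto
  qed
  then obtain vs where vs: "set vs \<subseteq> adj A y" "low_span A y k \<subseteq> lspan A vs" by blast
  have "lspan A vs \<subseteq> adj A y"
    by (intro lspan_least vs smod_subr[OF subr_adj[OF A] adj_superset[OF A]])
  with 1 vs show ?thesis by blast
qed

text \<open>From \<open>y\<close> in \<open>T[a y]\<close> follows \<open>T[y] = T + a T[y]\<close>,
  and Nakayama's lemma applies to \<open>T[y] / T\<close>. So if replacing \<open>y\<close> by
  \<open>a y\<close> does not shrink the ring, \<open>a\<close> is invertible modulo the conductor
  of \<open>y\<close>.\<close>

lemma adj_scale_step:
  assumes T: "subr T" and a: "a \<in> T" and y: "0 \<in> lead_rel T {1} y" and mem: "y \<in> adj T (a * y)"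
  shows "\<exists>t\<in>T. (1 - a * t) * y \<in> T"
proof -
  obtain vs where vs: "set vs \<subseteq> adj T y" "adj T y = lspan T vs"
    using integral_adj_fg[OF T y] by blast
  have sub: "adj T (a * y) \<subseteq> adj T y"
    by (intro adj_least[OF subr_adj[OF T]] adj_superset[OF T] subrD(4)[OF subr_adj[OF T]]
        subsetD[OF adj_superset[OF T] a] adj_gen[OF T])
  obtain t v where tv: "t \<in> T" "v \<in> adj T y" "y = t + a * v"
  proof -
    obtain b v where "b \<in> T" "v \<in> adj T (a * y)" "y = b + (a * y) * v"
      using mem adj_horner[OF T, of y "a * y"] by blast
    with that[of b "y * v"] sub adj_gen[OF T] subrD(4)[OF subr_adj[OF T]]
    show ?thesis by (auto simp: mult.assoc)
  qed
  have all: "\<exists>s\<in>T. \<exists>w\<in>adj T y. u = s + a * w" if "u \<in> adj T y" for u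
  proof -
    obtain p where p: "p \<in> polys T" "u = poly p y" using \<open>u \<in> adj T y\<close> by (auto simp: adj_def)
    have "\<exists>s\<in>T. \<exists>w\<in>adj T y. poly p y = s + a * w" using p(1)
    proof (induction p)
      case 0
      have "0 \<in> T" "0 \<in> adj T y" using subrD(2) T subr_adj[OF T] by auto
      then show ?case by force
    next
      case (pCons b p)
      have bp: "b \<in> T" "p \<in> polys T"
        using polysD[OF pCons.prems, of 0] polysD[OF pCons.prems, of "Suc _"] by (auto simp: polys_def)
      then obtain s w where sw: "s \<in> T" "w \<in> adj T y" "poly p y = s + a * w" using pCons.IH by blast
      have "poly (pCons b p) y = b + s * y + a * (y * w)" by (simp add: sw algebra_simps)
      also have "\<dots> = b + s * (t + a * v) + a * (y * w)" by (simp only: tv(3)[symmetric])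
      also have "\<dots> = (b + s * t) + a * (s * v + y * w)" by (simp add: algebra_simps)
      finally have "poly (pCons b p) y = (b + s * t) + a * (s * v + y * w)" .
      moreover have "b + s * t \<in> T" using bp sw tv subrD[OF T] by auto
      moreover have "s * v + y * w \<in> adj T y"
        by (intro subrD(6)[OF subr_adj[OF T]] subrD(4)[OF subr_adj[OF T]] tv(2) sw(2) adj_gen[OF T] subsetD[OF adj_superset[OF T] sw(1)])
      ultimately show ?case by blast
    qed
    with p show ?thesis by simp
  qed
  have "\<exists>t\<in>T. \<forall>v\<in>set vs. (1 - a * t) * v \<in> T"
  proof (rule nakayama[OF T a smod_self[OF T]])
    fix v assume "v \<in> set vs"
    then obtain s w where "s \<in> T" "w \<in> lspan T vs" "v = s + a * w" using all vs by blast
    then show "\<exists>t\<in>T. \<exists>w\<in>T. \<exists>u\<in>lspan T vs. (1 - a * t) * v = w + a * u"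
      using subrD(2)[OF T] by (intro bexI[of _ 0] bexI[of _ s] bexI[of _ w]) auto
  qed
  then obtain t where t: "t \<in> T" "\<forall>v\<in>set vs. (1 - a * t) * v \<in> T" by blast
  have "smod T {v. (1 - a * t) * v \<in> T}"
    using subrD[OF T] by (auto simp: smod_def distrib_left mult.left_commute[of "1 - a * t"])
  then have "lspan T vs \<subseteq> {v. (1 - a * t) * v \<in> T}"
    by (rule lspan_least) (use t in auto)
  then show ?thesis using t adj_gen[OF T] vs(2) by blast
qed

section \<open>Modules of finite length over the base ring\<close>

abbreviation fin_length :: "'a::comm_ring_1 set \<Rightarrow> 'a set \<Rightarrow> bool" where
  "fin_length A N \<equiv> (simple_step A {1})\<^sup>*\<^sup>* A N"

lemma fin_length_integral:
  assumes "fin_length A T" "subr A" "subr T" "x \<in> T"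
  shows "0 \<in> lead_rel A {1} x"
  using assms subrD(1)[of A] by (intro steps_integral[OF assms(1)]) auto

lemma fin_length_fg:
  assumes "fin_length A N" "subr A"
  shows "\<exists>us. N = lspan A us"
  using assms(1)
proof induction
  case base
  have "lspan A [1] = A" by (auto simp: adjoin_def)
  then show ?case by metis
next
  case (step N N')
  then obtain us where "N = lspan A us" by blast
  moreover obtain e where "N' = adjoin A N e" using step(2) by (auto simp: simple_step_def)
  ultimately have "N' = lspan A (e # us)" by simp
  then show ?case by blast
qed

text \<open>Each element of \<open>ws\<close> is killed by \<open>M\<close> modulo \<open>T\<close>
  and adds one simple step. The minimality clause later identifies \<open>N\<close> with a
  ring.\<close>

lemma fin_length_extend:
  assumes A: "subr A" and T: "fin_length A T" and M: "rel_maximal A {1} M"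
    and ws: "\<And>w m. w \<in> set ws \<Longrightarrow> m \<in> M \<Longrightarrow> m * w \<in> T"
  shows "\<exists>N. fin_length A N \<and> T \<subseteq> N \<and> set ws \<subseteq> N \<and> (\<forall>N'. smod A N' \<longrightarrow> T \<subseteq> N' \<longrightarrow> set ws \<subseteq> N' \<longrightarrow> N \<subseteq> N')"
  using ws
proof (induction ws)
  case Nil
  then show ?case using T by auto
next
  case (Cons w ws)
  then obtain N where N: "fin_length A N" "T \<subseteq> N" "set ws \<subseteq> N"
    "\<forall>N'. smod A N' \<longrightarrow> T \<subseteq> N' \<longrightarrow> set ws \<subseteq> N' \<longrightarrow> N \<subseteq> N'" by fastforce
  have smN: "smod A N" using smod_steps[OF N(1) A smod_self[OF A]] by blast
  have "simple_step A {1} N (adjoin A N w)"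
    unfolding simple_step_def using M Cons.prems[of w] N(2) by auto
  with N(1) have "fin_length A (adjoin A N w)" by simp
  moreover have "N \<subseteq> adjoin A N w" by (rule adjoin_superset[OF A])
  moreover have "w \<in> adjoin A N w"
  proof -
    have "w = 0 + 1 * w" by simp
    then show ?thesis unfolding adjoin_def using smodD(1)[OF smN] subrD(1)[OF A] by blast
  qed
  moreover have "adjoin A N w \<subseteq> N'" if "smod A N'" "T \<subseteq> N'" "set (w # ws) \<subseteq> N'" for N'
  proof -
    have "N \<subseteq> N'" using that N(4) by simp
    then show ?thesis using that(3) smodD(2,3)[OF that(1)] by (auto simp: adjoin_def)
  qed
  ultimately show ?case using N(2,3) by (intro exI[of _ "adjoin A N w"]) auto
qed

section \<open>The largest extension of finite length and the Pruefer property\<close>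

text \<open>Multiplying by a power of \<open>b\<close> makes the polynomial monic in
  \<open>b * x\<close>. The claim is one Horner step ahead of \<open>p\<close>, since
  \<open>p = b\<close> has degree 0 and cannot be made monic; \<open>c + x * b\<close> can.\<close>

lemma lead_rel_scale_integral:
  assumes A: "subr A" and "b \<in> A"
  shows "p \<in> lead_rel A {b} x \<Longrightarrow> (\<forall>c\<in>A. \<exists>k. b ^ k * (c + x * p) \<in> lead_rel A {1} (b * x))"
proof (induction rule: lead_rel.induct)
  case (lead s)
  have "c + (b * x) * 1 \<in> lead_rel A {1} (b * x)" if "c \<in> A" for c
    using that by (intro lead_rel.intros) auto
  then show ?case using lead by (intro ballI exI[of _ 0]) (auto simp: mult.commute)
next
  case (horner p d)
  then obtain k where k: "b ^ k * (d + x * p) \<in> lead_rel A {1} (b * x)" by blast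
  have "b ^ Suc k * c + (b * x) * (b ^ k * (d + x * p)) \<in> lead_rel A {1} (b * x)" if "c \<in> A" for c
    using k that subrD(4)[OF A] subr_power[OF A] assms(2) by (intro lead_rel.horner) auto
  then show ?case by (intro ballI exI[of _ "Suc k"]) (simp add: algebra_simps)
qed

lemma poly_shift_rec: "poly (poly_shift j p) x = coeff p j + x * poly (poly_shift (Suc j) p) x"
proof -
  have "poly_shift j p = pCons (coeff p j) (poly_shift (Suc j) p)"
    by (intro poly_eqI) (auto simp: coeff_poly_shift coeff_pCons split: nat.splits)
  then show ?thesis by simp
qed

text \<open>The ascending condition provides \<open>B\<close>; the descending one serves the minimal
  choice in \<open>B_integrally_closed\<close> and the relation in
  \<open>primitive_relation\<close>.\<close>

locale fcp_ext =
  fixes R :: "'a::comm_ring_1 set"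
  assumes R: "subr R"
    and no_asc: "\<nexists>T. \<forall>i::nat. subr (T i) \<and> R \<subseteq> T i \<and> T i \<subset> T (Suc i)"
    and no_desc: "\<nexists>T. \<forall>i::nat. subr (T i) \<and> R \<subseteq> T i \<and> T (Suc i) \<subset> T i"
begin

lemma ex_maximal:
  assumes "subr T" "R \<subseteq> T" "P T"
  shows "\<exists>M. subr M \<and> R \<subseteq> M \<and> P M \<and> (\<forall>N. subr N \<longrightarrow> P N \<longrightarrow> \<not> M \<subset> N)"
proof -
  define r where "r = {(N, M). subr N \<and> R \<subseteq> N \<and> subr M \<and> R \<subseteq> M \<and> M \<subset> N}"
  have "wf r"
    unfolding wf_iff_no_infinite_down_chain
  proof
    assume "\<exists>f. \<forall>i. (f (Suc i), f i) \<in> r"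
    then obtain f where f: "\<And>i. (f (Suc i), f i) \<in> r" by blast
    have "\<forall>i. subr (f i) \<and> R \<subseteq> f i \<and> f i \<subset> f (Suc i)" using f by (simp add: r_def)
    then show False using no_asc by (elim notE) (rule exI)
  qed
  moreover have "T \<in> {T. subr T \<and> R \<subseteq> T \<and> P T}" using assms by simp
  ultimately obtain M where "M \<in> {T. subr T \<and> R \<subseteq> T \<and> P T}"
    "\<And>N. (N, M) \<in> r \<Longrightarrow> N \<notin> {T. subr T \<and> R \<subseteq> T \<and> P T}"
    by (rule wfE_min) blast
  then show ?thesis unfolding r_def by blast
qed

lemma ex_minimal:
  assumes "subr T" "R \<subseteq> T" "P T"
  shows "\<exists>M. subr M \<and> R \<subseteq> M \<and> P M \<and> (\<forall>N. subr N \<longrightarrow> R \<subseteq> N \<longrightarrow> P N \<longrightarrow> \<not> N \<subset> M)"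
proof -
  define r where "r = {(N, M). subr N \<and> R \<subseteq> N \<and> subr M \<and> R \<subseteq> M \<and> N \<subset> M}"
  have "wf r"
    unfolding wf_iff_no_infinite_down_chain
  proof
    assume "\<exists>f. \<forall>i. (f (Suc i), f i) \<in> r"
    then obtain f where f: "\<And>i. (f (Suc i), f i) \<in> r" by blast
    have "\<forall>i. subr (f i) \<and> R \<subseteq> f i \<and> f (Suc i) \<subset> f i" using f by (simp add: r_def)
    then show False using no_desc by (elim notE) (rule exI)
  qed
  moreover have "T \<in> {T. subr T \<and> R \<subseteq> T \<and> P T}" using assms by simp
  ultimately obtain M where "M \<in> {T. subr T \<and> R \<subseteq> T \<and> P T}"
    "\<And>N. (N, M) \<in> r \<Longrightarrow> N \<notin> {T. subr T \<and> R \<subseteq> T \<and> P T}"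
    by (rule wfE_min) blast
  then show ?thesis unfolding r_def by blast
qed

lemma ex_fin_length_maximal:
  "\<exists>B. subr B \<and> R \<subseteq> B \<and> fin_length R B \<and> (\<forall>N. subr N \<longrightarrow> fin_length R N \<longrightarrow> \<not> B \<subset> N)"
  using ex_maximal[of R "fin_length R"] R by auto

text \<open>\<open>B\<close> plays the role of the integral closure of \<open>R\<close>; no other description of it is needed.\<close>

definition B :: "'a set" where
  "B = (SOME B. subr B \<and> R \<subseteq> B \<and> fin_length R B \<and> (\<forall>N. subr N \<longrightarrow> fin_length R N \<longrightarrow> \<not> B \<subset> N))"

lemma B: "subr B" "R \<subseteq> B" "fin_length R B" "subr N \<Longrightarrow> fin_length R N \<Longrightarrow> \<not> B \<subset> N"
  using someI_ex[OF ex_fin_length_maximal] unfolding B_def by blast+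

text \<open>For \<open>y\<close> outside \<open>B\<close> with \<open>B[y]\<close> minimal, the
  conductor \<open>I\<close> of \<open>y\<close> is a maximal ideal of \<open>B\<close> and an ideal
  of \<open>B[y]\<close>. So \<open>B[y] / B\<close> is a finite-dimensional space over
  \<open>B / I\<close>, and \<open>B[y]\<close> has finite length over \<open>R\<close>, against the
  maximality of \<open>B\<close>.\<close>

lemma B_integrally_closed:
  assumes "0 \<in> lead_rel B {1} x"
  shows "x \<in> B"
proof (rule ccontr)
  assume "x \<notin> B"
  note B' = subrD[OF B(1)]
  \<comment> \<open>Choosing \<open>B[y]\<close> minimal among the rings generated by one integral element replaces the passage to
    a minimal extension of \<open>B\<close>, whose elements would have to be shown integral first.\<close>
  define P where "P T \<longleftrightarrow> (\<exists>y. y \<notin> B \<and> 0 \<in> lead_rel B {1} y \<and> T = adj B y)" for T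
  have "P (adj B x)" using assms \<open>x \<notin> B\<close> by (auto simp: P_def)
  moreover have "subr (adj B x)" "R \<subseteq> adj B x"
    using subr_adj[OF B(1)] adj_superset[OF B(1)] B(2) by auto
  ultimately obtain T where "P T" and Tmin: "\<And>N. subr N \<Longrightarrow> R \<subseteq> N \<Longrightarrow> P N \<Longrightarrow> \<not> N \<subset> T"
    using ex_minimal[of "adj B x" P] by blast
  then obtain y where y: "y \<notin> B" "0 \<in> lead_rel B {1} y" and T: "T = adj B y" by (auto simp: P_def)
  have ymin: "y \<in> adj B (a * y)" if "a \<in> B" "a * y \<notin> B" for a
  proof -
    have "P (adj B (a * y))" using that y integral_scale[OF B(1)] by (auto simp: P_def)
    moreover have "subr (adj B (a * y))" "R \<subseteq> adj B (a * y)"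
      using subr_adj[OF B(1)] adj_superset[OF B(1)] B(2) by auto
    ultimately have "\<not> adj B (a * y) \<subset> adj B y" using Tmin T by blast
    moreover have "adj B (a * y) \<subseteq> adj B y"
      by (intro adj_least subr_adj[OF B(1)] adj_superset[OF B(1)] subrD(4)[OF subr_adj[OF B(1)]]
          subsetD[OF adj_superset[OF B(1)] that(1)] adj_gen[OF B(1)])
    ultimately show ?thesis using adj_gen[OF B(1)] by blast
  qed
  define I where "I = {a \<in> B. a * y \<in> B}"
  have I: "smod B I" "I \<subseteq> B"
    using B' by (auto simp: I_def smod_def distrib_right mult.assoc)
  have Imax: "rel_maximal B {1} I"
    unfolding rel_maximal_def
  proof (intro conjI ballI I)
    fix a assume a: "a \<in> B"
    show "a \<in> I \<or> (\<exists>c\<in>B. \<exists>m\<in>I. c * a + m \<in> {1})"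
    proof (cases "a * y \<in> B")
      case False
      obtain t where t: "t \<in> B" "(1 - a * t) * y \<in> B"
        using adj_scale_step[OF B(1) a y(2) ymin[OF a False]] by blast
      then have "1 - a * t \<in> I" using a B' by (auto simp: I_def)
      with t show ?thesis by (intro disjI2 bexI[of _ t] bexI[of _ "1 - a * t"]) (auto simp: mult.commute)
    qed (use a in \<open>auto simp: I_def\<close>)
  qed
  \<comment> \<open>Otherwise \<open>y\<close> inverts some \<open>c * a\<close> modulo
    \<open>I\<close>, and by integrality an inverse exists in \<open>B\<close>; as \<open>a\<close>
    lies in \<open>I\<close>, this forces \<open>y\<close> into \<open>B\<close>.\<close>
  have Iy: "a * y \<in> I" if "a \<in> I" for a
  proof (rule ccontr)
    assume "a * y \<notin> I"
    moreover have aB: "a \<in> B" "a * y \<in> B" using that by (auto simp: I_def)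
    ultimately obtain c m where cm: "c \<in> B" "m \<in> I" "c * (a * y) + m = 1"
      using Imax by (auto simp: rel_maximal_def)
    have "c * a \<in> B" using cm aB B' by blast
    moreover have "(c * a) * y + m = 1" using cm by (simp add: mult.assoc)
    ultimately obtain t where t: "t \<in> B" "1 - (c * a) * t \<in> I"
      using integral_inverse[OF B(1) B(1) order.refl I _ cm(2) _ y(2)] by blast
    have "y = (1 - (c * a) * t) * y + (c * t) * (a * y)" by (simp add: algebra_simps)
    moreover have "(1 - (c * a) * t) * y \<in> B" using t by (auto simp: I_def)
    moreover have "(c * t) * (a * y) \<in> B" using B' cm t aB by auto
    ultimately show False using y(1) B'(6) by metis
  qed
  have Iadj: "a * u \<in> B" if "a \<in> I" "u \<in> adj B y" for a u
  proof -
    obtain p where p: "p \<in> polys B" "u = poly p y" using \<open>u \<in> adj B y\<close> by (auto simp: adj_def)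
    have "\<forall>a\<in>I. a * poly p y \<in> B" using p(1)
    proof (induction p)
      case 0
      then show ?case using B' by simp
    next
      case (pCons b p)
      have bp: "b \<in> B" "p \<in> polys B"
        using polysD[OF pCons.prems, of 0] polysD[OF pCons.prems, of "Suc _"] by (auto simp: polys_def)
      show ?case
      proof
        fix a assume a: "a \<in> I"
        have "(a * y) * poly p y \<in> B" using pCons.IH[OF bp(2)] Iy[OF a] by blast
        moreover have "a * b \<in> B" using a bp B' by (auto simp: I_def)
        ultimately show "a * poly (pCons b p) y \<in> B" using B'(6) by (simp add: distrib_left mult.assoc)
      qed
    qed
    with that p show ?thesis by blast
  qed
  have M: "rel_maximal R {1} (I \<inter> R)"
    by (rule rel_maximal_contract[OF R B(1,2) Imax fin_length_integral[OF B(3) R B(1)]])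
  obtain vs where vs: "set vs \<subseteq> adj B y" "adj B y = lspan B vs"
    using integral_adj_fg[OF B(1) y(2)] by blast
  obtain us where us: "B = lspan R us" using fin_length_fg[OF B(3) R] by blast
  \<comment> \<open>Products of generators of \<open>B\<close> over \<open>R\<close> with generators
    of \<open>B[y]\<close> over \<open>B\<close> generate \<open>B[y]\<close> over
    \<open>R\<close>.\<close>
  define ws where "ws = [x * y. x \<leftarrow> us, y \<leftarrow> vs]"
  have usB: "set us \<subseteq> B" using us lspan_mem[OF R] by blast
  have wsT: "set ws \<subseteq> adj B y"
    using usB vs(1) adj_superset[OF B(1), of y]
    by (auto simp: ws_def intro!: subrD(4)[OF subr_adj[OF B(1)]])
  then have "\<And>w m. w \<in> set ws \<Longrightarrow> m \<in> I \<inter> R \<Longrightarrow> m * w \<in> B" using Iadj by blast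
  from fin_length_extend[OF R B(3) M this]
  obtain N where N: "fin_length R N" "B \<subseteq> N" "set ws \<subseteq> N"
    "\<forall>N'. smod R N' \<longrightarrow> B \<subseteq> N' \<longrightarrow> set ws \<subseteq> N' \<longrightarrow> N \<subseteq> N'" by blast
  have smN: "smod R N" using smod_steps[OF N(1) R smod_self[OF R]] by blast
  have smT: "smod R (adj B y)"
    using smod_subr[OF subr_adj[OF B(1)], of R y] adj_superset[OF B(1), of y] B(2) by blast
  have "adj B y \<subseteq> N"
  proof -
    have wsN: "lspan R ws \<subseteq> N" by (rule lspan_least[OF smN N(3)])
    have "smod B (lspan R ws)"
      unfolding smod_def
    proof (intro conjI ballI)
      show "0 \<in> lspan R ws" using smodD(1)[OF smod_lspan[OF R]] .
      show "u + v \<in> lspan R ws" if "u \<in> lspan R ws" "v \<in> lspan R ws" for u v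
        using smodD(2)[OF smod_lspan[OF R]] that .
      fix b u assume b: "b \<in> B" and u: "u \<in> lspan R ws"
      have "smod R {u. b * u \<in> lspan R ws}"
        using smodD[OF smod_lspan[OF R]] by (auto simp: smod_def distrib_left mult.left_commute[of b])
      moreover have "set ws \<subseteq> {u. b * u \<in> lspan R ws}"
      proof
        fix w assume "w \<in> set ws"
        then obtain x v where xv: "w = x * v" "x \<in> set us" "v \<in> set vs" by (auto simp: ws_def)
        have "b * x \<in> lspan R us" using b xv usB us B' by blast
        from lspan_mult[OF R this lspan_mem[OF R xv(3)]]
        have "(b * x) * v \<in> lspan R ws" unfolding ws_def .
        then show "w \<in> {u. b * u \<in> lspan R ws}" using xv by (simp add: mult.assoc)
      qed
      ultimately show "b * u \<in> lspan R ws" using lspan_least[of R _ ws] u by blast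
    qed
    moreover have "set vs \<subseteq> lspan R ws"
    proof
      fix v assume v: "v \<in> set vs"
      have "1 \<in> lspan R us" using us B' by simp
      from lspan_mult[OF R this lspan_mem[OF R v]] show "v \<in> lspan R ws" unfolding ws_def by simp
    qed
    ultimately show ?thesis using vs(2) lspan_least wsN by blast
  qed
  moreover have "N \<subseteq> adj B y" using N(4) smT wsT adj_superset[OF B(1)] by blast
  ultimately have "adj B y = N" by blast
  then have "fin_length R (adj B y)" using N(1) by simp
  from B(4)[OF subr_adj[OF B(1)] this] have "adj B y = B" using adj_superset[OF B(1), of y] by blast
  then show False using adj_gen[OF B(1), of y] y(1) by simp
qed

text \<open>The descending rings \<open>B + x\<^sup>k B[x]\<close> become stationary, which yields the coefficient \<open>1\<close>.\<close>

lemma primitive_relation: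
  "\<exists>p\<in>polys B. poly p x = 0 \<and> (\<exists>i. coeff p i = 1)"
proof -
  note B' = subrD[OF B(1)] and T' = subrD[OF subr_adj[OF B(1), of x]]
  define D where "D k = {r + x ^ Suc k * v | r v. r \<in> B \<and> v \<in> adj B x}" for k
  have Bad: "B \<subseteq> adj B x" by (rule adj_superset[OF B(1)])
  have xadj: "x \<in> adj B x" by (rule adj_gen[OF B(1)])
  have D: "subr (D k)" for k
    unfolding subr_def
  proof (intro conjI ballI)
    have "1 + x ^ Suc k * 0 \<in> D k" unfolding D_def using B'(1) T'(2) by blast
    then show "1 \<in> D k" by simp
    fix u v assume "u \<in> D k" "v \<in> D k"
    then obtain r s p q where *: "u = r + x ^ Suc k * p" "v = s + x ^ Suc k * q" "r \<in> B" "s \<in> B"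
      "p \<in> adj B x" "q \<in> adj B x" by (auto simp: D_def)
    have memD: "r + x ^ Suc k * v \<in> D k" if "r \<in> B" "v \<in> adj B x" for r v
      unfolding D_def using that by blast
    have "u - v = (r - s) + x ^ Suc k * (p - q)" by (simp add: * algebra_simps)
    then show "u - v \<in> D k" using memD[OF B'(3)[OF *(3,4)] T'(3)[OF *(5,6)]] by (simp only:)
    have "u * v = r * s + x ^ Suc k * (r * q + s * p + x ^ Suc k * (p * q))"
      by (simp add: * algebra_simps)
    moreover have "r * q + s * p + x ^ Suc k * (p * q) \<in> adj B x"
      using * Bad by (intro T'(6) T'(4) subr_power[OF subr_adj[OF B(1)] xadj]) auto
    ultimately show "u * v \<in> D k" using memD[OF B'(4)[OF *(3,4)]] by (simp only:)
  qed
  have RD: "R \<subseteq> D k" for k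
  proof
    fix r assume "r \<in> R"
    then have "r + x ^ Suc k * 0 \<in> D k" unfolding D_def using T'(2) B(2) by blast
    then show "r \<in> D k" by simp
  qed
  have dec: "D (Suc k) \<subseteq> D k" for k
  proof
    fix u assume "u \<in> D (Suc k)"
    then obtain r v where *: "u = r + x ^ Suc k * (x * v)" "r \<in> B" "v \<in> adj B x"
      by (auto simp: D_def mult_ac)
    then have "x * v \<in> adj B x" using T'(4) xadj by blast
    then have "r + x ^ Suc k * (x * v) \<in> D k" unfolding D_def using *(2) by blast
    then show "u \<in> D k" using *(1) by (simp only:)
  qed
  obtain k where k: "D (Suc k) = D k" using no_desc D RD dec by blast
  have "0 + x ^ Suc k * 1 \<in> D k" unfolding D_def using B'(2) T'(1) by blast
  then have "x ^ Suc k \<in> D (Suc k)" using k by simp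
  then obtain r v where rv: "x ^ Suc k = r + x ^ Suc (Suc k) * v" "r \<in> B" "v \<in> adj B x"
    unfolding D_def by blast
  then obtain q where q: "q \<in> polys B" "v = poly q x" by (auto simp: adj_def)
  \<comment> \<open>The exponent \<open>Suc k\<close> is positive, so the constant \<open>r\<close>
    does not disturb the coefficient 1.\<close>
  define p where "p = monom 1 (Suc k) - [:r:] - monom 1 (Suc (Suc k)) * q"
  have "p \<in> polys B"
    unfolding p_def using polys_monom[OF B'(2,1)] polys_const[OF B'(2)] q rv
    by (intro subrD(3,4)[OF subr_polys[OF B(1)]]) auto
  moreover have "poly p x = x ^ Suc k - r - x ^ Suc (Suc k) * v" by (simp add: p_def poly_monom q(2))
  then have "poly p x = 0" using rv(1) by (simp only: add_diff_cancel_left' diff_self)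
  moreover have "coeff p (Suc k) = 1" by (simp add: p_def coeff_monom_mult)
  ultimately show ?thesis by blast
qed

text \<open>The fractional ideal generated by 1 and \<open>x\<close> is invertible. The Horner tails
  \<open>b j\<close> of a relation \<open>p\<close> satisfy
  \<open>b j = coeff p j + x * b (Suc j)\<close>, so a coefficient 1 at \<open>i\<close> gives
  \<open>b i - x * b (Suc i) = 1\<close>; integral closedness puts the tails and their multiples by
  \<open>x\<close> into \<open>B\<close>.\<close>

lemma pruefer_pair:
  "\<exists>a\<in>B. \<exists>b\<in>B. a + b * x = 1 \<and> a * x \<in> B \<and> b * x \<in> B"
proof -
  obtain p i where p: "p \<in> polys B" "poly p x = 0" "coeff p i = 1" using primitive_relation by blast
  define b where "b j = poly (poly_shift j p) x" for j
  note B' = subrD[OF B(1)]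
  have rec: "b j = coeff p j + x * b (Suc j)" for j
    unfolding b_def by (rule poly_shift_rec)
  have b0: "b 0 = 0" using p by (simp add: b_def)
  have big: "b j = 0" if "j > degree p" for j
  proof -
    have "poly_shift j p = 0" using that by (intro poly_eqI) (auto simp: coeff_poly_shift coeff_eq_0)
    then show ?thesis by (simp add: b_def)
  qed
  \<comment> \<open>\<open>b j\<close> is the leading coefficient of an equation for \<open>x\<close>, so \<open>b j * x\<close> is integral over \<open>B\<close>.\<close>
  have xb: "x * b j \<in> B" if "b j \<in> B" for j
  proof (cases j)
    case 0
    then show ?thesis using b0 B' by simp
  next
    case (Suc j')
    have "b (j - l) \<in> lead_rel B {b j} x" if "l < j" for l
      using that
    proof (induction l)
      case 0
      then show ?case by (auto intro: lead_rel.lead)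
    next
      case (Suc l)
      have "b (j - Suc l) = coeff p (j - Suc l) + x * b (j - l)"
        using rec[of "j - Suc l"] Suc.prems by (simp add: Suc_diff_Suc)
      moreover have "b (j - l) \<in> lead_rel B {b j} x" using Suc by simp
      ultimately show ?case using polysD[OF p(1)] by (simp add: lead_rel.horner)
    qed
    from this[of j'] have "b 1 \<in> lead_rel B {b j} x" using Suc by simp
    from lead_rel_scale_integral[OF B(1) that this] polysD[OF p(1)]
    obtain k where "b j ^ k * (coeff p 0 + x * b 1) \<in> lead_rel B {1} (b j * x)" by blast
    then have "0 \<in> lead_rel B {1} (b j * x)" using rec[of 0] b0 by simp
    from B_integrally_closed[OF this] show ?thesis by (simp add: mult.commute)
  qed
  \<comment> \<open>Descending induction on the index, started just above the degree, where the tail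
    is 0.\<close>
  have bB: "b (Suc (degree p) - l) \<in> B" for l
  proof (induction l)
    case 0
    then show ?case using big B' by simp
  next
    case (Suc l)
    show ?case
    proof (cases "l \<le> degree p")
      case True
      then have "b (Suc (degree p) - Suc l) = coeff p (degree p - l) + x * b (Suc (degree p) - l)"
        using rec[of "degree p - l"] by (simp add: Suc_diff_le)
      then show ?thesis using xb[OF Suc] polysD[OF p(1)] B'(6) by simp
    next
      case False
      then show ?thesis using Suc by simp
    qed
  qed
  have bB: "b j \<in> B" for j
    using bB[of "Suc (degree p) - j"] big[of j] B'(2) by (cases "j \<le> degree p") auto
  have "b i + (- b (Suc i)) * x = 1" using rec[of i] p(3) by (simp add: mult.commute)
  moreover have "b i * x \<in> B" "(- b (Suc i)) * x \<in> B" using xb bB B'(5) by (auto simp: mult.commute)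
  ultimately show ?thesis using bB[of i] bB[of "Suc i"] B'(5) by blast
qed

end

section \<open>Unit content polynomials\<close>

context fcp_ext
begin

text \<open>\<open>Y\<close> generates the inverse of the fractional ideal generated by \<open>Z\<close> and \<open>1\<close>.\<close>

lemma inverse_set:
  assumes "finite Z"
  shows "\<exists>Y. finite Y \<and> (\<forall>y\<in>Y. \<forall>z\<in>insert 1 Z. y * z \<in> B) \<and>
    (\<forall>J. smod B J \<longrightarrow> (\<forall>y\<in>Y. \<forall>z\<in>insert 1 Z. y * z \<in> J) \<longrightarrow> 1 \<in> J)"
  using assms
proof induction
  case empty
  show ?case by (rule exI[of _ "{1}"]) (use subrD(1)[OF B(1)] in auto)
next
  case (insert x Z)
  note B' = subrD[OF B(1)]
  obtain Y where Y: "finite Y" "\<And>y z. y \<in> Y \<Longrightarrow> z \<in> insert 1 Z \<Longrightarrow> y * z \<in> B"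
    "\<And>J. smod B J \<Longrightarrow> (\<forall>y\<in>Y. \<forall>z\<in>insert 1 Z. y * z \<in> J) \<Longrightarrow> 1 \<in> J"
    using insert.IH by blast
  have "\<forall>y. \<exists>a b. a \<in> B \<and> b \<in> B \<and> a + b * (y * x) = 1 \<and> a * (y * x) \<in> B \<and> b * (y * x) \<in> B"
    using pruefer_pair by blast
  then obtain a b where ab: "\<And>y. a y \<in> B" "\<And>y. b y \<in> B" "\<And>y. a y + b y * (y * x) = 1"
    "\<And>y. a y * (y * x) \<in> B" "\<And>y. b y * (y * x) \<in> B" by metis
  \<comment> \<open>The pair is taken for \<open>y * x\<close>, not for \<open>x\<close>: then
    \<open>a y * y\<close> and \<open>b y * y\<close> multiply \<open>x\<close> into
    \<open>B\<close>, and still multiply the old elements into \<open>B\<close>.\<close>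
  define Y' where "Y' = (\<lambda>y. a y * y) ` Y \<union> (\<lambda>y. b y * y) ` Y"
  show ?case
  proof (intro exI[of _ Y'] conjI ballI allI impI)
    show "finite Y'" using Y(1) by (simp add: Y'_def)
    fix y' z assume "y' \<in> Y'" and z: "z \<in> insert 1 (insert x Z)"
    then obtain y c where y: "y \<in> Y" "y' = c * y" "c \<in> B" "c * (y * x) \<in> B"
      using ab by (auto simp: Y'_def)
    show "y' * z \<in> B"
    proof (cases "z = x")
      case True
      then show ?thesis using y by (simp add: mult.assoc)
    next
      case False
      then have "y * z \<in> B" using Y(2)[OF y(1), of z] z by blast
      then show ?thesis using y(2,3) B'(4) by (simp add: mult.assoc)
    qed
  next
    fix J assume J: "smod B J" and mem: "\<forall>y\<in>Y'. \<forall>z\<in>insert 1 (insert x Z). y * z \<in> J"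
    have "y * z \<in> J" if y: "y \<in> Y" and z: "z \<in> insert 1 Z" for y z
    proof -
      have 1: "(a y * y) * z \<in> J" using mem y z by (auto simp: Y'_def)
      have 2: "(b y * y) * x \<in> J" using mem y by (auto simp: Y'_def)
      have "y * z = (a y + b y * (y * x)) * (y * z)" by (simp only: ab(3) mult_1)
      also have "\<dots> = (a y * y) * z + (y * z) * ((b y * y) * x) + (a y * y * z - a y * y * z)"
        by (simp add: algebra_simps)
      finally have "y * z = (a y * y) * z + (y * z) * ((b y * y) * x)" by simp
      moreover have "(y * z) * ((b y * y) * x) \<in> J"
        using smodD(3)[OF J Y(2)[OF y z] 2] .
      ultimately show ?thesis using smodD(2)[OF J 1] by metis
    qed
    then show "1 \<in> J" using Y(3)[OF J] by blast
  qed
qed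

text \<open>The elements of \<open>Y\<close> are placed in degrees further apart than the degree of
  \<open>F\<close>, so that \<open>\<phi> * F\<close> shows the coefficients of all
  \<open>y * F\<close> without overlap.\<close>

lemma spread:
  assumes "finite Y"
  shows "\<exists>\<phi>. (\<forall>i. coeff \<phi> i \<in> insert 0 Y) \<and>
    (\<forall>J. smod B J \<longrightarrow> \<phi> * F \<in> polys J \<longrightarrow> (\<forall>y\<in>Y. smult y F \<in> polys J))"
  using assms
proof induction
  case empty
  show ?case by (intro exI[of _ 0]) auto
next
  case (insert y Y)
  then obtain \<phi> where \<phi>: "\<And>i. coeff \<phi> i \<in> insert 0 Y"
    "\<And>J. smod B J \<Longrightarrow> \<phi> * F \<in> polys J \<Longrightarrow> (\<forall>y\<in>Y. smult y F \<in> polys J)" by blast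
  define N where "N = Suc (degree F)"
  define \<psi> where "\<psi> = [:y:] + monom 1 N * \<phi>"
  have eq: "\<psi> * F = smult y F + monom 1 N * (\<phi> * F)" by (simp add: \<psi>_def algebra_simps)
  show ?case
  proof (intro exI[of _ \<psi>] conjI allI impI)
    fix i show "coeff \<psi> i \<in> insert 0 (insert y Y)"
      using \<phi>(1)[of "i - N"] by (auto simp: \<psi>_def coeff_monom_mult coeff_pCons N_def split: nat.split)
  next
    fix J assume J: "smod B J" "\<psi> * F \<in> polys J"
    have "coeff (smult y F) i \<in> J" for i
    proof (cases "i \<le> degree F")
      case True
      then show ?thesis using polysD[OF J(2), of i] by (simp add: eq coeff_monom_mult N_def)
    next
      case False
      then show ?thesis using smodD(1)[OF J(1)] by (simp add: coeff_eq_0)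
    qed
    moreover have "coeff (\<phi> * F) i \<in> J" for i
      using polysD[OF J(2), of "i + N"] by (simp add: eq coeff_monom_mult coeff_eq_0 N_def)
    ultimately show "\<forall>y\<in>insert y Y. smult y F \<in> polys J" using \<phi>(2)[OF J(1)] polysI by blast
  qed
qed

text \<open>Generators of the inverse of the fractional ideal of coefficients of \<open>F\<close>,
  spread over one polynomial, clear the denominators and leave unit content.\<close>

lemma unit_multiple:
  assumes "coeff F i = 1"
  shows "\<exists>\<phi>\<in>polys B. \<phi> * F \<in> unit_polys B \<and> (\<forall>j. smult (coeff F j) \<phi> \<in> polys B)"
proof -
  define Z where "Z = coeff F ` {..degree F}"
  have Z: "coeff F j = 0 \<or> coeff F j \<in> Z" for j
    by (cases "j \<le> degree F") (auto simp: Z_def coeff_eq_0)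
  have "finite Z" by (simp add: Z_def)
  from inverse_set[OF this] obtain Y where Y: "finite Y"
    "\<And>y z. y \<in> Y \<Longrightarrow> z \<in> insert 1 Z \<Longrightarrow> y * z \<in> B"
    "\<And>J. smod B J \<Longrightarrow> (\<forall>y\<in>Y. \<forall>z\<in>insert 1 Z. y * z \<in> J) \<Longrightarrow> 1 \<in> J" by blast
  from spread[OF Y(1), of F] obtain \<phi> where \<phi>: "\<And>i. coeff \<phi> i \<in> insert 0 Y"
    "\<And>J. smod B J \<Longrightarrow> \<phi> * F \<in> polys J \<Longrightarrow> (\<forall>y\<in>Y. smult y F \<in> polys J)" by blast
  note B0 = subrD(2)[OF B(1)]
  have YB: "y * 1 \<in> B" if "y \<in> Y" for y using Y(2)[OF that, of 1] by simp
  have \<phi>B: "\<phi> \<in> polys B"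
  proof (rule polysI)
    fix i show "coeff \<phi> i \<in> B" using \<phi>(1)[of i] YB B0 by auto
  qed
  have prod: "coeff \<phi> i * coeff F j \<in> B" for i j
    using \<phi>(1)[of i] Z[of j] Y(2)[of "coeff \<phi> i" "coeff F j"] B0 by auto
  have "smult (coeff F j) \<phi> \<in> polys B" for j
    using prod by (intro polysI) (simp add: mult.commute)
  moreover have "\<phi> * F \<in> unit_polys B"
  proof (rule unit_polysI[OF B(1)])
    show "\<phi> * F \<in> polys B"
      using prod by (intro polysI) (auto simp: coeff_mult intro!: smod_sum[OF smod_self[OF B(1)]])
    fix J assume J: "smod B J" "\<phi> * F \<in> polys J"
    have yF: "y * coeff F j \<in> J" if "y \<in> Y" for y j
      using \<phi>(2)[OF J] that polysD[of "smult y F" J j] by simp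
    have "y * z \<in> J" if "y \<in> Y" "z \<in> insert 1 Z" for y z
      using that yF[OF that(1)] yF[OF that(1), of i] assms by (auto simp: Z_def)
    then show "1 \<in> J" using Y(3)[OF J(1)] by blast
  qed
  ultimately show ?thesis using \<phi>B by blast
qed

text \<open>Induction on Horner's scheme with \<open>n\<close> free. A lowest coefficient in
  \<open>M[X]\<close> is absorbed by \<open>E\<close> at the cost of one more factor
  \<open>f\<close>; the unit content of the leading coefficient ends the process.\<close>

lemma maximal_power_relation:
  assumes E: "smod (polys B) E" and M: "rel_maximal R {1} M" "polys M \<subseteq> E" and f: "f \<in> polys B"
    and "p \<in> lead_rel (polys R) (unit_polys R) f"
  shows "p \<in> polys B \<and> (\<forall>n. f ^ n * p \<in> E \<longrightarrow>
    (\<exists>n. \<exists>h\<in>polys B. \<exists>\<alpha>\<in>unit_polys R. f ^ n * (\<alpha> - f * h) \<in> E))"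
  using assms(5)
proof induction
  case (lead s)
  have "s \<in> polys B" using lead unit_polysD polys_mono[OF B(2)] by blast
  moreover have "s - f * 0 = s" by simp
  moreover have "0 \<in> polys B" using subrD(2)[OF subr_polys[OF B(1)]] .
  ultimately show ?case using lead by metis
next
  case (horner p b)
  note pB = subrD[OF subr_polys[OF B(1)]]
  have bB: "b \<in> polys B" using horner polys_mono[OF B(2)] by blast
  have "\<exists>n. \<exists>h\<in>polys B. \<exists>\<alpha>\<in>unit_polys R. f ^ n * (\<alpha> - f * h) \<in> E"
    if n: "f ^ n * (b + f * p) \<in> E" for n
  proof (cases "b \<in> polys M")
    case True
    then have "f ^ n * b \<in> E" using smodD(3)[OF E subr_power[OF subr_polys[OF B(1)] f]] M(2) by blast
    then have "f ^ n * (b + f * p) - f ^ n * b \<in> E"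
      using smod_diff[OF E subr_polys[OF B(1)] n] by blast
    moreover have "f ^ n * (b + f * p) - f ^ n * b = f ^ Suc n * p" by (simp add: algebra_simps)
    ultimately have "f ^ Suc n * p \<in> E" by (simp only:)
    then show ?thesis using horner.IH by blast
  next
    case False
    obtain m where m: "m \<in> polys M" "b + m \<in> unit_polys R"
      using rel_maximal_polys[OF R M(1) horner.hyps(2) False] by blast
    have "f ^ n * m \<in> E" using smodD(3)[OF E subr_power[OF subr_polys[OF B(1)] f]] M(2) m by blast
    then have "f ^ n * (b + f * p) + f ^ n * m \<in> E" using smodD(2)[OF E n] by blast
    moreover have "f ^ n * (b + f * p) + f ^ n * m = f ^ n * ((b + m) - f * (- p))"
      by (simp add: algebra_simps)
    ultimately have "f ^ n * ((b + m) - f * (- p)) \<in> E" by (simp only:)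
    moreover have "- p \<in> polys B" using horner.IH pB(5) by blast
    ultimately show ?thesis using m by blast
  qed
  moreover have "b + f * p \<in> polys B" using pB(6)[OF bB pB(4)[OF f]] horner.IH by blast
  ultimately show ?case by blast
qed

text \<open>
  \<open>f\<close> satisfies an equation with unit leading coefficient modulo each of the maximal ideals along a
  composition series of \<open>B / R\<close>; the lowest coefficient outside of that ideal may be replaced by a unit
  content polynomial \<open>\<alpha>\<close>, and the product of the resulting relations carries \<open>B[X]\<close> into \<open>R[X]\<close>.
\<close>

lemma power_relation:
  assumes f: "f \<in> polys B"
  shows "\<exists>n. \<exists>h\<in>polys B. \<exists>\<alpha>\<in>unit_polys R. \<forall>v\<in>polys B. f ^ n * (\<alpha> - f * h) * v \<in> polys R"
proof -
  note pB = subrD[OF subr_polys[OF B(1)]]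
  have int: "0 \<in> lead_rel (polys R) (unit_polys R) f"
    using steps_polys[OF B(3) R smod_self[OF R]] subr_polys[OF R] subr_polys[OF B(1)] f
    by (rule steps_integral) (use unit_polysD unit_polys_1[OF R] unit_polys_mult[OF R] in auto)
  \<comment> \<open>The induction runs from \<open>B\<close> down to \<open>R\<close>; each step
    adds a factor that moves the product into the next smaller module.\<close>
  have "smod R N \<longrightarrow> (\<exists>n. \<exists>h\<in>polys B. \<exists>\<alpha>\<in>unit_polys R. \<forall>v\<in>polys B. f ^ n * (\<alpha> - f * h) * v \<in> polys N)"
    if "(simple_step R {1})\<^sup>*\<^sup>* N B" for N
    using that
  proof (induction rule: converse_rtranclp_induct)
    case base
    have "f ^ 0 * (1 - f * 0) * v \<in> polys B" if "v \<in> polys B" for v using that by simp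
    then show ?case using pB(2) unit_polys_1[OF R] by blast
  next
    case (step N N')
    show ?case
    proof
      assume N: "smod R N"
      obtain M e where M: "rel_maximal R {1} M" "N' = adjoin R N e" "\<And>m. m \<in> M \<Longrightarrow> m * e \<in> N"
        using step(1) by (auto simp: simple_step_def)
      have smM: "smod R M" "M \<subseteq> R" using M by (auto simp: rel_maximal_def)
      have "smod R N'" using smod_step[OF R N step(1)] .
      then obtain n h \<alpha> where q: "h \<in> polys B" "\<alpha> \<in> unit_polys R"
        "\<And>v. v \<in> polys B \<Longrightarrow> f ^ n * (\<alpha> - f * h) * v \<in> polys N'" using step.IH by blast
      define q where "q = f ^ n * (\<alpha> - f * h)"
      \<comment> \<open>An ideal of \<open>B[X]\<close>: the further factors \<open>u\<close> that
        carry \<open>q B[X]\<close> into \<open>N[X]\<close>. It contains \<open>M[X]\<close>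
        because \<open>M\<close> kills \<open>N' / N\<close>.\<close>
      define E where "E = {u \<in> polys B. \<forall>v\<in>polys B. q * u * v \<in> polys N}"
      have E: "smod (polys B) E"
        unfolding smod_def
      proof (intro conjI ballI)
        show "0 \<in> E" using pB(2) smodD(1)[OF N] by (auto simp: E_def polys_def)
        show "u + v \<in> E" if "u \<in> E" "v \<in> E" for u v
          using that pB(6) smodD(2)[OF smod_polys[OF N]] by (auto simp: E_def distrib_left distrib_right)
        show "a * u \<in> E" if "a \<in> polys B" "u \<in> E" for a u
        proof -
          have "q * (a * u) * v \<in> polys N" if "v \<in> polys B" for v
          proof -
            have "q * u * (a * v) \<in> polys N"
              using \<open>u \<in> E\<close> pB(4)[OF \<open>a \<in> polys B\<close> that] by (auto simp: E_def)
            then show ?thesis by (simp add: mult_ac)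
          qed
          then show ?thesis using that pB(4) by (auto simp: E_def)
        qed
      qed
      have ME: "polys M \<subseteq> E"
      proof
        fix m assume m: "m \<in> polys M"
        have mR: "m \<in> polys R" using m polys_mono[OF smM(2)] by blast
        have "c * x \<in> N" if "c \<in> M" "x \<in> N'" for c x
        proof -
          obtain n a where x: "x = n + a * e" "n \<in> N" "a \<in> R"
            using \<open>x \<in> N'\<close> M(2) by (auto simp: adjoin_def)
          have "c * x = c * n + a * (c * e)" by (simp add: x algebra_simps)
          then show ?thesis using x that M(3) smodD(2,3)[OF N] smM(2) by (metis subsetD)
        qed
        then have "m * x \<in> polys N" if "x \<in> polys N'" for x
          using polysD[OF m] polysD[OF that] by (intro polysI) (auto simp: coeff_mult intro!: smod_sum[OF N])
        moreover have "q * v \<in> polys N'" if "v \<in> polys B" for v using q(3)[OF that] by (simp add: q_def)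
        ultimately have mqv: "m * (q * v) \<in> polys N" if "v \<in> polys B" for v using that by blast
        have "q * m * v \<in> polys N" if "v \<in> polys B" for v
          using mqv[OF that] by (simp only: mult.assoc mult.left_commute)
        then show "m \<in> E" using mR polys_mono[OF B(2)] unfolding E_def by auto
      qed
      have "0 \<in> E" using smodD(1)[OF E] .
      then obtain n' h' \<alpha>' where q': "h' \<in> polys B" "\<alpha>' \<in> unit_polys R" "f ^ n' * (\<alpha>' - f * h') \<in> E"
        using maximal_power_relation[OF E M(1) ME f int] by (metis mult_zero_right)
      \<comment> \<open>From \<open>(\<alpha> - f * h) * (\<alpha>' - f * h') = \<alpha> * \<alpha>'
        - f * k\<close>.\<close>
      define k where "k = \<alpha> * h' + h * \<alpha>' - f * (h * h')"
      have "q * (f ^ n' * (\<alpha>' - f * h')) = f ^ (n + n') * (\<alpha> * \<alpha>' - f * k)"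
        by (simp add: q_def k_def power_add algebra_simps)
      moreover have "\<alpha> \<in> polys B" "\<alpha>' \<in> polys B"
        using q(2) q'(2) unit_polysD polys_mono[OF B(2)] by blast+
      then have "k \<in> polys B" using q(1) q'(1) f pB by (auto simp: k_def)
      moreover have "\<alpha> * \<alpha>' \<in> unit_polys R" using unit_polys_mult[OF R] q(2) q'(2) by blast
      ultimately show "\<exists>n. \<exists>h\<in>polys B. \<exists>\<alpha>\<in>unit_polys R. \<forall>v\<in>polys B. f ^ n * (\<alpha> - f * h) * v \<in> polys N"
        using q'(3) unfolding E_def by (metis (no_types, lifting) mem_Collect_eq)
    qed
  qed
  with B(3) smod_self[OF R] show ?thesis by blast
qed

text \<open>The conductor of \<open>R\<close> in \<open>B\<close>, an ideal of both rings.\<close>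

definition K :: "'a set" where "K = {k \<in> R. \<forall>v\<in>B. k * v \<in> R}"

lemma K: "smod B K" "K \<subseteq> R"
proof -
  have "(a * k) * v \<in> R" if "a \<in> B" "k \<in> K" "v \<in> B" for a k v
    using that subrD(4)[OF B(1)] by (auto simp: K_def mult.assoc mult.left_commute[of a k])
  moreover from this[of _ _ 1] have "a * k \<in> R" if "a \<in> B" "k \<in> K" for a k
    using that subrD(1)[OF B(1)] by simp
  ultimately show "smod B K"
    using subrD[OF R] by (auto simp: smod_def K_def distrib_right)
qed (auto simp: K_def)

lemma polys_K: "(\<And>v. v \<in> polys B \<Longrightarrow> q * v \<in> polys R) \<Longrightarrow> q \<in> polys K"
proof (rule polysI)
  fix i assume *: "\<And>v. v \<in> polys B \<Longrightarrow> q * v \<in> polys R"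
  have "coeff q i * c \<in> R" if "c \<in> B" for c
    using *[of "[:c:]"] that polysD[of "smult c q" R i] subrD(2)[OF B(1)]
    by (simp add: polys_const mult.commute)
  moreover have "coeff q i \<in> R" using calculation[of 1] subrD(1)[OF B(1)] by simp
  ultimately show "coeff q i \<in> K" by (simp add: K_def)
qed

text \<open>\<open>power_relation\<close> for \<open>g\<close> gives
  \<open>g ^ n * (\<alpha> - g * h)\<close> in \<open>K[X]\<close>, and McCoy's theorem over
  \<open>B\<close> removes \<open>g ^ n\<close>. So \<open>g * h\<close> has unit content up to
  \<open>K\<close>; elements of \<open>K\<close> can be supplied from multiples of \<open>g\<close>,
  because \<open>K\<close> is an ideal of \<open>B\<close> and \<open>g\<close> has unit content
  there.\<close>

lemma unit_polys_descend:
  assumes g: "g \<in> unit_polys B"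
  shows "\<exists>h\<in>polys B. g * h \<in> unit_polys R"
proof -
  note pB = subrD[OF subr_polys[OF B(1)]] and pR = subrD[OF subr_polys[OF R]]
  note gB = unit_polysD[OF g]
  obtain n h \<alpha> where h: "h \<in> polys B" and \<alpha>: "\<alpha> \<in> unit_polys R"
    and q: "\<And>v. v \<in> polys B \<Longrightarrow> g ^ n * (\<alpha> - g * h) * v \<in> polys R"
    using power_relation[OF gB] by blast
  have "g ^ n * (\<alpha> - g * h) \<in> polys K" by (rule polys_K[OF q])
  then have kK: "\<alpha> - g * h \<in> polys K"
    by (rule mccoy[OF B(1) K(1) unit_polys_power[OF B(1) g]])
  obtain \<beta> k where \<beta>: "\<beta> \<in> polys R" "coeff (\<alpha> * \<beta>) k = 1"
    using \<alpha> by (auto simp: unit_polys_def)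
  obtain \<gamma> l where \<gamma>: "\<gamma> \<in> polys B" "coeff (g * \<gamma>) l = 1"
    using g by (auto simp: unit_polys_def)
  have \<beta>B: "\<beta> \<in> polys B" using \<beta> polys_mono[OF B(2)] by blast
  \<comment> \<open>The defect of \<open>g * h\<close>: \<open>c\<close> and the coefficient of
    \<open>\<beta> * (g * h)\<close> in degree \<open>k\<close> add up to 1.\<close>
  define c where "c = coeff ((\<alpha> - g * h) * \<beta>) k"
  have cK: "c \<in> K"
    using polysD[OF smodD(3)[OF smod_polys[OF K(1)] \<beta>B kK]] by (simp add: c_def mult.commute)
  define u where "u = g * h"
  define D where "D = Suc (degree u)"
  define w where "w = g * smult c \<gamma>"
  have wK: "w \<in> polys K"
    unfolding w_def using smodD(3)[OF smod_polys[OF K(1)] gB] polys_smult'[OF K(1) cK \<gamma>(1)] by blast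
  have uR: "u \<in> polys R"
  proof -
    have "\<alpha> - (\<alpha> - g * h) \<in> polys R"
      using pR(3)[OF unit_polysD[OF \<alpha>]] kK polys_mono[OF K(2)] by blast
    then show ?thesis by (simp add: u_def)
  qed
  \<comment> \<open>The content of \<open>u = g h\<close> is \<open>R\<close> only up to the conductor \<open>K\<close>; the term \<open>w\<close> contributes the missing \<open>c\<close>.\<close>
  have "u + monom 1 D * w \<in> unit_polys R"
  proof (rule unit_polysI[OF R])
    show "u + monom 1 D * w \<in> polys R"
      by (intro pR(6) pR(4) uR polys_monom subrD(1,2)[OF R] subsetD[OF polys_mono[OF K(2)] wK])
    fix J assume J: "smod R J" "u + monom 1 D * w \<in> polys J"
    have uJ: "u \<in> polys J"
    proof (rule polysI)
      fix i show "coeff u i \<in> J"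
      proof (cases "i < D")
        case True
        then show ?thesis using polysD[OF J(2), of i] by (simp add: coeff_monom_mult)
      next
        case False
        then show ?thesis using smodD(1)[OF J(1)] by (simp add: coeff_eq_0 D_def)
      qed
    qed
    have "coeff w l \<in> J"
      using polysD[OF J(2), of "l + D"] by (simp add: coeff_monom_mult coeff_eq_0 D_def)
    then have "c \<in> J" using \<gamma>(2) by (simp add: w_def)
    moreover have "coeff (\<beta> * u) k \<in> J"
      using polysD[OF smodD(3)[OF smod_polys[OF J(1)] \<beta>(1) uJ]] .
    moreover have "c + coeff (\<beta> * u) k = 1"
      using \<beta>(2) by (simp add: c_def u_def algebra_simps)
    ultimately show "1 \<in> J" using smodD(2)[OF J(1)] by metis
  qed
  moreover have "u + monom 1 D * w = g * (h + monom 1 D * smult c \<gamma>)"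
    by (simp add: u_def w_def algebra_simps)
  moreover have "h + monom 1 D * smult c \<gamma> \<in> polys B"
    by (intro pB(6) pB(4) h polys_monom subrD(1,2)[OF B(1)] polys_smult[OF smod_self[OF B(1)]] \<gamma>(1)
        subsetD[OF B(2)] subsetD[OF K(2)] cK)
  ultimately show ?thesis by metis
qed

lemma unit_polys_divides:
  assumes "g \<in> unit_polys UNIV"
  shows "\<exists>h. g * h \<in> unit_polys R"
proof -
  obtain h n where "coeff (g * h) n = 1" using assms by (auto simp: unit_polys_def)
  then obtain \<phi> where "\<phi> * (g * h) \<in> unit_polys B" using unit_multiple by blast
  then obtain k where "\<phi> * (g * h) * k \<in> unit_polys R" using unit_polys_descend by blast
  then show ?thesis by (intro exI[of _ "\<phi> * h * k"]) (simp add: mult_ac)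
qed

end

section \<open>Saturated rings of polynomials\<close>

text \<open>For subrings \<open>W\<close> and \<open>C\<close> this is the ring generated by
  both.\<close>

inductive_set gen_prod :: "'a::comm_ring_1 set \<Rightarrow> 'a set \<Rightarrow> 'a set" for W C where
  zero: "0 \<in> gen_prod W C"
| step: "p \<in> gen_prod W C \<Longrightarrow> w \<in> W \<Longrightarrow> c \<in> C \<Longrightarrow> p + w * c \<in> gen_prod W C"

lemma gen_prod_add: "q \<in> gen_prod W C \<Longrightarrow> p \<in> gen_prod W C \<Longrightarrow> p + q \<in> gen_prod W C"
  by (induction rule: gen_prod.induct) (auto simp flip: add.assoc intro: gen_prod.step)

lemma gen_prod_elem:
  assumes "w \<in> W" "c \<in> C" shows "w * c \<in> gen_prod W C"
  using gen_prod.step[OF gen_prod.zero assms] by simp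

lemma subr_gen_prod:
  assumes W: "subr W" and C: "subr C"
  shows "subr (gen_prod W C)"
proof -
  have scale: "x * (w * c) \<in> gen_prod W C" if "x \<in> gen_prod W C" "w \<in> W" "c \<in> C" for x w c
    using that
  proof induction
    case zero
    then show ?case by (simp add: gen_prod.zero)
  next
    case (step p w' c')
    have "p * (w * c) + (w' * w) * (c' * c) \<in> gen_prod W C"
      using step subrD(4)[OF W] subrD(4)[OF C] by (intro gen_prod.step) auto
    then show ?case by (simp add: algebra_simps)
  qed
  have mult: "x * y \<in> gen_prod W C" if "y \<in> gen_prod W C" "x \<in> gen_prod W C" for x y
    using that
  proof induction
    case (step p w c)
    then have "x * p + x * (w * c) \<in> gen_prod W C" using scale gen_prod_add by blast
    then show ?case by (simp add: distrib_left)
  qed (simp add: gen_prod.zero)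
  have one: "1 \<in> gen_prod W C" using gen_prod_elem[OF subrD(1)[OF W] subrD(1)[OF C]] by simp
  have minus: "- 1 \<in> gen_prod W C"
    using gen_prod_elem[OF subrD(5)[OF W subrD(1)[OF W]] subrD(1)[OF C]] by simp
  have "x - y \<in> gen_prod W C" if "x \<in> gen_prod W C" "y \<in> gen_prod W C" for x y
    using gen_prod_add[OF mult[OF minus that(2)] that(1)] by simp
  with mult one show ?thesis by (auto simp: subr_def)
qed

text \<open>The degree is only bounded by \<open>d\<close>, so that each \<open>d\<close> gives a
  module; if \<open>X\<close> lies in the ring \<open>W\<close>, these modules increase with
  \<open>d\<close>.\<close>

definition lead_coeffs :: "'a::comm_ring_1 poly set \<Rightarrow> nat \<Rightarrow> 'a set" where
  "lead_coeffs W d = {coeff f d | f. f \<in> W \<and> degree f \<le> d}"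

lemma lead_coeffs_mono:
  assumes "subr W" "monom 1 1 \<in> W"
  shows "lead_coeffs W d \<subseteq> lead_coeffs W (Suc d)"
proof
  fix c assume "c \<in> lead_coeffs W d"
  then obtain f where f: "f \<in> W" "degree f \<le> d" "c = coeff f d" by (auto simp: lead_coeffs_def)
  have "monom 1 1 * f \<in> W" using subrD(4)[OF assms(1,2) f(1)] .
  moreover have "degree (monom 1 1 * f) \<le> Suc d"
    using degree_mult_le[of "monom 1 1" f] degree_monom_le[of "1::'a" 1] f(2) by linarith
  moreover have "coeff (monom 1 1 * f) (Suc d) = c" by (simp add: coeff_monom_mult f(3))
  ultimately show "c \<in> lead_coeffs W (Suc d)" unfolding lead_coeffs_def by blast
qed

lemma smod_lead_coeffs:
  assumes "subr W" "\<And>r. r \<in> A \<Longrightarrow> [:r:] \<in> W"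
  shows "smod A (lead_coeffs W d)"
  unfolding smod_def
proof (intro conjI ballI)
  show "0 \<in> lead_coeffs W d" using subrD(2)[OF assms(1)] by (force simp: lead_coeffs_def)
  fix x y assume "x \<in> lead_coeffs W d" "y \<in> lead_coeffs W d"
  then obtain f g where "f \<in> W" "degree f \<le> d" "x = coeff f d" "g \<in> W" "degree g \<le> d" "y = coeff g d"
    by (auto simp: lead_coeffs_def)
  then show "x + y \<in> lead_coeffs W d"
    using subrD(6)[OF assms(1)] unfolding lead_coeffs_def
    by (auto intro!: exI[of _ "f + g"] degree_add_le)
next
  fix r y assume "r \<in> A" "y \<in> lead_coeffs W d"
  then obtain g where "g \<in> W" "degree g \<le> d" "y = coeff g d" by (auto simp: lead_coeffs_def)
  then show "r * y \<in> lead_coeffs W d"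
    using subrD(4)[OF assms(1) assms(2)[OF \<open>r \<in> A\<close>]] unfolding lead_coeffs_def
    by (auto intro!: exI[of _ "[:r:] * g"] order.trans[OF degree_smult_le])
qed

lemma coeff_mult_bounds:
  assumes "degree f \<le> d" "degree g \<le> e"
  shows "coeff (f * g) (d + e) = coeff f d * coeff g e"
proof -
  have "coeff f i * coeff g (d + e - i) = 0" if "i \<noteq> d" for i
    using that assms by (cases "i < d") (auto simp: coeff_eq_0)
  then have "(\<Sum>i\<in>{..d+e} - {d}. coeff f i * coeff g (d + e - i)) = 0" by (intro sum.neutral) auto
  then show ?thesis by (simp add: coeff_mult sum.remove[of _ d])
qed

lemma subr_lead_coeffs:
  assumes W: "subr W" "monom 1 1 \<in> W"
  shows "subr (\<Union>d. lead_coeffs W d)"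
proof -
  have mono: "lead_coeffs W d \<subseteq> lead_coeffs W e" if "d \<le> e" for d e
    using that lead_coeffs_mono[OF W] by (rule lift_Suc_mono_le[rotated])
  \<comment> \<open>The scalars 1 and -1 suffice for closure under differences.\<close>
  have sm: "smod {-1, 1} (lead_coeffs W d)" for d
    using subrD(1)[OF W(1)] subrD(5)[OF W(1), of 1]
    by (intro smod_lead_coeffs W(1)) (auto simp: one_pCons)
  have "1 \<in> lead_coeffs W 0" using subrD(1)[OF W(1)] by (force simp: lead_coeffs_def)
  moreover have "x - y \<in> (\<Union>d. lead_coeffs W d)" if "x \<in> lead_coeffs W d" "y \<in> lead_coeffs W e" for x y d e
  proof -
    have "x \<in> lead_coeffs W (max d e)" "(-1) * y \<in> lead_coeffs W (max d e)"
      using that mono[of d "max d e"] mono[of e "max d e"] smodD(3)[OF sm, of "-1" y] by auto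
    then have "x + (-1) * y \<in> lead_coeffs W (max d e)" using smodD(2)[OF sm] by blast
    then show ?thesis by auto
  qed
  moreover have "x * y \<in> (\<Union>d. lead_coeffs W d)" if "x \<in> lead_coeffs W d" "y \<in> lead_coeffs W e" for x y d e
  proof -
    from that obtain f g
      where "f \<in> W" "degree f \<le> d" "x = coeff f d" "g \<in> W" "degree g \<le> e" "y = coeff g e"
      by (auto simp: lead_coeffs_def)
    moreover then have "coeff (f * g) (d + e) = x * y"
      by (simp add: coeff_mult_bounds)
    ultimately have "x * y \<in> lead_coeffs W (d + e)"
      using subrD(4)[OF W(1)] unfolding lead_coeffs_def
      by (auto intro!: exI[of _ "f * g"] order.trans[OF degree_mult_le])
    then show ?thesis by blast
  qed
  ultimately show ?thesis unfolding subr_def by (simp only: UN_iff) fast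
qed

text \<open>A filtration from \<open>polys R\<close> that enlarges one degree at a time:
  \<open>N\<close> runs from \<open>R\<close> to \<open>B\<close> in degree \<open>j\<close> before
  \<open>j\<close> is raised.\<close>

definition graded_polys :: "nat \<Rightarrow> 'a set \<Rightarrow> 'a set \<Rightarrow> 'a set \<Rightarrow> 'a::comm_ring_1 poly set" where
  "graded_polys j B N R = {h. (\<forall>i<j. coeff h i \<in> B) \<and> coeff h j \<in> N \<and> (\<forall>i>j. coeff h i \<in> R)}"

text \<open>The scalars are constant polynomials, so that \<open>steps_stabilise\<close> applies
  inside the polynomial ring; the new generator is \<open>e\<close> in degree
  \<open>j\<close>.\<close>

lemma graded_step:
  assumes R: "subr R" and N: "smod R N" and st: "simple_step R {1} N N'" and B: "0 \<in> B"
  shows "simple_step ((\<lambda>r. [:r:]) ` R) {1} (graded_polys j B N R) (graded_polys j B N' R)"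
proof -
  obtain M e where M: "rel_maximal R {1} M" and N': "N' = adjoin R N e" and Me: "\<And>m. m \<in> M \<Longrightarrow> m * e \<in> N"
    using st by (auto simp: simple_step_def)
  have "rel_maximal ((\<lambda>r. [:r:]) ` R) {1} ((\<lambda>r. [:r:]) ` M)"
    unfolding rel_maximal_def
  proof (intro conjI ballI)
    show "smod ((\<lambda>r. [:r:]) ` R) ((\<lambda>r. [:r:]) ` M)" "(\<lambda>r. [:r:]) ` M \<subseteq> (\<lambda>r. [:r:]) ` R"
      using M by (auto simp: rel_maximal_def smod_def image_iff mult.commute[of _ "_ :: 'a"])
    fix x assume "x \<in> (\<lambda>r. [:r:]) ` R"
    then obtain r where r: "r \<in> R" "x = [:r:]" by blast
    show "x \<in> (\<lambda>r. [:r:]) ` M \<or>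
        (\<exists>c\<in>(\<lambda>r. [:r:]) ` R. \<exists>m\<in>(\<lambda>r. [:r:]) ` M. c * x + m \<in> {1})"
    proof (cases "r \<in> M")
      case False
      then obtain c m where cm: "c \<in> R" "m \<in> M" "c * r + m = 1"
        using M r(1) by (auto simp: rel_maximal_def)
      have "[:c:] * x + [:m:] \<in> {1}" using cm(3) by (simp add: r(2) one_pCons mult.commute)
      then show ?thesis using cm(1,2) by blast
    qed (use r in blast)
  qed
  moreover have "graded_polys j B N' R = adjoin ((\<lambda>r. [:r:]) ` R) (graded_polys j B N R) (monom e j)"
  proof safe
    fix h assume h: "h \<in> graded_polys j B N' R"
    then obtain n a where na: "coeff h j = n + a * e" "n \<in> N" "a \<in> R"
      by (auto simp: graded_polys_def N' adjoin_def)
    have "h - smult a (monom e j) \<in> graded_polys j B N R"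
      using h na by (auto simp: graded_polys_def)
    moreover have "h = (h - smult a (monom e j)) + [:a:] * monom e j" by simp
    ultimately show "h \<in> adjoin ((\<lambda>r. [:r:]) ` R) (graded_polys j B N R) (monom e j)"
      unfolding adjoin_def using na(3) by blast
  next
    fix h assume "h \<in> adjoin ((\<lambda>r. [:r:]) ` R) (graded_polys j B N R) (monom e j)"
    then obtain n a where "n \<in> graded_polys j B N R" "a \<in> R" "h = n + [:a:] * monom e j"
      by (auto simp: adjoin_def)
    then show "h \<in> graded_polys j B N' R"
      by (auto simp: graded_polys_def N' adjoin_def)
  qed
  moreover have "[:m:] * monom e j \<in> graded_polys j B N R" if "m \<in> M" for m
    using Me[OF that] B subrD(2)[OF R] by (auto simp: graded_polys_def)
  ultimately show ?thesis unfolding simple_step_def by blast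
qed

lemma compress_chain:
  fixes F :: "nat \<Rightarrow> 'a set"
  assumes "\<And>i. i < m \<Longrightarrow> F i \<subseteq> F (Suc i)"
  shows "\<exists>T. T 0 = F 0 \<and> T (card {i. i < m \<and> F i \<noteq> F (Suc i)}) = F m \<and>
    (\<forall>i<card {i. i < m \<and> F i \<noteq> F (Suc i)}. T i \<subset> T (Suc i)) \<and>
    (\<forall>i. \<exists>j\<le>m. T i = F j)"
  using assms
proof (induction m)
  case 0
  then show ?case by (intro exI[of _ "\<lambda>_. F 0"]) auto
next
  case (Suc m)
  define p where "p = card {i. i < m \<and> F i \<noteq> F (Suc i)}"
  obtain T where T: "T 0 = F 0" "T p = F m" "\<And>i. i < p \<Longrightarrow> T i \<subset> T (Suc i)" "\<And>i. \<exists>j\<le>m. T i = F j"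
    using Suc unfolding p_def by auto
  show ?case
  proof (cases "F m = F (Suc m)")
    case True
    then have "{i. i < Suc m \<and> F i \<noteq> F (Suc i)} = {i. i < m \<and> F i \<noteq> F (Suc i)}"
      by (auto simp: less_Suc_eq)
    moreover have "\<exists>j\<le>Suc m. T i = F j" for i using T(4)[of i] le_SucI by blast
    ultimately show ?thesis using T(1-3) True by (intro exI[of _ T]) (auto simp: p_def)
  next
    case False
    then have "{i. i < Suc m \<and> F i \<noteq> F (Suc i)} = insert m {i. i < m \<and> F i \<noteq> F (Suc i)}"
      by (auto simp: less_Suc_eq)
    then have card: "card {i. i < Suc m \<and> F i \<noteq> F (Suc i)} = Suc p" by (simp add: p_def)
    define T' where "T' i = (if i \<le> p then T i else F (Suc m))" for i
    have "F m \<subset> F (Suc m)" using False Suc.prems[of m] by blast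
    then have "T' i \<subset> T' (Suc i)" if "i < Suc p" for i
      using that T(2,3) by (cases "i = p") (auto simp: T'_def)
    moreover have "\<exists>j\<le>Suc m. T' i = F j" for i
      using T(4)[of i] by (auto simp: T'_def le_Suc_eq)
    ultimately show ?thesis using T(1) unfolding card by (intro exI[of _ T']) (auto simp: T'_def)
  qed
qed

section \<open>Saturated rings and their extensions by \<open>B\<close>\<close>

context fcp_ext
begin

text \<open>Such a \<open>W\<close> stands for its ring of fractions with denominators in
  \<open>unit_polys R\<close>.\<close>

definition sat_ring :: "'a poly set \<Rightarrow> bool" where
  "sat_ring W \<longleftrightarrow> subr W \<and> polys R \<subseteq> W \<and> sat (unit_polys R) W"

lemma sat_ringD:
  assumes "sat_ring W"
  shows "subr W" "polys R \<subseteq> W" "s \<in> unit_polys R \<Longrightarrow> s * f \<in> W \<Longrightarrow> f \<in> W"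
  using assms by (auto simp: sat_ring_def sat_def)

definition V :: "'a poly set \<Rightarrow> 'a poly set" where
  "V W = {f. \<exists>\<alpha>\<in>unit_polys R. \<alpha> * f \<in> gen_prod W (polys B)}"

lemma V_gen: "gen_prod W (polys B) \<subseteq> V W"
  using unit_polys_1[OF R] by (auto simp: V_def intro!: bexI[of _ 1])

text \<open>\<open>V W\<close> inverts unit content over \<open>R\<close> only; its saturation with
  respect to unit content over \<open>B\<close> comes from
  \<open>unit_polys_descend\<close>.\<close>

lemma V_props:
  assumes W: "sat_ring W"
  shows "subr (V W)" "polys B \<subseteq> V W" "W \<subseteq> V W" "\<And>s f. s \<in> unit_polys B \<Longrightarrow> s * f \<in> V W \<Longrightarrow> f \<in> V W"
proof -
  note W' = sat_ringD[OF W] and pB = subrD[OF subr_polys[OF B(1)]]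
  have G: "subr (gen_prod W (polys B))" by (rule subr_gen_prod[OF W'(1) subr_polys[OF B(1)]])
  note G' = subrD[OF G]
  show BV: "polys B \<subseteq> V W"
    using gen_prod_elem[OF subrD(1)[OF W'(1)], of _ "polys B"] V_gen[of W] by auto
  show WV: "W \<subseteq> V W"
    using gen_prod_elem[OF _ pB(1), of _ W] V_gen[of W] by auto
  have uG: "s \<in> gen_prod W (polys B)" if "s \<in> unit_polys R" for s
    using gen_prod_elem[OF _ pB(1), of s W] W'(2) unit_polysD[OF that] by auto
  show sV: "subr (V W)"
    unfolding subr_def
  proof (intro conjI ballI)
    show "1 \<in> V W" using BV pB(1) by blast
    fix f g assume "f \<in> V W" "g \<in> V W"
    then obtain \<alpha> \<beta> where ab: "\<alpha> \<in> unit_polys R" "\<beta> \<in> unit_polys R"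
      "\<alpha> * f \<in> gen_prod W (polys B)" "\<beta> * g \<in> gen_prod W (polys B)" by (auto simp: V_def)
    have "\<beta> * (\<alpha> * f) - \<alpha> * (\<beta> * g) \<in> gen_prod W (polys B)"
      by (intro G'(3) G'(4)[OF uG] ab)
    then have "(\<alpha> * \<beta>) * (f - g) \<in> gen_prod W (polys B)" by (simp add: algebra_simps)
    then show "f - g \<in> V W" unfolding V_def using unit_polys_mult[OF R ab(1,2)] by blast
    have "(\<alpha> * f) * (\<beta> * g) \<in> gen_prod W (polys B)"
      by (rule G'(4)[OF ab(3,4)])
    then have "(\<alpha> * \<beta>) * (f * g) \<in> gen_prod W (polys B)" by (simp add: algebra_simps)
    then show "f * g \<in> V W" unfolding V_def using unit_polys_mult[OF R ab(1,2)] by blast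
  qed
  fix s f assume s: "s \<in> unit_polys B" "s * f \<in> V W"
  obtain h where h: "h \<in> polys B" "s * h \<in> unit_polys R" using unit_polys_descend[OF s(1)] by blast
  have "h * (s * f) \<in> V W" using subrD(4)[OF sV] h(1) BV s(2) by blast
  then obtain \<alpha> where a: "\<alpha> \<in> unit_polys R" "\<alpha> * (h * (s * f)) \<in> gen_prod W (polys B)"
    by (auto simp: V_def)
  then have "(\<alpha> * (s * h)) * f \<in> gen_prod W (polys B)" by (simp add: mult_ac)
  then show "f \<in> V W" unfolding V_def using unit_polys_mult[OF R a(1) h(2)] by blast
qed

lemma mult_coeffs: "(\<And>j. smult (coeff f j) \<phi> \<in> polys B) \<Longrightarrow> \<phi> * f \<in> polys B"
proof (rule polysI)
  fix n assume *: "\<And>j. smult (coeff f j) \<phi> \<in> polys B"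
  have "coeff \<phi> i * coeff f j \<in> B" for i j using polysD[OF *, of j i] by (simp add: mult.commute)
  then show "coeff (\<phi> * f) n \<in> B"
    unfolding coeff_mult by (intro smod_sum[OF smod_self[OF B(1)]])
qed

text \<open>The added monomial supplies the coefficient 1 and leaves those of \<open>f\<close> in
  place.\<close>

lemma unit_multiple':
  "\<exists>\<phi>\<in>polys B. \<phi> * (f + monom 1 (Suc (degree f))) \<in> unit_polys B \<and> (\<forall>j. smult (coeff f j) \<phi> \<in> polys B)"
proof -
  let ?F = "f + monom 1 (Suc (degree f))"
  have "coeff ?F (Suc (degree f)) = 1" by (simp add: coeff_eq_0)
  from unit_multiple[OF this] obtain \<phi> where \<phi>: "\<phi> \<in> polys B" "\<phi> * ?F \<in> unit_polys B"
    "\<And>j. smult (coeff ?F j) \<phi> \<in> polys B" by blast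
  have "smult (coeff f j) \<phi> \<in> polys B" for j
  proof (cases "j \<le> degree f")
    case True
    then show ?thesis using \<phi>(3)[of j] by simp
  next
    case False
    then show ?thesis using subrD(2)[OF subr_polys[OF B(1)]] by (simp add: coeff_eq_0)
  qed
  with \<phi> show ?thesis by blast
qed

text \<open>With \<open>F\<close> the polynomial of \<open>unit_multiple'\<close>, the product
  \<open>(\<phi> * F) * coeff f j\<close> lies in \<open>V W\<close>, because
  \<open>coeff f j * \<phi>\<close> is in \<open>B[X]\<close>; saturation cancels
  \<open>\<phi> * F\<close>.\<close>

lemma V_coeff:
  assumes W: "sat_ring W" and f: "f \<in> V W"
  shows "[:coeff f j:] \<in> V W"
proof -
  note V = V_props[OF W]
  obtain \<phi> where \<phi>: "\<phi> \<in> polys B" "\<phi> * (f + monom 1 (Suc (degree f))) \<in> unit_polys B"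
    "smult (coeff f j) \<phi> \<in> polys B" using unit_multiple' by blast
  have "monom 1 (Suc (degree f)) \<in> V W" using V(2) polys_monom[OF subrD(2,1)[OF B(1)]] by blast
  then have "smult (coeff f j) \<phi> * (f + monom 1 (Suc (degree f))) \<in> V W"
    using \<phi>(3) V(2) f by (intro subrD(4)[OF V(1)] subrD(6)[OF V(1)]) auto
  then have "(\<phi> * (f + monom 1 (Suc (degree f)))) * [:coeff f j:] \<in> V W" by (simp add: mult.commute)
  then show ?thesis using V(4)[OF \<phi>(2)] by blast
qed

lemma V_subset:
  assumes W: "sat_ring W" "sat_ring W'" and c: "\<And>c. [:c:] \<in> V W \<Longrightarrow> [:c:] \<in> V W'"
  shows "V W \<subseteq> V W'"
proof
  fix f assume "f \<in> V W"
  then have 1: "[:coeff f j:] \<in> V W'" for j using V_coeff[OF W(1)] c by blast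
  have 2: "monom 1 j \<in> V W'" for j using V_props(2)[OF W(2)] polys_monom[OF subrD(2,1)[OF B(1)]] by blast
  have "[:coeff f j:] * monom 1 j \<in> V W'" for j
    using subrD(4)[OF V_props(1)[OF W(2)] 1 2] .
  then have "(\<Sum>j\<le>degree f. [:coeff f j:] * monom 1 j) \<in> V W'"
    by (intro smod_sum[OF smod_self[OF V_props(1)[OF W(2)]]])
  also have "(\<Sum>j\<le>degree f. [:coeff f j:] * monom 1 j) = f"
    using poly_as_sum_of_monoms[of f] by (simp add: smult_monom)
  finally show "f \<in> V W'" .
qed

text \<open>The factor \<open>q\<close> moves the \<open>B[X]\<close>-part of each product into
  \<open>R[X]\<close>, hence into \<open>W\<close>; the denominators go by saturation.\<close>

lemma conductor_V:
  assumes W: "sat_ring W" and q: "\<And>v. v \<in> polys B \<Longrightarrow> q * v \<in> polys R" and w: "w \<in> V W"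
  shows "q * w \<in> W"
proof -
  note W' = sat_ringD[OF W]
  have "q * p \<in> W" if "p \<in> gen_prod W (polys B)" for p
    using that
  proof induction
    case zero
    then show ?case using subrD(2)[OF W'(1)] by simp
  next
    case (step p w c)
    have "q * p + w * (q * c) \<in> W"
      by (intro subrD(6)[OF W'(1)] subrD(4)[OF W'(1) step(2)] step.IH subsetD[OF W'(2)] q step(3))
    then show ?case by (simp add: algebra_simps)
  qed
  moreover obtain \<alpha> where a: "\<alpha> \<in> unit_polys R" "\<alpha> * w \<in> gen_prod W (polys B)"
    using w by (auto simp: V_def)
  ultimately have "\<alpha> * (q * w) \<in> W" by (metis mult.left_commute)
  then show ?thesis using W'(3)[OF a(1)] by blast
qed

text \<open>
  By \<open>power_relation\<close> a multiple of \<open>f\<close> by a unit content polynomial splits into an element of \<open>B[X]\<close> and one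
  of \<open>q W'\<close>, where \<open>q B[X] \<subseteq> R[X]\<close>.  Since \<open>W'\<close> lies in the saturation of \<open>W B[X]\<close>, the second one is in \<open>W\<close>.
\<close>

lemma mixed_eq:
  assumes W: "sat_ring W" "sat_ring W'" and sub: "W \<subseteq> W'"
    and int: "W' \<inter> polys B \<subseteq> W" and V: "V W' \<subseteq> V W"
  shows "W' \<subseteq> W"
proof
  fix f assume f: "f \<in> W'"
  note W1 = sat_ringD[OF W(1)] and W2 = sat_ringD[OF W(2)] and pB = subrD[OF subr_polys[OF B(1)]]
  let ?X = "monom 1 (Suc (degree f))"
  obtain \<phi> where \<phi>: "\<phi> \<in> polys B" "\<phi> * (f + ?X) \<in> unit_polys B"
    "\<And>j. smult (coeff f j) \<phi> \<in> polys B" using unit_multiple'[of f] by blast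
  obtain h where h: "h \<in> polys B" "\<phi> * (f + ?X) * h \<in> unit_polys R"
    using unit_polys_descend[OF \<phi>(2)] by blast
  define b where "b = \<phi> * h"
  define y where "y = b * f"
  define a where "a = b * ?X"
  define \<rho> where "\<rho> = \<phi> * (f + ?X) * h"
  have \<rho>: "\<rho> = a + y" by (simp add: \<rho>_def a_def y_def b_def algebra_simps)
  have bB: "b \<in> polys B" using pB(4)[OF \<phi>(1) h(1)] by (simp add: b_def)
  have "\<phi> * f \<in> polys B" by (rule mult_coeffs[OF \<phi>(3)])
  then have "h * (\<phi> * f) \<in> polys B" using pB(4)[OF h(1)] by blast
  then have yB: "y \<in> polys B" by (simp add: y_def b_def mult_ac)
  have XB: "?X \<in> polys B" by (rule polys_monom[OF subrD(2,1)[OF B(1)]])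
  have "?X * y \<in> polys B" using pB(4)[OF XB yB] .
  then have afB: "a * f \<in> polys B" by (simp add: a_def y_def mult_ac)
  have aB: "a \<in> polys B" using pB(4)[OF bB XB] by (simp add: a_def)
  have \<rho>B: "\<rho> \<in> polys B" using pB(6)[OF aB yB] by (simp add: \<rho>)
  \<comment> \<open>Modulo \<open>B[X]\<close>, multiplying \<open>f\<close> by
    \<open>\<rho> = a + y\<close> is multiplying it by \<open>y\<close>, as \<open>a * f\<close> is
    in \<open>B[X]\<close>.\<close>
  have red: "\<rho> ^ n * f - y ^ n * f \<in> polys B" for n
  proof (induction n)
    case 0
    then show ?case using pB(2) by simp
  next
    case (Suc n)
    have "\<rho> * (\<rho> ^ n * f - y ^ n * f) + y ^ n * (a * f) \<in> polys B"
      by (intro pB(6) pB(4) \<rho>B Suc subr_power[OF subr_polys[OF B(1)] yB] afB)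
    moreover have "\<rho> * (\<rho> ^ n * f - y ^ n * f) + y ^ n * (a * f) = \<rho> ^ Suc n * f - y ^ Suc n * f"
      by (simp add: \<rho> algebra_simps)
    ultimately show ?case by (simp only:)
  qed
  obtain n h' \<alpha> where q: "h' \<in> polys B" "\<alpha> \<in> unit_polys R"
    "\<And>v. v \<in> polys B \<Longrightarrow> b ^ n * (\<alpha> - b * h') * v \<in> polys R"
    using power_relation[OF bB] by blast
  \<comment> \<open>Since \<open>y = b * f\<close>, this is
    \<open>\<alpha> * y ^ n * f - y ^ Suc n * h'\<close>.\<close>
  define w where "w = b ^ n * (\<alpha> - b * h') * f ^ Suc n"
  have "f ^ Suc n \<in> V W" using subr_power[OF W2(1) f] V_props(3)[OF W(2)] V by blast
  then have w: "w \<in> W" unfolding w_def by (intro conductor_V[OF W(1)] q(3))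
  have "\<alpha> * (\<rho> ^ n * f) = (\<alpha> * (\<rho> ^ n * f - y ^ n * f) + y ^ Suc n * h') + w"
    by (simp add: w_def y_def power_mult_distrib algebra_simps)
  moreover have rB: "\<alpha> * (\<rho> ^ n * f - y ^ n * f) + y ^ Suc n * h' \<in> polys B" (is "?r \<in> _")
    by (intro pB(6) pB(4)[OF _ red] pB(4)[OF _ q(1)] subr_power[OF subr_polys[OF B(1)] yB]
        subsetD[OF polys_mono[OF B(2)] unit_polysD[OF q(2)]])
  ultimately have eq: "\<alpha> * (\<rho> ^ n * f) = ?r + w" by blast
  have u: "\<rho> ^ n \<in> unit_polys R" using unit_polys_power[OF R] h(2) by (simp add: \<rho>_def)
  have "\<alpha> * (\<rho> ^ n * f) \<in> W'"
    by (intro subrD(4)[OF W2(1)] f subsetD[OF W2(2)] unit_polysD u q(2))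
  then have "(?r + w) - w \<in> W'" using w sub subrD(3)[OF W2(1)] eq by (metis subsetD)
  then have "?r \<in> W'" by (simp only: add_diff_cancel_right')
  then have "?r \<in> W" using rB int by blast
  then have "\<alpha> * (\<rho> ^ n * f) \<in> W" using subrD(6)[OF W1(1)] w eq by metis
  then show "f \<in> W" using W1(3) q(2) u by blast
qed

end

lemma steps_graded:
  assumes "(simple_step R {1})\<^sup>*\<^sup>* R N" and R: "subr R" and B: "0 \<in> B"
  shows "(simple_step ((\<lambda>r. [:r:]) ` R) {1})\<^sup>*\<^sup>* (graded_polys j B R R) (graded_polys j B N R)"
  using assms(1)
proof induction
  case (step N N')
  have "smod R N" using smod_steps[OF step(1) R smod_self[OF R]] by blast
  from step.IH graded_step[OF R this step(2) B] show ?case by (rule rtranclp.rtrancl_into_rtrancl)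
qed simp

context fcp_ext
begin

lemma steps_graded_all:
  "(simple_step ((\<lambda>r. [:r:]) ` R) {1})\<^sup>*\<^sup>* (polys R) (graded_polys j B R R)"
proof (induction j)
  case 0
  have "graded_polys 0 B R R = polys R"
    unfolding graded_polys_def polys_def by (metis (lifting) gr0I not_less0)
  then show ?case by simp
next
  case (Suc j)
  have "graded_polys j B B R = graded_polys (Suc j) B R R"
    by (auto simp: graded_polys_def less_Suc_eq) (metis Suc_lessI)
  with Suc steps_graded[OF B(3) R subrD(2)[OF B(1)], of j] show ?case by simp
qed

text \<open>
  Equality of the leading coefficients gives \<open>W' \<subseteq> W + B[X]\<^bsub>< N\<^esub>\<close>.  Writing \<open>X\<^sup>k f = w\<^sub>k + h\<^sub>k\<close> accordingly, finite
  length of \<open>B[X]\<^bsub>< N\<^esub>\<close> over \<open>R\<close> makes some \<open>h\<^sub>k\<close> depend on its predecessors, and then a monic multiple of \<open>f\<close>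
  is in \<open>W\<close>.
\<close>

lemma lead_coeffs_strict:
  assumes W: "sat_ring W" "sat_ring W'" and sub: "W \<subseteq> W'" "W' \<subseteq> polys B"
    and L: "(\<Union>d. lead_coeffs W' d) \<subseteq> (\<Union>d. lead_coeffs W d)"
  shows "W' \<subseteq> W"
proof
  fix f assume f: "f \<in> W'"
  note W1 = sat_ringD[OF W(1)] and W2 = sat_ringD[OF W(2)] and pR = subrD[OF subr_polys[OF R]]
  note W1' = subrD[OF W1(1)] and W2' = subrD[OF W2(1)]
  have X: "monom 1 k \<in> polys R" for k by (rule polys_monom[OF subrD(2,1)[OF R]])
  have cR: "[:r:] \<in> polys R" if "r \<in> R" for r using that polys_const[OF subrD(2)[OF R]] by blast
  have Lmono: "lead_coeffs W d \<subseteq> lead_coeffs W (Suc d)" for d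
    using lead_coeffs_mono[OF W1(1)] X W1(2) by blast
  have RL: "lead_coeffs W d \<inter> R = lead_coeffs W 0 \<inter> R" for d
  proof -
    have "R \<subseteq> lead_coeffs W 0" using cR W1(2) by (force simp: lead_coeffs_def)
    moreover have "lead_coeffs W 0 \<subseteq> lead_coeffs W d"
      by (rule lift_Suc_mono_le[of "lead_coeffs W", OF Lmono]) simp
    ultimately show ?thesis by blast
  qed
  have LB: "lead_coeffs W d \<subseteq> B" for d
  proof
    fix c assume "c \<in> lead_coeffs W d"
    then obtain g where "g \<in> W" "c = coeff g d" by (auto simp: lead_coeffs_def)
    then show "c \<in> B" using sub polysD by blast
  qed
  have smL: "smod R (lead_coeffs W d)" for d
    using cR W1(2) by (intro smod_lead_coeffs W1(1)) auto
  have sat1: "sat {1} U" for U :: "'c::comm_ring_1 set" by (simp add: sat_def)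
  \<comment> \<open>From degree \<open>N\<close> on no new leading coefficients appear, so shifts of
    elements of degree at most \<open>N\<close> cancel all higher ones.\<close>
  obtain N where N: "\<And>k. k \<ge> N \<Longrightarrow> lead_coeffs W k \<inter> B = lead_coeffs W N \<inter> B"
    using steps_stabilise[OF B(3) R smod_self[OF R] smL sat1 Lmono RL] by blast
  have LN: "(\<Union>d. lead_coeffs W d) \<subseteq> lead_coeffs W N"
  proof
    fix c assume "c \<in> (\<Union>d. lead_coeffs W d)"
    then obtain d where "c \<in> lead_coeffs W d" by blast
    moreover have "lead_coeffs W d \<subseteq> lead_coeffs W (max N d)"
      by (rule lift_Suc_mono_le[of "lead_coeffs W", OF Lmono]) simp
    moreover have "lead_coeffs W (max N d) = lead_coeffs W N" using N[of "max N d"] LB by auto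
    ultimately show "c \<in> lead_coeffs W N" by blast
  qed
  have red: "\<exists>w\<in>W. \<forall>j\<ge>N. coeff (f - w) j = 0" if "f \<in> W'" "\<forall>j\<ge>d. coeff f j = 0" for f d
    using that
  proof (induction d arbitrary: f)
    case 0
    then show ?case using W1'(2) by (intro bexI[of _ 0]) auto
  next
    case (Suc d)
    show ?case
    proof (cases "Suc d \<le> N")
      case True
      then show ?thesis using Suc.prems W1'(2) by (intro bexI[of _ 0]) auto
    next
      case False
      have "degree f \<le> d" using Suc.prems(2) by (intro degree_le) auto
      then have "coeff f d \<in> (\<Union>d. lead_coeffs W' d)"
        using Suc.prems(1) by (auto simp: lead_coeffs_def)
      then have "coeff f d \<in> lead_coeffs W N" using L LN by blast
      then obtain w where w: "w \<in> W" "degree w \<le> N" "coeff f d = coeff w N"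
        by (auto simp: lead_coeffs_def)
      define w' where "w' = monom 1 (d - N) * w"
      have w': "w' \<in> W" unfolding w'_def using W1'(4) X W1(2) w(1) by blast
      have "coeff (f - w') j = 0" if "j \<ge> d" for j
      proof (cases "j = d")
        case True
        then show ?thesis using False w(3) by (simp add: w'_def coeff_monom_mult)
      next
        case j: False
        then show ?thesis using that False Suc.prems(2) w(2)
          by (simp add: w'_def coeff_monom_mult coeff_eq_0)
      qed
      moreover have "f - w' \<in> W'" using W2'(3) Suc.prems(1) w' sub by blast
      ultimately obtain v where v: "v \<in> W" "\<forall>j\<ge>N. coeff (f - w' - v) j = 0"
        using Suc.IH by blast
      then show ?thesis using W1'(6)[OF w' v(1)] by (intro bexI[of _ "w' + v"]) (auto simp: algebra_simps)
    qed
  qed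
  \<comment> \<open>\<open>W\<close> plus the multiples of \<open>f\<close> by polynomials over
    \<open>R\<close> of degree below \<open>k\<close>; a module over the constants only.\<close>
  define U where "U k = {w + q * f | w q. w \<in> W \<and> q \<in> polys R \<and> (\<forall>i\<ge>k. coeff q i = 0)}" for k
  have memU: "w + q * f \<in> U k" if "w \<in> W" "q \<in> polys R" "\<forall>i\<ge>k. coeff q i = 0" for w q k
    unfolding U_def using that by blast
  let ?C = "(\<lambda>r. [:r:]) ` R"
  have subC: "subr ?C"
  proof -
    have "1 = [:1::'a:]" by (simp add: one_pCons)
    then show ?thesis unfolding subr_def using subrD[OF R] by (auto simp: image_iff one_pCons)
  qed
  have smU: "smod ?C (U k)" for k
    unfolding smod_def
  proof (intro conjI ballI)
    have "0 + 0 * f \<in> U k" by (rule memU) (simp_all add: W1'(2) pR(2))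
    then show "0 \<in> U k" by simp
  next
    fix x y assume "x \<in> U k" "y \<in> U k"
    then obtain w q v p where *: "x = w + q * f" "w \<in> W" "q \<in> polys R" "\<forall>i\<ge>k. coeff q i = 0"
      "y = v + p * f" "v \<in> W" "p \<in> polys R" "\<forall>i\<ge>k. coeff p i = 0" unfolding U_def by blast
    have "x + y = (w + v) + (q + p) * f" by (simp add: * algebra_simps)
    moreover have "(w + v) + (q + p) * f \<in> U k"
      by (rule memU) (use *(4,8) in \<open>simp_all add: W1'(6)[OF *(2,6)] pR(6)[OF *(3,7)]\<close>)
    ultimately show "x + y \<in> U k" by simp
  next
    fix c x assume "c \<in> ?C" "x \<in> U k"
    then obtain r w q where *: "c = [:r:]" "r \<in> R" "x = w + q * f" "w \<in> W" "q \<in> polys R" "\<forall>i\<ge>k. coeff q i = 0"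
      unfolding U_def by blast
    have "c * x = c * w + (c * q) * f" by (simp add: * algebra_simps)
    moreover have "c * w + (c * q) * f \<in> U k"
    proof (rule memU)
      have "c \<in> polys R" using cR *(1,2) by blast
      then show "c * w \<in> W" "c * q \<in> polys R" using W1'(4) W1(2) pR(4) *(4,5) by blast+
      show "\<forall>i\<ge>k. coeff (c * q) i = 0" using *(6) by (simp add: *(1))
    qed
    ultimately show "c * x \<in> U k" by simp
  qed
  have monoU: "U k \<subseteq> U (Suc k)" for k
  proof
    fix x assume "x \<in> U k"
    then obtain w q where "x = w + q * f" "w \<in> W" "q \<in> polys R" "\<forall>i\<ge>k. coeff q i = 0"
      unfolding U_def by blast
    then show "x \<in> U (Suc k)" by (simp add: memU)
  qed
  have WU: "w \<in> U k" if "w \<in> W" for w k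
  proof -
    have "w + 0 * f \<in> U k" by (rule memU) (simp_all add: that pR(2))
    then show ?thesis by simp
  qed
  then have base: "U k \<inter> polys R = U 0 \<inter> polys R" for k using W1(2) by blast
  have smP: "smod ?C (polys R)"
    by (intro smod_subr[OF subr_polys[OF R]]) (use cR in blast)
  obtain k where k: "\<And>l. l \<ge> k \<Longrightarrow> U l \<inter> graded_polys N B R R = U k \<inter> graded_polys N B R R"
    using steps_stabilise[OF steps_graded_all subC smP smU sat1 monoU base] by blast
  have Xf: "monom 1 k * f \<in> W'" using W2'(4) X W2(2) f by blast
  then obtain w where w: "w \<in> W" "\<forall>j\<ge>N. coeff (monom 1 k * f - w) j = 0"
    using red[OF Xf, of "Suc (degree (monom 1 k * f))"] by (auto simp: coeff_eq_0)
  define g where "g = monom 1 k * f - w"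
  have "g \<in> polys B" using W2'(3)[OF Xf] w(1) sub by (auto simp: g_def)
  then have gC: "g \<in> graded_polys N B R R"
    using w(2) subrD(2)[OF R] by (auto simp: graded_polys_def polys_def g_def)
  have "- w + monom 1 k * f \<in> U (Suc k)"
    by (rule memU) (simp_all add: W1'(5)[OF w(1)] X)
  then have "g \<in> U (Suc k)" by (simp add: g_def)
  then have "g \<in> U k" using gC k[of "Suc k"] by auto
  then obtain v q where v: "g = v + q * f" "v \<in> W" "q \<in> polys R" "\<forall>i\<ge>k. coeff q i = 0"
    unfolding U_def by blast
  \<comment> \<open>As \<open>q\<close> has degree below \<open>k\<close>, the factor is monic and
    hence of unit content.\<close>
  have "(monom 1 k - q) * f = v + w" using v(1) by (simp add: g_def algebra_simps)
  then have "(monom 1 k - q) * f \<in> W" using W1'(6)[OF v(2) w(1)] by simp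
  moreover have "monom 1 k - q \<in> unit_polys R"
    by (rule unit_polys_coeff_1[OF R pR(3)[OF X v(3)], where i = k]) (use v(4) in simp)
  ultimately show "f \<in> W" using W1(3) by blast
qed

section \<open>The two chains between \<open>R\<close> and \<open>S\<close>\<close>

lemma chain_descends:
  assumes W: "\<And>i. i \<le> m \<Longrightarrow> sat_ring (W i)" and strict: "\<And>i. i < m \<Longrightarrow> W i \<subset> W (Suc i)"
  shows "\<exists>n\<ge>m. \<exists>T. (\<forall>i\<le>n. subr (T i) \<and> R \<subseteq> T i) \<and> (\<forall>i<n. T i \<subset> T (Suc i))"
proof -
  define F where "F i = (\<Union>d. lead_coeffs (W i \<inter> polys B) d)" for i
  define G where "G i = {c. [:c:] \<in> V (W i)}" for i
  have WB: "sat_ring (W i \<inter> polys B)" if "i \<le> m" for i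
  proof -
    note W' = sat_ringD[OF W[OF that]]
    have "f \<in> polys B" if "s \<in> unit_polys R" "s * f \<in> polys B" for s f
      using mccoy[OF R smod_subr[OF B(1,2)] that] .
    then show ?thesis
      using W' polys_mono[OF B(2)] subr_Int[OF W'(1) subr_polys[OF B(1)]]
      by (auto simp: sat_ring_def sat_def)
  qed
  have F: "subr (F i)" "R \<subseteq> F i" "F i \<subseteq> B" if "i \<le> m" for i
  proof -
    note W' = sat_ringD[OF WB[OF that]]
    show "subr (F i)" unfolding F_def
      using W'(2) polys_monom[OF subrD(2,1)[OF R], of 1] by (intro subr_lead_coeffs W'(1)) auto
    show "F i \<subseteq> B" by (auto simp: F_def lead_coeffs_def polys_def)
    show "R \<subseteq> F i"
    proof
      fix r assume "r \<in> R"
      then have "[:r:] \<in> polys R" using polys_const[OF subrD(2)[OF R]] by blast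
      then have "[:r:] \<in> W i \<inter> polys B" using W'(2) by blast
      then have "r \<in> lead_coeffs (W i \<inter> polys B) 0" unfolding lead_coeffs_def by force
      then show "r \<in> F i" by (auto simp: F_def)
    qed
  qed
  have G: "subr (G i)" "B \<subseteq> G i" if "i \<le> m" for i
  proof -
    note V = V_props[OF W[OF that]]
    have "[:x * y:] \<in> V (W i)" "[:x - y:] \<in> V (W i)" if "[:x:] \<in> V (W i)" "[:y:] \<in> V (W i)" for x y
      using subrD(3,4)[OF V(1) that] by (simp_all add: mult.commute)
    moreover have "[:1:] \<in> V (W i)" using subrD(1)[OF V(1)] by (simp add: one_pCons)
    ultimately show "subr (G i)" unfolding subr_def G_def by simp
    show "B \<subseteq> G i" using V(2) polys_const[OF subrD(2)[OF B(1)]] by (auto simp: G_def)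
  qed
  have Fmono: "F i \<subseteq> F (Suc i)" if "i < m" for i
    using strict[OF that] by (auto simp: F_def lead_coeffs_def)
  have Vmono: "V (W i) \<subseteq> V (W (Suc i))" if "i < m" for i
  proof -
    have "p \<in> gen_prod (W (Suc i)) (polys B)" if "p \<in> gen_prod (W i) (polys B)" for p
      using that strict[OF \<open>i < m\<close>] by induction (auto intro: gen_prod.intros)
    then show ?thesis by (auto simp: V_def)
  qed
  have Gmono: "G i \<subseteq> G (Suc i)" if "i < m" for i
    using Vmono[OF that] by (auto simp: G_def)
  have one: "F i \<noteq> F (Suc i) \<or> G i \<noteq> G (Suc i)" if "i < m" for i
  proof (rule ccontr)
    assume "\<not> ?thesis"
    then have eq: "F (Suc i) = F i" "G (Suc i) = G i" by auto
    have i: "i \<le> m" "Suc i \<le> m" using that by auto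
    have "W (Suc i) \<inter> polys B \<subseteq> W i \<inter> polys B"
      using lead_coeffs_strict[OF WB[OF i(1)] WB[OF i(2)]] strict[OF that] eq(1) unfolding F_def by blast
    moreover have "V (W (Suc i)) \<subseteq> V (W i)"
      using V_subset[OF W[OF i(2)] W[OF i(1)]] eq(2) unfolding G_def by blast
    ultimately have "W (Suc i) \<subseteq> W i"
      using mixed_eq[OF W[OF i(1)] W[OF i(2)]] strict[OF that] by blast
    then show False using strict[OF that] by blast
  qed
  define p where "p = card {i. i < m \<and> F i \<noteq> F (Suc i)}"
  define q where "q = card {i. i < m \<and> G i \<noteq> G (Suc i)}"
  obtain T1 where T1: "T1 p = F m" "\<And>i. i < p \<Longrightarrow> T1 i \<subset> T1 (Suc i)" "\<And>i. \<exists>j\<le>m. T1 i = F j"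
    using compress_chain[of m F, OF Fmono] unfolding p_def by blast
  obtain T2 where T2: "T2 0 = G 0" "\<And>i. i < q \<Longrightarrow> T2 i \<subset> T2 (Suc i)" "\<And>i. \<exists>j\<le>m. T2 i = G j"
    using compress_chain[of m G, OF Gmono] unfolding q_def by blast
  \<comment> \<open>Index \<open>p\<close> takes \<open>G 0\<close> in place of \<open>F m\<close>.
    As \<open>F m \<subseteq> B \<subseteq> G 0\<close>, the step into it is still strict, and
    exactly \<open>p + q\<close> steps result.\<close>
  define T where "T i = (if i < p then T1 i else T2 (i - p))" for i
  have "m \<le> p + q"
  proof -
    have "card {..<m} \<le> card ({i. i < m \<and> F i \<noteq> F (Suc i)} \<union> {i. i < m \<and> G i \<noteq> G (Suc i)})"
      using one by (intro card_mono) auto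
    also have "\<dots> \<le> p + q" unfolding p_def q_def by (rule card_Un_le)
    finally show ?thesis by simp
  qed
  moreover have "subr (T i) \<and> R \<subseteq> T i" for i
  proof (cases "i < p")
    case True
    obtain j where "j \<le> m" "T1 i = F j" using T1(3) by blast
    then show ?thesis using True F(1,2)[of j] by (simp add: T_def)
  next
    case False
    obtain j where "j \<le> m" "T2 (i - p) = G j" using T2(3) by blast
    then show ?thesis using False G[of j] B(2) by (auto simp: T_def)
  qed
  moreover have "T i \<subset> T (Suc i)" if "i < p + q" for i
  proof -
    consider "Suc i < p" | "Suc i = p" | "p \<le> i" by linarith
    then show ?thesis
    proof cases
      case 1
      then show ?thesis using T1(2)[of i] by (simp add: T_def)
    next
      case 2
      have "T1 i \<subset> F m" using T1(1) T1(2)[of i] 2 by auto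
      also have "F m \<subseteq> B" using F by blast
      also have "B \<subseteq> G 0" using G by blast
      finally show ?thesis using 2 T2(1) by (simp add: T_def)
    next
      case 3
      then show ?thesis using T2(2)[of "i - p"] that by (simp add: T_def Suc_diff_le)
    qed
  qed
  ultimately show ?thesis by blast
qed

end

section \<open>Nagata rings as fractions of lifted polynomials\<close>

lemma polys_UNIV [simp]: "f \<in> polys UNIV"
  by (simp add: polys_def)

lemma subr_UNIV [simp]: "subr UNIV"
  by (simp add: subr_def)

lemma UN_const: "x \<noteq> {} \<Longrightarrow> (\<And>y. y \<in> x \<Longrightarrow> f y = c) \<Longrightarrow> (\<Union>y\<in>x. f y) = c"
  by auto

text \<open>Rings between \<open>R\<close> and \<open>S\<close> are replaced by their preimages.
  These contain the kernel of \<open>\<pi>\<close>, so strict chains stay strict in both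
  directions.\<close>

locale cring_cover = cring S for S :: "('a, 'm) ring_scheme" (structure) +
  fixes \<pi> :: "'b::comm_ring_1 \<Rightarrow> 'a"
  assumes pi_closed [simp]: "\<pi> x \<in> carrier S"
    and pi_surj: "a \<in> carrier S \<Longrightarrow> \<exists>x. \<pi> x = a"
    and pi_add: "\<pi> (x + y) = \<pi> x \<oplus> \<pi> y"
    and pi_mult: "\<pi> (x * y) = \<pi> x \<otimes> \<pi> y"
    and pi_one: "\<pi> 1 = \<one>"
begin

lemma pi_zero: "\<pi> 0 = \<zero>"
proof -
  have "\<pi> 0 \<oplus> \<pi> 0 = \<pi> 0" using pi_add[of 0 0] by simp
  then show ?thesis by simp
qed

lemma pi_uminus: "\<pi> (- x) = \<ominus> \<pi> x"
  using pi_add[of "- x" x] by (intro minus_equality[symmetric]) (simp_all add: pi_zero)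

lemma pi_diff: "\<pi> (x - y) = \<pi> x \<ominus> \<pi> y"
  using pi_add[of x "- y"] by (simp add: pi_uminus minus_eq)

definition ker :: "'b set" where "ker = \<pi> -` {\<zero>}"

lemma pi_eq_iff: "\<pi> x = \<pi> y \<longleftrightarrow> x - y \<in> ker"
  by (simp add: ker_def pi_diff r_right_minus_eq)

lemma subr_vimage:
  assumes "subring R S" shows "subr (\<pi> -` R)"
  unfolding subr_def
  using subringE[OF assms] by (auto simp: pi_one pi_mult pi_diff minus_eq)

lemma ker_subset: "subring R S \<Longrightarrow> ker \<subseteq> \<pi> -` R"
  using subringE(2) by (auto simp: ker_def)

lemma smod_ker: "smod A ker"
  unfolding smod_def ker_def by (simp add: pi_zero pi_add pi_mult)

lemma subring_image:
  assumes "subr A" shows "subring (\<pi> ` A) S"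
proof (rule subringI)
  show "\<one> \<in> \<pi> ` A" using subrD(1)[OF assms] pi_one by (metis imageI)
  show "\<ominus> h \<in> \<pi> ` A" if "h \<in> \<pi> ` A" for h
    using that subrD(5)[OF assms] by (auto simp flip: pi_uminus)
  show "h \<otimes> k \<in> \<pi> ` A" "h \<oplus> k \<in> \<pi> ` A" if "h \<in> \<pi> ` A" "k \<in> \<pi> ` A" for h k
    using that subrD(4,6)[OF assms] by (auto simp flip: pi_mult pi_add)
qed auto

definition cmap :: "'b poly \<Rightarrow> nat \<Rightarrow> 'a" where "cmap f = (\<lambda>i. \<pi> (coeff f i))"

lemma cmap_eq_iff: "cmap f = cmap g \<longleftrightarrow> f - g \<in> polys ker"
  by (auto simp: cmap_def fun_eq_iff polys_def pi_eq_iff)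

lemma cmap_up:
  assumes "f \<in> polys (\<pi> -` R)"
  shows "cmap f \<in> carrier (UP (S\<lparr>carrier := R\<rparr>))"
proof -
  have "bound \<zero> (degree f) (cmap f)"
    by (auto simp: cmap_def coeff_eq_0 pi_zero)
  then show ?thesis using polysD[OF assms] by (auto simp: UP_def up_def cmap_def)
qed

lemma cmap_up_surj:
  assumes "R \<subseteq> carrier S" and p: "p \<in> carrier (UP (S\<lparr>carrier := R\<rparr>))"
  shows "\<exists>f\<in>polys (\<pi> -` R). cmap f = p"
proof -
  have pR: "p i \<in> R" for i using p by (auto simp: UP_def up_def)
  obtain n where n: "bound \<zero> n p" using p by (auto simp: UP_def up_def)
  have "\<forall>i. \<exists>x. \<pi> x = p i" using pR assms(1) pi_surj by blast
  then obtain x where x: "\<And>i. \<pi> (x i) = p i" by metis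
  define f where "f = (\<Sum>i\<le>n. monom (x i) i)"
  have "coeff f i = (if i \<le> n then x i else 0)" for i by (auto simp: f_def coeff_sum)
  then have "cmap f = p" using x n by (auto simp: cmap_def fun_eq_iff pi_zero not_le)
  moreover from this have "f \<in> polys (\<pi> -` R)" using pR by (auto simp: polys_def cmap_def)
  ultimately show ?thesis by blast
qed

lemma pi_sum:
  assumes "subring R S" "\<And>i. i \<in> I \<Longrightarrow> \<pi> (f i) \<in> R" "finite I"
  shows "\<pi> (sum f I) = (\<Oplus>\<^bsub>S\<lparr>carrier := R\<rparr>\<^esub>i\<in>I. \<pi> (f i))"
proof -
  interpret R: ring "S\<lparr>carrier := R\<rparr>" using subring_is_ring[OF assms(1)] .
  show ?thesis using assms(3,2)
    by induction (auto simp: pi_zero pi_add R.finsum_insert[simplified] Pi_iff)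
qed

lemma cmap_mult:
  assumes R: "subring R S" and fg: "f \<in> polys (\<pi> -` R)" "g \<in> polys (\<pi> -` R)"
  shows "cmap f \<otimes>\<^bsub>UP (S\<lparr>carrier := R\<rparr>)\<^esub> cmap g = cmap (f * g)"
proof -
  have "cmap f \<in> up (S\<lparr>carrier := R\<rparr>)" "cmap g \<in> up (S\<lparr>carrier := R\<rparr>)"
    using cmap_up fg by (auto simp: UP_def)
  moreover have "\<pi> (coeff f i * coeff g j) \<in> R" for i j
    using polysD[OF fg(1), of i] polysD[OF fg(2), of j] subringE(6)[OF R] by (simp add: pi_mult)
  ultimately show ?thesis
    by (simp add: UP_def cmap_def coeff_mult pi_sum[OF R] fun_eq_iff pi_mult)
qed

lemma cmap_add:
  assumes "subring R S" "f \<in> polys (\<pi> -` R)" "g \<in> polys (\<pi> -` R)"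
  shows "cmap f \<oplus>\<^bsub>UP (S\<lparr>carrier := R\<rparr>)\<^esub> cmap g = cmap (f + g)"
proof -
  have "cmap f \<in> up (S\<lparr>carrier := R\<rparr>)" "cmap g \<in> up (S\<lparr>carrier := R\<rparr>)"
    using cmap_up assms by (auto simp: UP_def)
  then show ?thesis by (simp add: UP_def cmap_def fun_eq_iff pi_add)
qed

lemma cmap_one: "\<one>\<^bsub>UP S\<^esub> = cmap 1"
  by (auto simp: UP_def cmap_def fun_eq_iff pi_one pi_zero coeff_1)

lemma cmap_zero: "\<zero>\<^bsub>UP S\<^esub> = cmap 0"
  by (auto simp: UP_def cmap_def fun_eq_iff pi_zero)

lemma coeff_cmap: "f \<in> polys (\<pi> -` R) \<Longrightarrow> range (up_ring.coeff (UP (S\<lparr>carrier := R\<rparr>)) (cmap f)) = range (cmap f)"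
  using cmap_up by (simp add: UP_def)

lemma unit_content_cmap:
  assumes R: "subring R S" and g: "g \<in> unit_polys (\<pi> -` R)"
  shows "cmap g \<in> unit_content_polys (S\<lparr>carrier := R\<rparr>)"
proof -
  interpret R: ring "S\<lparr>carrier := R\<rparr>" using subring_is_ring[OF R] .
  have gR: "g \<in> polys (\<pi> -` R)" using unit_polysD[OF g] .
  have "I = R" if I: "ideal I (S\<lparr>carrier := R\<rparr>)" "range (cmap g) \<subseteq> I" for I
  proof -
    interpret I: ideal I "S\<lparr>carrier := R\<rparr>" by (rule I(1))
    have "smod (\<pi> -` R) (\<pi> -` I)"
      using I.zero_closed I.a_closed I.I_l_closed by (auto simp: smod_def pi_zero pi_add pi_mult)
    moreover have "g \<in> polys (\<pi> -` I)" using I(2) by (auto simp: polys_def cmap_def)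
    ultimately have "1 \<in> \<pi> -` I" using unit_polys_one_mem[OF subr_vimage[OF R] g] by blast
    then show "I = R" using I.one_imp_carrier by (simp add: pi_one)
  qed
  moreover have "ideal R (S\<lparr>carrier := R\<rparr>)" using R.oneideal by simp
  moreover have "range (cmap g) \<subseteq> R" using polysD[OF gR] by (auto simp: cmap_def)
  ultimately have "Idl\<^bsub>S\<lparr>carrier := R\<rparr>\<^esub> (range (cmap g)) = R"
    unfolding genideal_def by blast
  then show ?thesis using cmap_up[OF gR] by (simp add: unit_content_polys_def coeff_cmap[OF gR])
qed

text \<open>A lift of \<open>p\<close> has 1 in its content only up to the kernel. Appending the
  defect \<open>1 - c\<close> in a fresh degree repairs this and disappears under
  \<open>\<pi>\<close>.\<close>

lemma unit_content_surj:
  assumes R: "subring R S" and p: "p \<in> unit_content_polys (S\<lparr>carrier := R\<rparr>)"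
  shows "\<exists>g\<in>unit_polys (\<pi> -` R). cmap g = p"
proof -
  interpret R: ring "S\<lparr>carrier := R\<rparr>" using subring_is_ring[OF R] .
  let ?R = "\<pi> -` R"
  have sR: "subr ?R" using subr_vimage[OF R] .
  obtain f where f: "f \<in> polys ?R" "cmap f = p"
    using cmap_up_surj[OF subringE(1)[OF R]] p by (auto simp: unit_content_polys_def)
  let ?C = "content_ideal ?R f"
  have C: "smod ?R ?C" by (rule smod_content_ideal[OF sR])
  have CR: "?C \<subseteq> ?R"
    using subrD(4)[OF subr_polys[OF sR] f(1)] polysD by (fastforce simp: content_ideal_def)
  have "ideal (\<pi> ` ?C) (S\<lparr>carrier := R\<rparr>)"
  proof (rule idealI[OF R.ring_axioms])
    show "subgroup (\<pi> ` ?C) (add_monoid (S\<lparr>carrier := R\<rparr>))"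
    proof (rule R.add.subgroupI)
      show "\<pi> ` ?C \<subseteq> carrier (S\<lparr>carrier := R\<rparr>)" using CR by auto
      show "\<pi> ` ?C \<noteq> {}" using smodD(1)[OF C] by auto
      fix a assume "a \<in> \<pi> ` ?C"
      then obtain x where x: "a = \<pi> x" "x \<in> ?C" by blast
      have "\<pi> (- x) \<oplus>\<^bsub>S\<lparr>carrier := R\<rparr>\<^esub> a = \<zero>\<^bsub>S\<lparr>carrier := R\<rparr>\<^esub>"
        using pi_add[of "- x" x] by (simp add: x pi_zero)
      moreover have "- x \<in> ?C" using smod_uminus[OF C sR x(2)] .
      ultimately have "\<ominus>\<^bsub>S\<lparr>carrier := R\<rparr>\<^esub> a = \<pi> (- x)"
        using x CR by (intro R.minus_equality) auto
      then show "\<ominus>\<^bsub>S\<lparr>carrier := R\<rparr>\<^esub> a \<in> \<pi> ` ?C" using \<open>- x \<in> ?C\<close> by simp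
    next
      fix a b assume "a \<in> \<pi> ` ?C" "b \<in> \<pi> ` ?C"
      then show "a \<oplus>\<^bsub>S\<lparr>carrier := R\<rparr>\<^esub> b \<in> \<pi> ` ?C"
        using smodD(2)[OF C] by (auto simp flip: pi_add)
    qed
    fix a x assume "a \<in> \<pi> ` ?C" "x \<in> carrier (S\<lparr>carrier := R\<rparr>)"
    then obtain c y where cy: "a = \<pi> c" "c \<in> ?C" "x = \<pi> y" "y \<in> ?R"
      using pi_surj subringE(1)[OF R] by (auto simp: subset_iff) (metis vimageI)
    have "y * c \<in> ?C" using smodD(3)[OF C] cy by blast
    then show "x \<otimes>\<^bsub>S\<lparr>carrier := R\<rparr>\<^esub> a \<in> \<pi> ` ?C" "a \<otimes>\<^bsub>S\<lparr>carrier := R\<rparr>\<^esub> x \<in> \<pi> ` ?C"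
      by (auto simp: cy mult.commute simp flip: pi_mult)
  qed
  moreover have "range (cmap f) \<subseteq> \<pi> ` ?C"
    using coeff_in_content_ideal[OF sR] by (auto simp: cmap_def)
  moreover have "Idl\<^bsub>S\<lparr>carrier := R\<rparr>\<^esub> (range (cmap f)) = R"
    using p by (simp add: unit_content_polys_def coeff_cmap[OF f(1)] flip: f(2))
  ultimately have "R \<subseteq> \<pi> ` ?C" using R.genideal_minimal by metis
  then have "\<pi> 1 \<in> \<pi> ` ?C" using subringE(3)[OF R] by (auto simp: pi_one)
  then obtain c where c: "c \<in> ?C" "1 - c \<in> ker" unfolding image_iff pi_eq_iff by blast
  define g where "g = f + monom (1 - c) (Suc (degree f))"
  have "monom (1 - c) (Suc (degree f)) \<in> polys ker"
    using c(2) smodD(1)[OF smod_ker] by (intro polys_monom)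
  then have "cmap g = cmap f" by (simp add: cmap_eq_iff g_def)
  moreover have "g \<in> unit_polys ?R"
  proof (rule unit_polysI[OF sR])
    show "g \<in> polys ?R"
      unfolding g_def using c(2) ker_subset[OF R]
      by (intro subrD(6)[OF subr_polys[OF sR]] f(1) polys_monom subrD(2)[OF sR]) auto
    fix J assume J: "smod ?R J" "g \<in> polys J"
    have "coeff f i \<in> J" for i
      using polysD[OF J(2), of i] smodD(1)[OF J(1)]
      by (cases "i \<le> degree f") (auto simp: g_def coeff_eq_0)
    then have fJ: "f \<in> polys J" by (rule polysI)
    obtain h n where h: "h \<in> polys ?R" "c = coeff (f * h) n" using c(1) unfolding content_ideal_def by blast
    have "c \<in> J"
      using polysD[OF smodD(3)[OF smod_polys[OF J(1)] h(1) fJ], of n] by (simp add: h(2) mult.commute)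
    moreover have "1 - c \<in> J"
      using polysD[OF J(2), of "Suc (degree f)"] by (simp add: g_def coeff_eq_0)
    ultimately have "c + (1 - c) \<in> J" using smodD(2)[OF J(1)] by blast
    then show "1 \<in> J" by simp
  qed
  ultimately show ?thesis using f(2) by metis
qed

lemma vimage_carrier: "\<pi> -` carrier S = UNIV"
  by auto

lemmas cmap_carrier = cmap_up[of _ "carrier S", simplified, unfolded vimage_carrier, OF polys_UNIV]
lemmas cmap_surj = cmap_up_surj[of "carrier S", simplified, unfolded vimage_carrier]
lemmas cmap_mult_S = cmap_mult[OF carrier_is_subring, simplified, unfolded vimage_carrier, OF polys_UNIV polys_UNIV]
lemmas cmap_add_S = cmap_add[OF carrier_is_subring, simplified, unfolded vimage_carrier, OF polys_UNIV polys_UNIV]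
lemmas unit_content_S = unit_content_cmap[OF carrier_is_subring, simplified, unfolded vimage_carrier]
lemmas unit_content_S_surj = unit_content_surj[OF carrier_is_subring, simplified, unfolded vimage_carrier]

section \<open>Arithmetic of fractions of lifted polynomials\<close>

abbreviation U :: "'b poly set" where "U \<equiv> unit_polys UNIV"

abbreviation \<Sigma> :: "(nat \<Rightarrow> 'a) set" where "\<Sigma> \<equiv> unit_content_polys S"

definition fr :: "'b poly \<Rightarrow> 'b poly \<Rightarrow> ((nat \<Rightarrow> 'a) \<times> (nat \<Rightarrow> 'a)) set" where
  "fr a s = mk_frac (UP S) \<Sigma> (cmap a) (cmap s)"

text \<open>McCoy's theorem modulo the kernel: unit content polynomials are not zero divisors, so
  the extra factor in \<open>frac_rel\<close> cancels.\<close>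

lemma cmap_cancel: "u \<in> U \<Longrightarrow> cmap (u * f) = cmap (u * g) \<Longrightarrow> cmap f = cmap g"
  unfolding cmap_eq_iff right_diff_distrib[symmetric] by (rule mccoy[OF subr_UNIV smod_ker])

lemma cmap_mult_cong: "cmap f = cmap g \<Longrightarrow> cmap (u * f) = cmap (u * g)"
  by (simp flip: cmap_mult_S)

lemma frac_rel_iff:
  assumes "s \<in> U" "t \<in> U"
  shows "((cmap a, cmap s), (cmap b, cmap t)) \<in> frac_rel (UP S) \<Sigma> \<longleftrightarrow> cmap (t * a) = cmap (s * b)"
proof
  assume "((cmap a, cmap s), (cmap b, cmap t)) \<in> frac_rel (UP S) \<Sigma>"
  then obtain p where p: "p \<in> \<Sigma>"
    "p \<otimes>\<^bsub>UP S\<^esub> (cmap t \<otimes>\<^bsub>UP S\<^esub> cmap a) = p \<otimes>\<^bsub>UP S\<^esub> (cmap s \<otimes>\<^bsub>UP S\<^esub> cmap b)"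
    by (auto simp: frac_rel_def)
  obtain u where u: "u \<in> U" "cmap u = p" using unit_content_S_surj[OF p(1)] by blast
  have "cmap (u * (t * a)) = cmap (u * (s * b))" using p(2) unfolding u(2)[symmetric] by (simp only: cmap_mult_S)
  then show "cmap (t * a) = cmap (s * b)" by (rule cmap_cancel[OF u(1)])
next
  assume "cmap (t * a) = cmap (s * b)"
  then show "((cmap a, cmap s), (cmap b, cmap t)) \<in> frac_rel (UP S) \<Sigma>"
    using assms unit_content_S unit_polys_1[OF subr_UNIV]
    by (auto simp: frac_rel_def cmap_mult_S cmap_carrier intro!: bexI[of _ "cmap 1"])
qed

lemma fr_mem_iff:
  assumes "s \<in> U"
  shows "x \<in> fr a s \<longleftrightarrow> (\<exists>b t. t \<in> U \<and> x = (cmap b, cmap t) \<and> cmap (t * a) = cmap (s * b))"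
proof
  assume x: "x \<in> fr a s"
  then have "fst x \<in> carrier (UP S)" "snd x \<in> \<Sigma>"
    by (auto simp: fr_def mk_frac_def frac_rel_def)
  then obtain b t where bt: "t \<in> U" "fst x = cmap b" "snd x = cmap t"
    using cmap_surj unit_content_S_surj by metis
  then have "((cmap a, cmap s), (cmap b, cmap t)) \<in> frac_rel (UP S) \<Sigma>"
    using x by (simp add: fr_def mk_frac_def flip: bt(2,3))
  then show "\<exists>b t. t \<in> U \<and> x = (cmap b, cmap t) \<and> cmap (t * a) = cmap (s * b)"
    using bt frac_rel_iff[OF assms bt(1)] by (metis prod.collapse)
next
  assume "\<exists>b t. t \<in> U \<and> x = (cmap b, cmap t) \<and> cmap (t * a) = cmap (s * b)"
  then show "x \<in> fr a s" using frac_rel_iff[OF assms] by (auto simp: fr_def mk_frac_def)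
qed

lemma fr_eq_iff:
  assumes "s \<in> U" "t \<in> U"
  shows "fr a s = fr b t \<longleftrightarrow> cmap (t * a) = cmap (s * b)"
proof
  assume eq: "fr a s = fr b t"
  have "(cmap b, cmap t) \<in> fr b t" using fr_mem_iff[OF assms(2)] assms(2) by blast
  then have "((cmap a, cmap s), (cmap b, cmap t)) \<in> frac_rel (UP S) \<Sigma>"
    unfolding eq[symmetric] by (simp add: fr_def mk_frac_def)
  then show "cmap (t * a) = cmap (s * b)" using frac_rel_iff[OF assms] by blast
next
  have trans: "cmap (v * b) = cmap (t * c)" if "s \<in> U" "cmap (t * a) = cmap (s * b)" "cmap (v * a) = cmap (s * c)"
    for a b c s t v
  proof (rule cmap_cancel[OF that(1)])
    have "cmap (s * (v * b)) = cmap (v * (s * b))" by (simp add: mult.left_commute)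
    also have "\<dots> = cmap (v * (t * a))" by (rule cmap_mult_cong[OF that(2)[symmetric]])
    also have "\<dots> = cmap (t * (v * a))" by (simp add: mult.left_commute)
    also have "\<dots> = cmap (t * (s * c))" by (rule cmap_mult_cong[OF that(3)])
    finally show "cmap (s * (v * b)) = cmap (s * (t * c))" by (simp add: mult.left_commute)
  qed
  assume eq: "cmap (t * a) = cmap (s * b)"
  show "fr a s = fr b t"
  proof (intro Set.set_eqI iffI)
    fix x assume "x \<in> fr a s"
    then obtain c v where x: "v \<in> U" "x = (cmap c, cmap v)" "cmap (v * a) = cmap (s * c)"
      using fr_mem_iff[OF assms(1)] by blast
    have "cmap (v * b) = cmap (t * c)" by (rule trans[OF assms(1) eq x(3)])
    then show "x \<in> fr b t" using x fr_mem_iff[OF assms(2)] by blast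
  next
    fix x assume "x \<in> fr b t"
    then obtain c v where x: "v \<in> U" "x = (cmap c, cmap v)" "cmap (v * b) = cmap (t * c)"
      using fr_mem_iff[OF assms(2)] by blast
    have "cmap (v * a) = cmap (s * c)" by (rule trans[OF assms(2) eq[symmetric] x(3)])
    then show "x \<in> fr a s" using x fr_mem_iff[OF assms(1)] by blast
  qed
qed

abbreviation N where "N \<equiv> nagata S"

lemma carrier_N: "carrier N = {fr a s | a s. s \<in> U}"
proof -
  have "x \<in> carrier N \<longleftrightarrow> (\<exists>p q. p \<in> carrier (UP S) \<and> q \<in> \<Sigma> \<and> x = mk_frac (UP S) \<Sigma> p q)" for x
    by (auto simp: nagata_def localization_def quotient_def mk_frac_def)
  also have "\<dots> x \<longleftrightarrow> (\<exists>a s. s \<in> U \<and> x = fr a s)" for x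
    unfolding fr_def using cmap_surj cmap_carrier unit_content_S unit_content_S_surj by metis
  finally show ?thesis by blast
qed

lemma fr_self: "s \<in> U \<Longrightarrow> (cmap a, cmap s) \<in> fr a s"
  by (auto simp: fr_mem_iff)

lemma fr_congI: "s \<in> U \<Longrightarrow> t \<in> U \<Longrightarrow> cmap (t * a) = cmap (s * b) \<Longrightarrow> fr a s = fr b t"
  by (simp add: fr_eq_iff)

lemma mult_N:
  assumes "s \<in> U" "t \<in> U"
  shows "fr a s \<otimes>\<^bsub>N\<^esub> fr b t = fr (a * b) (s * t)"
proof -
  have "mk_frac (UP S) \<Sigma> (fst x \<otimes>\<^bsub>UP S\<^esub> fst y) (snd x \<otimes>\<^bsub>UP S\<^esub> snd y) = fr (a * b) (s * t)"
    if "x \<in> fr a s" "y \<in> fr b t" for x y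
  proof -
    obtain a' s' where x: "s' \<in> U" "x = (cmap a', cmap s')" "cmap (s' * a) = cmap (s * a')"
      using \<open>x \<in> fr a s\<close> fr_mem_iff[OF assms(1)] by blast
    obtain b' t' where y: "t' \<in> U" "y = (cmap b', cmap t')" "cmap (t' * b) = cmap (t * b')"
      using \<open>y \<in> fr b t\<close> fr_mem_iff[OF assms(2)] by blast
    have "cmap ((s * t) * (a' * b')) = cmap (s * a') \<otimes>\<^bsub>UP S\<^esub> cmap (t * b')"
      by (simp add: cmap_mult_S mult_ac)
    also have "\<dots> = cmap (s' * a) \<otimes>\<^bsub>UP S\<^esub> cmap (t' * b)" by (simp only: x(3) y(3))
    also have "\<dots> = cmap ((s' * t') * (a * b))" by (simp add: cmap_mult_S mult_ac)
    finally have "fr (a' * b') (s' * t') = fr (a * b) (s * t)"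
      using assms x(1) y(1) by (intro fr_congI unit_polys_mult[OF subr_UNIV])
    then show ?thesis by (simp add: x(2) y(2) cmap_mult_S fr_def)
  qed
  moreover have "fr a s \<noteq> {}" "fr b t \<noteq> {}" using fr_self assms by blast+
  ultimately have "(\<Union>x\<in>fr a s. \<Union>y\<in>fr b t. mk_frac (UP S) \<Sigma> (fst x \<otimes>\<^bsub>UP S\<^esub> fst y) (snd x \<otimes>\<^bsub>UP S\<^esub> snd y))
      = fr (a * b) (s * t)"
    by (intro UN_const)
  then show ?thesis by (simp add: nagata_def localization_def case_prod_unfold)
qed

lemma add_N:
  assumes "s \<in> U" "t \<in> U"
  shows "fr a s \<oplus>\<^bsub>N\<^esub> fr b t = fr (a * t + b * s) (s * t)"
proof -
  have "mk_frac (UP S) \<Sigma> (fst x \<otimes>\<^bsub>UP S\<^esub> snd y \<oplus>\<^bsub>UP S\<^esub> fst y \<otimes>\<^bsub>UP S\<^esub> snd x) (snd x \<otimes>\<^bsub>UP S\<^esub> snd y)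
      = fr (a * t + b * s) (s * t)"
    if "x \<in> fr a s" "y \<in> fr b t" for x y
  proof -
    obtain a' s' where x: "s' \<in> U" "x = (cmap a', cmap s')" "cmap (s' * a) = cmap (s * a')"
      using \<open>x \<in> fr a s\<close> fr_mem_iff[OF assms(1)] by blast
    obtain b' t' where y: "t' \<in> U" "y = (cmap b', cmap t')" "cmap (t' * b) = cmap (t * b')"
      using \<open>y \<in> fr b t\<close> fr_mem_iff[OF assms(2)] by blast
    have "cmap ((s * t) * (a' * t' + b' * s')) = cmap ((t * t') * (s * a')) \<oplus>\<^bsub>UP S\<^esub> cmap ((s * s') * (t * b'))"
      by (simp add: cmap_add_S algebra_simps)
    also have "\<dots> = cmap ((t * t') * (s' * a)) \<oplus>\<^bsub>UP S\<^esub> cmap ((s * s') * (t' * b))"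
      using cmap_mult_cong[OF x(3), of "t * t'"] cmap_mult_cong[OF y(3), of "s * s'"] by simp
    also have "\<dots> = cmap ((s' * t') * (a * t + b * s))"
      by (simp add: cmap_add_S algebra_simps)
    finally have "fr (a' * t' + b' * s') (s' * t') = fr (a * t + b * s) (s * t)"
      using assms x(1) y(1) by (intro fr_congI unit_polys_mult[OF subr_UNIV])
    then show ?thesis by (simp add: x(2) y(2) cmap_mult_S cmap_add_S fr_def)
  qed
  moreover have "fr a s \<noteq> {}" "fr b t \<noteq> {}" using fr_self assms by blast+
  ultimately have "(\<Union>x\<in>fr a s. \<Union>y\<in>fr b t. mk_frac (UP S) \<Sigma>
      (fst x \<otimes>\<^bsub>UP S\<^esub> snd y \<oplus>\<^bsub>UP S\<^esub> fst y \<otimes>\<^bsub>UP S\<^esub> snd x) (snd x \<otimes>\<^bsub>UP S\<^esub> snd y))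
      = fr (a * t + b * s) (s * t)"
    by (intro UN_const)
  then show ?thesis by (simp add: nagata_def localization_def case_prod_unfold)
qed

lemma one_N: "\<one>\<^bsub>N\<^esub> = fr 1 1"
  by (simp add: nagata_def localization_def fr_def cmap_one)

lemma zero_N: "\<zero>\<^bsub>N\<^esub> = fr 0 1"
  by (simp add: nagata_def localization_def fr_def cmap_one cmap_zero)

lemma cring_N: "cring N"
proof (intro cringI abelian_groupI comm_monoidI)
  note [simp] = unit_polys_1[OF subr_UNIV] unit_polys_mult[OF subr_UNIV]
  fix x y z assume "x \<in> carrier N" "y \<in> carrier N" "z \<in> carrier N"
  then obtain a s b t c u where *: "x = fr a s" "y = fr b t" "z = fr c u" "s \<in> U" "t \<in> U" "u \<in> U"
    unfolding carrier_N by blast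
  note [simp] = *(4-6)
  show "x \<oplus>\<^bsub>N\<^esub> y \<oplus>\<^bsub>N\<^esub> z = x \<oplus>\<^bsub>N\<^esub> (y \<oplus>\<^bsub>N\<^esub> z)"
    by (simp add: * add_N) (simp add: algebra_simps)
  show "(x \<oplus>\<^bsub>N\<^esub> y) \<otimes>\<^bsub>N\<^esub> z = x \<otimes>\<^bsub>N\<^esub> z \<oplus>\<^bsub>N\<^esub> y \<otimes>\<^bsub>N\<^esub> z"
    by (simp add: * add_N mult_N fr_eq_iff) (simp add: algebra_simps)
  show "x \<otimes>\<^bsub>N\<^esub> y \<otimes>\<^bsub>N\<^esub> z = x \<otimes>\<^bsub>N\<^esub> (y \<otimes>\<^bsub>N\<^esub> z)"
    by (simp add: * mult_N mult.assoc)
next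
  note [simp] = unit_polys_1[OF subr_UNIV] unit_polys_mult[OF subr_UNIV]
  fix x y assume "x \<in> carrier N" "y \<in> carrier N"
  then obtain a s b t where *: "x = fr a s" "y = fr b t" "s \<in> U" "t \<in> U"
    unfolding carrier_N by blast
  note [simp] = *(3,4)
  show "x \<oplus>\<^bsub>N\<^esub> y = y \<oplus>\<^bsub>N\<^esub> x" by (simp add: * add_N) (simp add: algebra_simps)
  show "x \<otimes>\<^bsub>N\<^esub> y = y \<otimes>\<^bsub>N\<^esub> x" by (simp add: * mult_N) (simp add: algebra_simps)
  show "x \<oplus>\<^bsub>N\<^esub> y \<in> carrier N"
    by (simp add: * add_N carrier_N) (metis \<open>s \<in> U\<close> \<open>t \<in> U\<close> unit_polys_mult[OF subr_UNIV])
  show "x \<otimes>\<^bsub>N\<^esub> y \<in> carrier N"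
    by (simp add: * mult_N carrier_N) (metis \<open>s \<in> U\<close> \<open>t \<in> U\<close> unit_polys_mult[OF subr_UNIV])
next
  note [simp] = unit_polys_1[OF subr_UNIV] unit_polys_mult[OF subr_UNIV]
  fix x assume "x \<in> carrier N"
  then obtain a s where *: "x = fr a s" "s \<in> U" unfolding carrier_N by blast
  note [simp] = *(2)
  show "\<zero>\<^bsub>N\<^esub> \<oplus>\<^bsub>N\<^esub> x = x" by (simp add: * add_N zero_N)
  show "\<one>\<^bsub>N\<^esub> \<otimes>\<^bsub>N\<^esub> x = x" by (simp add: * mult_N one_N)
  have "fr (- a) s \<oplus>\<^bsub>N\<^esub> x = \<zero>\<^bsub>N\<^esub>" by (simp add: * add_N zero_N fr_eq_iff)
  then show "\<exists>y\<in>carrier N. y \<oplus>\<^bsub>N\<^esub> x = \<zero>\<^bsub>N\<^esub>" using carrier_N *(2) by blast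
next
  show "\<one>\<^bsub>N\<^esub> \<in> carrier N" "\<zero>\<^bsub>N\<^esub> \<in> carrier N"
    using unit_polys_1[OF subr_UNIV] by (auto simp: one_N zero_N carrier_N)
qed

lemma nagata_base_eq:
  assumes R: "subring R S"
  shows "nagata_base R S = {fr a s | a s. a \<in> polys (\<pi> -` R) \<and> s \<in> unit_polys (\<pi> -` R)}"
proof -
  let ?R = "\<pi> -` R" and ?S = "S\<lparr>carrier := R\<rparr>"
  let ?\<Sigma> = "unit_content_polys (S\<lparr>carrier := R\<rparr>)"
  have sR: "subr ?R" using subr_vimage[OF R] .
  note pR = subrD[OF subr_polys[OF sR]]
  have RU: "s \<in> U" if "s \<in> unit_polys ?R" for s using that unit_polys_mono[of ?R UNIV] by blast
  have map: "nagata_map S (mk_frac (UP ?S) ?\<Sigma> (cmap a) (cmap s)) = fr a s"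
    if as: "a \<in> polys ?R" "s \<in> unit_polys ?R" for a s
  proof -
    have "mk_frac (UP S) \<Sigma> (fst x) (snd x) = fr a s" if x: "x \<in> mk_frac (UP ?S) ?\<Sigma> (cmap a) (cmap s)" for x
    proof -
      have "fst x \<in> carrier (UP ?S)" "snd x \<in> ?\<Sigma>"
        using x by (auto simp: mk_frac_def frac_rel_def)
      then obtain b t where bt: "b \<in> polys ?R" "t \<in> unit_polys ?R" "fst x = cmap b" "snd x = cmap t"
        using cmap_up_surj[OF subringE(1)[OF R]] unit_content_surj[OF R] by metis
      obtain p where p: "p \<in> ?\<Sigma>" "p \<otimes>\<^bsub>UP ?S\<^esub> (snd x \<otimes>\<^bsub>UP ?S\<^esub> cmap a) = p \<otimes>\<^bsub>UP ?S\<^esub> (cmap s \<otimes>\<^bsub>UP ?S\<^esub> fst x)"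
        using x by (auto simp: mk_frac_def frac_rel_def)
      obtain u where u: "u \<in> unit_polys ?R" "cmap u = p" using unit_content_surj[OF R p(1)] by blast
      have "cmap (u * (t * a)) = cmap (u * (s * b))"
        using p(2) unfolding u(2)[symmetric] bt(3,4)
          cmap_mult[OF R unit_polysD[OF bt(2)] as(1)] cmap_mult[OF R unit_polysD[OF as(2)] bt(1)]
          cmap_mult[OF R unit_polysD[OF u(1)] pR(4)[OF unit_polysD[OF bt(2)] as(1)]]
          cmap_mult[OF R unit_polysD[OF u(1)] pR(4)[OF unit_polysD[OF as(2)] bt(1)]] .
      then have "cmap (t * a) = cmap (s * b)" by (rule cmap_cancel[OF RU[OF u(1)]])
      then show ?thesis
        using fr_congI[OF RU[OF as(2)] RU[OF bt(2)]] by (simp add: fr_def bt(3,4))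
    qed
    moreover have "(cmap a, cmap s) \<in> mk_frac (UP ?S) ?\<Sigma> (cmap a) (cmap s)"
      using cmap_up[OF as(1)] unit_content_cmap[OF R as(2)] by (auto simp: mk_frac_def frac_rel_def)
    ultimately show ?thesis
      unfolding nagata_map_def by (intro UN_const) (auto simp: case_prod_unfold)
  qed
  have "carrier (nagata ?S) = {mk_frac (UP ?S) ?\<Sigma> p q | p q. p \<in> carrier (UP ?S) \<and> q \<in> ?\<Sigma>}"
    by (auto simp: nagata_def localization_def quotient_def mk_frac_def)
  also have "\<dots> = {mk_frac (UP ?S) ?\<Sigma> (cmap a) (cmap s) | a s. a \<in> polys ?R \<and> s \<in> unit_polys ?R}"
    using cmap_up_surj[OF subringE(1)[OF R]] unit_content_surj[OF R] cmap_up unit_content_cmap[OF R] by blast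
  finally have carr: "carrier (nagata ?S) = \<dots>" .
  show ?thesis
  proof (intro Set.set_eqI iffI)
    fix x assume "x \<in> nagata_base R S"
    then obtain y where y: "y \<in> carrier (nagata ?S)" "x = nagata_map S y"
      unfolding nagata_base_def by blast
    then obtain a s where as: "a \<in> polys ?R" "s \<in> unit_polys ?R" "y = mk_frac (UP ?S) ?\<Sigma> (cmap a) (cmap s)"
      unfolding carr by blast
    then show "x \<in> {fr a s | a s. a \<in> polys ?R \<and> s \<in> unit_polys ?R}" using map[OF as(1,2)] y(2) by blast
  next
    fix x assume "x \<in> {fr a s | a s. a \<in> polys ?R \<and> s \<in> unit_polys ?R}"
    then obtain a s where as: "x = fr a s" "a \<in> polys ?R" "s \<in> unit_polys ?R" by blast
    have "mk_frac (UP ?S) ?\<Sigma> (cmap a) (cmap s) \<in> carrier (nagata ?S)" unfolding carr using as(2,3) by blast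
    then show "x \<in> nagata_base R S"
      unfolding nagata_base_def as(1) map[OF as(2,3), symmetric] by (rule imageI)
  qed
qed

end

section \<open>Comparison of the lengths\<close>

lemma ext_length_leI:
  assumes "\<And>n T. (\<forall>i\<le>n. T i \<in> intermediate_rings R S) \<Longrightarrow> (\<forall>i<n. T i \<subset> T (Suc i)) \<Longrightarrow> enat n \<le> b"
  shows "ext_length R S \<le> b"
  unfolding ext_length_def by (rule Sup_least) (use assms in blast)

lemma ext_length_geI:
  assumes "\<forall>i\<le>n. T i \<in> intermediate_rings R S" "\<forall>i<n. T i \<subset> T (Suc i)"
  shows "enat n \<le> ext_length R S"
  unfolding ext_length_def by (rule Sup_upper) (use assms in blast)

lemma FCP_no_strict_sequence:
  fixes T :: "nat \<Rightarrow> 'a set"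
  assumes "FCP R S" "\<And>i. T i \<in> intermediate_rings R S"
  shows "\<not> (\<forall>i. T i \<subset> T (Suc i))" "\<not> (\<forall>i. T (Suc i) \<subset> T i)"
proof -
  have fin: "finite (range T)" if "\<And>i j. i \<le> j \<Longrightarrow> T i \<subseteq> T j \<or> T j \<subseteq> T i"
  proof -
    have "T i \<subseteq> T j \<or> T j \<subseteq> T i" for i j using that[of i j] that[of j i] by linarith
    then have "subset.chain (intermediate_rings R S) (range T)"
      using assms(2) by (auto simp: subset_chain_def)
    then show ?thesis using assms(1) by (auto simp: FCP_def)
  qed
  have inf: "infinite (range T)" if "\<And>i j. i < j \<Longrightarrow> T i \<noteq> T j"
    using that by (intro range_inj_infinite injI) (metis linorder_neqE_nat)
  show "\<not> (\<forall>i. T i \<subset> T (Suc i))"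
  proof
    assume *: "\<forall>i. T i \<subset> T (Suc i)"
    have "T i \<subset> T j" if "i < j" for i j using lift_Suc_mono_less[of T i j] * that by blast
    then show False using fin inf by (metis le_neq_implies_less order.refl psubset_imp_subset psubset_eq)
  qed
  show "\<not> (\<forall>i. T (Suc i) \<subset> T i)"
  proof
    assume *: "\<forall>i. T (Suc i) \<subset> T i"
    have "T j \<subset> T i" if "i < j" for i j
      using lift_Suc_mono_less[of "\<lambda>i. - T i" i j] * that by simp
    then show False using fin inf by (metis le_neq_implies_less order.refl psubset_imp_subset psubset_eq)
  qed
qed

section \<open>Transfer of chains and the two inequalities\<close>

context cring_cover
begin

lemma image_vimage_intermediate:
  assumes R: "subring R S" and T: "subr T" "\<pi> -` R \<subseteq> T"
  shows "\<pi> ` T \<in> intermediate_rings R S"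
proof -
  have "R \<subseteq> \<pi> ` T"
  proof
    fix r assume r: "r \<in> R"
    then obtain x where x: "\<pi> x = r" using pi_surj subringE(1)[OF R] by blast
    then have "x \<in> T" using r T(2) by blast
    then show "r \<in> \<pi> ` T" using x by blast
  qed
  then show ?thesis using subring_image[OF T(1)] by (simp add: intermediate_rings_def)
qed

text \<open>\<open>T\<close> contains the kernel, so no element outside \<open>T\<close> has the
  same image as one inside.\<close>

lemma image_strict:
  assumes R: "subring R S" and T: "subr T" "\<pi> -` R \<subseteq> T" and less: "T \<subset> T'"
  shows "\<pi> ` T \<subset> \<pi> ` T'"
proof -
  obtain x where x: "x \<in> T'" "x \<notin> T" using less by blast
  have "\<pi> x \<notin> \<pi> ` T"
  proof
    assume "\<pi> x \<in> \<pi> ` T"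
    then obtain y where y: "y \<in> T" "x - y \<in> ker" by (auto simp: pi_eq_iff)
    then have "(x - y) + y \<in> T" using ker_subset[OF R] T(2) subrD(6)[OF T(1)] by blast
    then show False using x by simp
  qed
  then show ?thesis using less x by blast
qed

lemma fcp_ext_vimage:
  assumes R: "subring R S" and "FCP R S"
  shows "fcp_ext (\<pi> -` R)"
proof
  show "subr (\<pi> -` R)" by (rule subr_vimage[OF R])
  show "\<nexists>T. \<forall>i::nat. subr (T i) \<and> \<pi> -` R \<subseteq> T i \<and> T i \<subset> T (Suc i)"
  proof
    assume "\<exists>T. \<forall>i::nat. subr (T i) \<and> \<pi> -` R \<subseteq> T i \<and> T i \<subset> T (Suc i)"
    then obtain T where "\<forall>i::nat. subr (T i) \<and> \<pi> -` R \<subseteq> T i \<and> T i \<subset> T (Suc i)" by (rule exE)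
    then have T: "subr (T i)" "\<pi> -` R \<subseteq> T i" "T i \<subset> T (Suc i)" for i by simp_all
    show False
    proof (rule notE[OF FCP_no_strict_sequence(1)[OF assms(2), of "\<lambda>i. \<pi> ` T i"]])
      show "\<pi> ` T i \<in> intermediate_rings R S" for i by (intro image_vimage_intermediate[OF R] T)
      show "\<forall>i. \<pi> ` T i \<subset> \<pi> ` T (Suc i)" by (intro allI image_strict[OF R] T)
    qed
  qed
  show "\<nexists>T. \<forall>i::nat. subr (T i) \<and> \<pi> -` R \<subseteq> T i \<and> T (Suc i) \<subset> T i"
  proof
    assume "\<exists>T. \<forall>i::nat. subr (T i) \<and> \<pi> -` R \<subseteq> T i \<and> T (Suc i) \<subset> T i"
    then obtain T where "\<forall>i::nat. subr (T i) \<and> \<pi> -` R \<subseteq> T i \<and> T (Suc i) \<subset> T i" by (rule exE)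
    then have T: "subr (T i)" "\<pi> -` R \<subseteq> T i" "T (Suc i) \<subset> T i" for i by simp_all
    show False
    proof (rule notE[OF FCP_no_strict_sequence(2)[OF assms(2), of "\<lambda>i. \<pi> ` T i"]])
      show "\<pi> ` T i \<in> intermediate_rings R S" for i by (intro image_vimage_intermediate[OF R] T)
      show "\<forall>i. \<pi> ` T (Suc i) \<subset> \<pi> ` T i" by (intro allI image_strict[OF R] T)
    qed
  qed
qed

lemma ext_length_nagata_le:
  assumes R: "subring R S" and fcp: "FCP R S"
  shows "ext_length (nagata_base R S) N \<le> ext_length R S"
proof (rule ext_length_leI)
  fix m T
  assume T: "\<forall>i\<le>m. T i \<in> intermediate_rings (nagata_base R S) N" and strict: "\<forall>i<m. T i \<subset> T (Suc i)"
  interpret E: fcp_ext "\<pi> -` R" by (rule fcp_ext_vimage[OF R fcp])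
  let ?R = "\<pi> -` R"
  note base = nagata_base_eq[OF R]
  have U1: "1 \<in> U" "1 \<in> unit_polys ?R" using unit_polys_1[OF subr_UNIV] unit_polys_1[OF E.R] .
  have RU: "s \<in> U" if "s \<in> unit_polys ?R" for s using that unit_polys_mono[of ?R UNIV] by blast
  have T': "subring (T i) N" "\<And>a s. a \<in> polys ?R \<Longrightarrow> s \<in> unit_polys ?R \<Longrightarrow> fr a s \<in> T i" if "i \<le> m" for i
    using T that base by (auto simp: intermediate_rings_def)
  define W where "W i = {f. fr f 1 \<in> T i}" for i
  have W: "E.sat_ring (W i)" if i: "i \<le> m" for i
  proof -
    note Ti = subringE[OF T'(1)[OF i]] and base' = T'(2)[OF i]
    note pR = subrD[OF subr_polys[OF E.R]]
    have "subr (W i)"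
      unfolding subr_def W_def mem_Collect_eq
    proof (intro conjI ballI)
      show "fr 1 1 \<in> T i" by (rule base'[OF pR(1) U1(2)])
      fix f g assume "f \<in> {f. fr f 1 \<in> T i}" "g \<in> {f. fr f 1 \<in> T i}"
      then have fg: "fr f 1 \<in> T i" "fr g 1 \<in> T i" by auto
      show "fr (f * g) 1 \<in> T i" using Ti(6)[OF fg] by (simp add: mult_N U1)
      have "fr (- 1) 1 \<in> T i" by (rule base'[OF pR(5)[OF pR(1)] U1(2)])
      then have "fr (- 1) 1 \<otimes>\<^bsub>N\<^esub> fr g 1 \<in> T i" using Ti(6) fg(2) by blast
      then have "fr f 1 \<oplus>\<^bsub>N\<^esub> (fr (- 1) 1 \<otimes>\<^bsub>N\<^esub> fr g 1) \<in> T i" using Ti(7) fg(1) by blast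
      then show "fr (f - g) 1 \<in> T i" by (simp add: mult_N add_N U1)
    qed
    moreover have "polys ?R \<subseteq> W i" using base' U1(2) by (auto simp: W_def)
    moreover have "f \<in> W i" if "s \<in> unit_polys ?R" "s * f \<in> W i" for s f
    proof -
      have "fr 1 s \<otimes>\<^bsub>N\<^esub> fr (s * f) 1 \<in> T i"
        using that base'[OF pR(1) that(1)] Ti(6) by (auto simp: W_def)
      moreover have "fr 1 s \<otimes>\<^bsub>N\<^esub> fr (s * f) 1 = fr f 1"
        using RU[OF that(1)] by (simp add: mult_N U1 fr_eq_iff)
      ultimately show ?thesis by (simp add: W_def)
    qed
    ultimately show ?thesis by (simp add: E.sat_ring_def sat_def)
  qed
  have "W i \<subset> W (Suc i)" if i: "i < m" for i
  proof -
    have sub: "T i \<subset> T (Suc i)" using strict i by blast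
    then obtain x where x: "x \<in> T (Suc i)" "x \<notin> T i" by blast
    have "x \<in> carrier N" using subringE(1)[OF T'(1)[of "Suc i"]] i x(1) by auto
    then obtain a s where as: "x = fr a s" "s \<in> U" by (auto simp: carrier_N)
    \<comment> \<open>With a denominator over \<open>R\<close>, which is invertible in the base,
      \<open>x\<close> and the polynomial \<open>a * h\<close> belong to the same intermediate
      rings.\<close>
    obtain h where h: "s * h \<in> unit_polys ?R" using E.unit_polys_divides[OF as(2)] by blast
    have eq1: "fr (s * h) 1 \<otimes>\<^bsub>N\<^esub> x = fr (a * h) 1"
      using as(2) by (simp add: as(1) mult_N U1 fr_eq_iff mult_ac)
    have eq2: "fr 1 (s * h) \<otimes>\<^bsub>N\<^esub> fr (a * h) 1 = x"
      using as(2) RU[OF h] by (simp add: as(1) mult_N U1 fr_eq_iff mult_ac)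
    have Si: "Suc i \<le> m" using i by simp
    have "fr (s * h) 1 \<otimes>\<^bsub>N\<^esub> x \<in> T (Suc i)"
      by (rule subringE(6)[OF T'(1)[OF Si] T'(2)[OF Si unit_polysD[OF h] U1(2)] x(1)])
    then have "a * h \<in> W (Suc i)" using eq1 by (simp add: W_def)
    moreover have "a * h \<notin> W i"
    proof
      assume "a * h \<in> W i"
      then have "fr 1 (s * h) \<otimes>\<^bsub>N\<^esub> fr (a * h) 1 \<in> T i"
        using subringE(6)[OF T'(1)[of i]] T'(2)[of i, OF _ subrD(1)[OF subr_polys[OF E.R]] h] i
        by (auto simp: W_def)
      then show False using eq2 x(2) by simp
    qed
    ultimately show ?thesis using sub by (auto simp: W_def)
  qed
  from E.chain_descends[of m W, OF W this] obtain n T1 where T1: "n \<ge> m" "\<forall>i\<le>n. subr (T1 i) \<and> ?R \<subseteq> T1 i"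
    "\<forall>i<n. T1 i \<subset> T1 (Suc i)" by blast
  have "enat n \<le> ext_length R S"
  proof (rule ext_length_geI[of n "\<lambda>i. \<pi> ` T1 i"])
    show "\<forall>i\<le>n. \<pi> ` T1 i \<in> intermediate_rings R S"
      using T1(2) image_vimage_intermediate[OF R] by blast
    show "\<forall>i<n. \<pi> ` T1 i \<subset> \<pi> ` T1 (Suc i)"
      using T1(2,3) image_strict[OF R] by (meson less_imp_le)
  qed
  then show "enat m \<le> ext_length R S" using T1(1) by (meson enat_ord_simps(1) order_trans)
qed

lemma ext_length_nagata_ge:
  assumes R: "subring R S"
  shows "ext_length R S \<le> ext_length (nagata_base R S) N"
proof (rule ext_length_leI)
  fix m T
  assume T: "\<forall>i\<le>m. T i \<in> intermediate_rings R S" and strict: "\<forall>i<m. T i \<subset> T (Suc i)"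
  interpret N: cring N by (rule cring_N)
  let ?R = "\<pi> -` R"
  have sR: "subr ?R" by (rule subr_vimage[OF R])
  have RU: "s \<in> U" if "s \<in> unit_polys ?R" for s using that unit_polys_mono[of ?R UNIV] by blast
  \<comment> \<open>The denominators stay over \<open>R\<close>; McCoy's theorem over
    \<open>R\<close>, for the preimage of \<open>A\<close> as a module, then separates
    \<open>Q A\<close> from \<open>Q A'\<close>.\<close>
  define Q where "Q A = {fr a s | a s. a \<in> polys (\<pi> -` A) \<and> s \<in> unit_polys ?R}" for A
  have Q: "Q A \<in> intermediate_rings (nagata_base R S) N" if A: "subring A S" "R \<subseteq> A" for A
  proof -
    have sA: "subr (\<pi> -` A)" by (rule subr_vimage[OF A(1)])
    note pA = subrD[OF subr_polys[OF sA]]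
    have RA: "polys ?R \<subseteq> polys (\<pi> -` A)" using A(2) by (intro polys_mono) auto
    have uA: "s \<in> polys (\<pi> -` A)" if "s \<in> unit_polys ?R" for s using RA unit_polysD[OF that] by blast
    have "subring (Q A) N"
    proof (rule N.subringI)
      show "Q A \<subseteq> carrier N" using RU by (auto simp: Q_def carrier_N)
      show "\<one>\<^bsub>N\<^esub> \<in> Q A" unfolding Q_def one_N using pA(1) unit_polys_1[OF sR] by blast
      fix x y assume "x \<in> Q A" "y \<in> Q A"
      then obtain a s b t where *: "x = fr a s" "y = fr b t" "a \<in> polys (\<pi> -` A)" "b \<in> polys (\<pi> -` A)"
        "s \<in> unit_polys ?R" "t \<in> unit_polys ?R" unfolding Q_def by blast
      note st = unit_polys_mult[OF sR *(5,6)] RU[OF *(5)] RU[OF *(6)]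
      show "x \<otimes>\<^bsub>N\<^esub> y \<in> Q A"
        using pA(4)[OF *(3,4)] st(1) unfolding *(1,2) mult_N[OF st(2,3)] Q_def by blast
      have "a * t + b * s \<in> polys (\<pi> -` A)" using * uA by (intro pA(6) pA(4)) auto
      then show "x \<oplus>\<^bsub>N\<^esub> y \<in> Q A" using st(1) unfolding *(1,2) add_N[OF st(2,3)] Q_def by blast
    next
      fix x assume "x \<in> Q A"
      then obtain a s where *: "x = fr a s" "a \<in> polys (\<pi> -` A)" "s \<in> unit_polys ?R"
        unfolding Q_def by blast
      have "fr (- a) s \<oplus>\<^bsub>N\<^esub> fr a s = \<zero>\<^bsub>N\<^esub>"
        using RU[OF *(3)] by (simp add: add_N zero_N fr_eq_iff unit_polys_mult unit_polys_1)
      then have "\<ominus>\<^bsub>N\<^esub> x = fr (- a) s"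
        using RU[OF *(3)] by (intro N.minus_equality) (auto simp: *(1) carrier_N)
      then show "\<ominus>\<^bsub>N\<^esub> x \<in> Q A" using pA(5)[OF *(2)] *(3) unfolding Q_def by auto
    qed
    moreover have "nagata_base R S \<subseteq> Q A"
      unfolding nagata_base_eq[OF R] Q_def using RA by blast
    ultimately show ?thesis by (simp add: intermediate_rings_def)
  qed
  have Q_strict: "Q A \<subset> Q A'" if A: "subring A S" "R \<subseteq> A" "A \<subset> A'" "A' \<subseteq> carrier S" for A A'
  proof -
    obtain c where c: "c \<in> A'" "c \<notin> A" using A(3) by blast
    then obtain x where x: "\<pi> x = c" using A(4) pi_surj by blast
    have sA: "subr (\<pi> -` A)" by (rule subr_vimage[OF A(1)])
    have sm: "smod ?R (\<pi> -` A)" using A(2) by (intro smod_subr[OF sA]) auto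
    have "0 \<in> \<pi> -` A'" using A(3) subrD(2)[OF sA] by blast
    then have "[:x:] \<in> polys (\<pi> -` A')" using c(1) x by (simp add: polys_const)
    then have "fr [:x:] 1 \<in> Q A'" unfolding Q_def using unit_polys_1[OF sR] by blast
    moreover have "fr [:x:] 1 \<notin> Q A"
    proof
      assume "fr [:x:] 1 \<in> Q A"
      then obtain a s where as: "fr [:x:] 1 = fr a s" "a \<in> polys (\<pi> -` A)" "s \<in> unit_polys ?R"
        unfolding Q_def by blast
      then have "cmap (s * [:x:]) = cmap a"
        using fr_eq_iff[OF unit_polys_1[OF subr_UNIV] RU[OF as(3)]] by simp
      then have "s * [:x:] - a \<in> polys (\<pi> -` A)"
        unfolding cmap_eq_iff using polys_mono[OF ker_subset[OF A(1)]] by blast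
      then have "(s * [:x:] - a) + a \<in> polys (\<pi> -` A)" using subrD(6)[OF subr_polys[OF sA]] as(2) by blast
      then have "s * [:x:] \<in> polys (\<pi> -` A)" by simp
      then have "[:x:] \<in> polys (\<pi> -` A)" by (rule mccoy[OF sR sm as(3)])
      then show False using c(2) x polys_const[OF subrD(2)[OF sA]] by simp
    qed
    moreover have "Q A \<subseteq> Q A'" unfolding Q_def using A(3) polys_mono[of "\<pi> -` A" "\<pi> -` A'"] by blast
    ultimately show ?thesis by blast
  qed
  show "enat m \<le> ext_length (nagata_base R S) N"
  proof (rule ext_length_geI[of m "\<lambda>i. Q (T i)"])
    show "\<forall>i\<le>m. Q (T i) \<in> intermediate_rings (nagata_base R S) N"
      using T Q by (auto simp: intermediate_rings_def)
    show "\<forall>i<m. Q (T i) \<subset> Q (T (Suc i))"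
    proof (intro allI impI)
      fix i assume i: "i < m"
      then have "T i \<in> intermediate_rings R S" "T (Suc i) \<in> intermediate_rings R S" using T by auto
      then have "subring (T i) S" "R \<subseteq> T i" "T (Suc i) \<subseteq> carrier S"
        using subringE(1) unfolding intermediate_rings_def by blast+
      then show "Q (T i) \<subset> Q (T (Suc i))" using strict i by (intro Q_strict) auto
    qed
  qed
qed

end

text \<open>
  The product of all commutative rings carried by subsets of \<open>'a\<close> is an instance of \<open>comm_ring_1\<close> that maps
  onto each of them, so that the ring theory can be done in type classes.  The factor \<open>int\<close> only
  ensures \<open>0 \<noteq> 1\<close>.
\<close>

typedef 'a all_crings =
  "{p :: int \<times> ('a ring \<Rightarrow> 'a). \<forall>S. (cring S \<longrightarrow> snd p S \<in> carrier S) \<and> (\<not> cring S \<longrightarrow> snd p S = undefined)}"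
proof -
  have "(0, \<lambda>S. if cring S then \<zero>\<^bsub>S\<^esub> else undefined) \<in>
      {p :: int \<times> ('a ring \<Rightarrow> 'a). \<forall>S. (cring S \<longrightarrow> snd p S \<in> carrier S) \<and> (\<not> cring S \<longrightarrow> snd p S = undefined)}"
    by (auto intro: ring.ring_simprules cring.axioms)
  then show ?thesis by blast
qed

setup_lifting type_definition_all_crings

instantiation all_crings :: (type) comm_ring_1
begin

lift_definition zero_all_crings :: "'a all_crings"
  is "(0, \<lambda>S. if cring S then \<zero>\<^bsub>S\<^esub> else undefined)"
  by (auto intro: ring.ring_simprules cring.axioms)

lift_definition one_all_crings :: "'a all_crings"
  is "(1, \<lambda>S. if cring S then \<one>\<^bsub>S\<^esub> else undefined)"
  by (auto intro: ring.ring_simprules cring.axioms)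

lift_definition plus_all_crings :: "'a all_crings \<Rightarrow> 'a all_crings \<Rightarrow> 'a all_crings"
  is "\<lambda>p q. (fst p + fst q, \<lambda>S. if cring S then snd p S \<oplus>\<^bsub>S\<^esub> snd q S else undefined)"
  by (auto intro: ring.ring_simprules cring.axioms)

lift_definition times_all_crings :: "'a all_crings \<Rightarrow> 'a all_crings \<Rightarrow> 'a all_crings"
  is "\<lambda>p q. (fst p * fst q, \<lambda>S. if cring S then snd p S \<otimes>\<^bsub>S\<^esub> snd q S else undefined)"
  by (auto intro: ring.ring_simprules cring.axioms)

lift_definition uminus_all_crings :: "'a all_crings \<Rightarrow> 'a all_crings"
  is "\<lambda>p. (- fst p, \<lambda>S. if cring S then \<ominus>\<^bsub>S\<^esub> snd p S else undefined)"
  by (auto intro: ring.ring_simprules cring.axioms)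

definition minus_all_crings :: "'a all_crings \<Rightarrow> 'a all_crings \<Rightarrow> 'a all_crings" where
  "minus_all_crings p q = p + - q"

instance
proof
  fix a b c :: "'a all_crings"
  show "a + b + c = a + (b + c)"
    by transfer (auto simp: fun_eq_iff cring.cring_simprules)
  show "a + b = b + a"
    by transfer (auto simp: fun_eq_iff cring.cring_simprules(10))
  show "0 + a = a"
    by transfer (auto simp: fun_eq_iff prod_eq_iff cring.cring_simprules)
  show "- a + a = 0"
    by transfer (auto simp: fun_eq_iff cring.cring_simprules)
  show "a - b = a + - b"
    by (rule minus_all_crings_def)
  show "a * b * c = a * (b * c)"
    by transfer (auto simp: fun_eq_iff cring.cring_simprules)
  show "a * b = b * a"
    by transfer (auto simp: fun_eq_iff cring.cring_simprules(14))
  show "1 * a = a"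
    by transfer (auto simp: fun_eq_iff prod_eq_iff cring.cring_simprules)
  show "(a + b) * c = a * c + b * c"
    by transfer (auto simp: fun_eq_iff cring.cring_simprules distrib_right)
  show "(0::'a all_crings) \<noteq> 1"
    by transfer auto
qed

end

text \<open>The product is indexed by \<open>'a ring\<close>, so the extra record fields of
  \<open>S\<close> are dropped.\<close>

definition core_ring :: "('a, 'm) ring_scheme \<Rightarrow> 'a ring" where
  "core_ring S = \<lparr>carrier = carrier S, monoid.mult = monoid.mult S, one = one S, zero = zero S, add = add S\<rparr>"

lemma cring_core_ring:
  assumes "cring S" shows "cring (core_ring S)"
proof -
  interpret cring S by fact
  show ?thesis
    by (intro cringI abelian_groupI comm_monoidI)
      (auto simp: core_ring_def a_assoc m_assoc l_distr intro: a_comm m_comm l_neg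
        bexI[of _ "\<ominus>\<^bsub>S\<^esub> _"])
qed

lemma cring_cover_exists:
  assumes "cring S"
  shows "cring_cover S (\<lambda>u. snd (Rep_all_crings u) (core_ring S))"
proof -
  interpret cring S by fact
  let ?C = "core_ring S"
  have C: "cring ?C" by (rule cring_core_ring[OF assms])
  have [simp]: "carrier ?C = carrier S" "monoid.mult ?C = monoid.mult S" "one ?C = one S" "add ?C = add S"
    by (simp_all add: core_ring_def)
  show ?thesis
  proof (unfold_locales)
    fix u v :: "'a all_crings"
    show "snd (Rep_all_crings u) ?C \<in> carrier S" using Rep_all_crings[of u] C by auto
    show "snd (Rep_all_crings (u + v)) ?C = snd (Rep_all_crings u) ?C \<oplus>\<^bsub>S\<^esub> snd (Rep_all_crings v) ?C"
      using C by (simp add: plus_all_crings.rep_eq)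
    show "snd (Rep_all_crings (u * v)) ?C = snd (Rep_all_crings u) ?C \<otimes>\<^bsub>S\<^esub> snd (Rep_all_crings v) ?C"
      using C by (simp add: times_all_crings.rep_eq)
    show "snd (Rep_all_crings 1) ?C = \<one>\<^bsub>S\<^esub>"
      using C by (simp add: one_all_crings.rep_eq)
  next
    fix a assume a: "a \<in> carrier S"
    \<comment> \<open>The preimage of \<open>a\<close> in the product: component \<open>a\<close> at
      \<open>S\<close> and zero in every other ring.\<close>
    define p :: "int \<times> ('a ring \<Rightarrow> 'a)" where
      "p = (0, \<lambda>T. if cring T then if T = ?C then a else \<zero>\<^bsub>T\<^esub> else undefined)"
    have "Rep_all_crings (Abs_all_crings p) = p"
      using a by (intro Abs_all_crings_inverse) (auto simp: p_def intro: cring.cring_simprules)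
    then show "\<exists>u. snd (Rep_all_crings u) ?C = a"
      using C by (intro exI[of _ "Abs_all_crings p"]) (simp add: p_def)
  qed
qed

theorem theorem3p3:
  fixes S :: "('a, 'm) ring_scheme" and R :: "'a set"
  assumes "cring S"
    and "subring R S"
    and "R \<subset> carrier S"
    and "FCP R S"
  shows "ext_length R S = ext_length (nagata_base R S) (nagata S)"
proof -
  interpret cring_cover S "\<lambda>u. snd (Rep_all_crings u) (core_ring S)"
    by (rule cring_cover_exists[OF assms(1)])
  show ?thesis
    using ext_length_nagata_le[OF assms(2,4)] ext_length_nagata_ge[OF assms(2)] by (rule antisym[rotated])
qed

end
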